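(* Let $A$ be a standard $\mathbb{N}$-graded algebra over an Artinian local ring $A_0$. Let $I_1,\ldots,I_t$ be homogeneous ideals of $A$, and let $M$ be a finitely generated $\mathbb{N}$-graded $A$-module. Then there exist two integers $k$ and $k'$ such that $$\mathrm{reg}(I_1^{n_1}\cdots I_t^{n_t} M) \le (n_1 + \cdots + n_t) k + k' \quad\text{for all } n_1,\ldots,n_t \in \mathbb{N}.$$
   Context: All rings are commutative Noetherian with identity; $\mathbb{N}$ is the set of non-negative integers and $t$ is a positive integer. Standard means that $A = A_0[A_1]$, i.e. $A=A_0[x_1,\ldots,x_d]$ with $x_j\in A_1$. Let $A_+$ be the ideal of $A$ generated by the homogeneous elements of positive degree. For a finitely generated $\mathbb{N}$-graded $A$-module $E$, let $H^i_{A_+}(E)$ be its $i$th local cohomology module with respect to $A_+$ and let $a_i(E) := \max\{\mu : H^i_{A_+}(E)_\mu\ne0\}$ if $H^i_{A_+}(E)\neq 0$, and $a_i(E):=-\infty$ if $H^i_{A_+}(E)=0$. The Castelnuovo-Mumford regularity of $E$ is $\mathrm{reg}(E) := \max\{a_i(E)+i : i\ge0\}$. *)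

theory Defs
  imports "HOL-Algebra.Algebra" "HOL-Library.Extended_Real"
begin

section \<open>Rings\<close>

definition artinian_ring :: "('a, 'b) ring_scheme \<Rightarrow> bool" where
  "artinian_ring R \<longleftrightarrow> ring R \<and>
     (\<forall>C :: nat \<Rightarrow> 'a set. (\<forall>n. ideal (C n) R \<and> C (Suc n) \<subseteq> C n) \<longrightarrow>
        (\<exists>N. \<forall>n\<ge>N. C n = C N))"

definition local_ring :: "('a, 'b) ring_scheme \<Rightarrow> bool" where
  "local_ring R \<longleftrightarrow> cring R \<and> (\<exists>!\<mm>. maximalideal \<mm> R)"


section \<open>Graded rings and graded modules\<close>

definition internal_direct_sum :: "('m, 'b) ring_scheme \<Rightarrow> ('i \<Rightarrow> 'm set) \<Rightarrow> bool" where
  "internal_direct_sum G H \<longleftrightarrow>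
     (\<forall>i. subgroup (H i) (add_monoid G)) \<and>
     (\<forall>x\<in>carrier G. \<exists>!c. (\<forall>i. c i \<in> H i) \<and> finite {i. c i \<noteq> \<zero>\<^bsub>G\<^esub>} \<and>
        x = (\<Oplus>\<^bsub>G\<^esub>i\<in>{i. c i \<noteq> \<zero>\<^bsub>G\<^esub>}. c i))"

record 'a graded_ring = "'a ring" +
  degree_part :: "nat \<Rightarrow> 'a set"

text \<open>Modules are graded by the integers; an \<open>\<nat>\<close>-graded module is one without
  non-zero elements in negative degrees.\<close>

record ('a, 'm) graded_module = "('a, 'm) module" +
  component :: "int \<Rightarrow> 'm set"

locale graded_ring = cring A for A :: "'a graded_ring" (structure) +
  assumes decomposition: "internal_direct_sum A (degree_part A)"
    and one_degree: "\<one> \<in> degree_part A 0"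
    and mult_degree: "\<And>m n a b. a \<in> degree_part A m \<Longrightarrow> b \<in> degree_part A n \<Longrightarrow>
          a \<otimes> b \<in> degree_part A (m + n)"

locale graded_module = graded_ring A + module A M
  for A :: "'a graded_ring" and M :: "('a, 'm) graded_module" +
  assumes module_decomposition: "internal_direct_sum M (component M)"
    and smult_degree: "\<And>n \<mu> a x. a \<in> degree_part A n \<Longrightarrow> x \<in> component M \<mu> \<Longrightarrow>
          a \<odot>\<^bsub>M\<^esub> x \<in> component M (int n + \<mu>)"

definition degree_zero_ring :: "'a graded_ring \<Rightarrow> 'a graded_ring" where
  "degree_zero_ring A = A\<lparr>carrier := degree_part A 0\<rparr>"

definition standard_graded :: "'a graded_ring \<Rightarrow> bool" where
  "standard_graded A \<longleftrightarrow> graded_ring A \<and>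
     (\<exists>G. G \<subseteq> degree_part A 1 \<and> finite G \<and> generate_ring A (degree_part A 0 \<union> G) = carrier A)"

definition irrelevant_ideal :: "'a graded_ring \<Rightarrow> 'a set" where
  "irrelevant_ideal A = Idl\<^bsub>A\<^esub> (\<Union>n\<in>{0<..}. degree_part A n)"

definition homogeneous_ideal :: "'a graded_ring \<Rightarrow> 'a set \<Rightarrow> bool" where
  "homogeneous_ideal A I \<longleftrightarrow> ideal I A \<and> (\<exists>S. S \<subseteq> (\<Union>n. degree_part A n) \<and> I = Idl\<^bsub>A\<^esub> S)"

definition module_span :: "('a, 'b) ring_scheme \<Rightarrow> ('a, 'm, 'c) module_scheme \<Rightarrow> 'm set \<Rightarrow> 'm set" where
  "module_span R M S = \<Inter>{N. submodule N R M \<and> S \<subseteq> N}"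

definition fin_gen_module :: "('a, 'b) ring_scheme \<Rightarrow> ('a, 'm, 'c) module_scheme \<Rightarrow> bool" where
  "fin_gen_module R M \<longleftrightarrow> (\<exists>S. S \<subseteq> carrier M \<and> finite S \<and> module_span R M S = carrier M)"

definition nat_graded :: "('a, 'm) graded_module \<Rightarrow> bool" where
  "nat_graded M \<longleftrightarrow> (\<forall>\<mu><0. component M \<mu> = {\<zero>\<^bsub>M\<^esub>})"

definition graded_submodule :: "('a, 'm) graded_module \<Rightarrow> 'm set \<Rightarrow> ('a, 'm) graded_module" where
  "graded_submodule M N = M\<lparr>carrier := N, component := (\<lambda>\<mu>. N \<inter> component M \<mu>)\<rparr>"

definition ideal_times_module ::
    "'a graded_ring \<Rightarrow> 'a set \<Rightarrow> ('a, 'm) graded_module \<Rightarrow> ('a, 'm) graded_module" where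
  "ideal_times_module A J M =
     graded_submodule M (module_span A M {a \<odot>\<^bsub>M\<^esub> x | a x. a \<in> J \<and> x \<in> carrier M})"

text \<open>The monoid \<open>ideals_set A\<close> has the product of ideals as multiplication and the unit
  ideal as unit, so \<open>I\<^sup>0 = A\<close>.\<close>

definition power_product :: "'a graded_ring \<Rightarrow> nat \<Rightarrow> (nat \<Rightarrow> 'a set) \<Rightarrow> (nat \<Rightarrow> nat) \<Rightarrow> 'a set" where
  "power_product A t I n = (\<Otimes>\<^bsub>ideals_set A\<^esub>j\<in>{1..t}. I j [^]\<^bsub>ideals_set A\<^esub> n j)"

definition graded_hom ::
    "'a graded_ring \<Rightarrow> ('a, 'm) graded_module \<Rightarrow> ('a, 'n) graded_module \<Rightarrow> ('m \<Rightarrow> 'n) set" where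
  "graded_hom A M N = {f. f \<in> carrier M \<rightarrow> carrier N \<and>
     (\<forall>x\<in>carrier M. \<forall>y\<in>carrier M. f (x \<oplus>\<^bsub>M\<^esub> y) = f x \<oplus>\<^bsub>N\<^esub> f y) \<and>
     (\<forall>a\<in>carrier A. \<forall>x\<in>carrier M. f (a \<odot>\<^bsub>M\<^esub> x) = a \<odot>\<^bsub>N\<^esub> f x) \<and>
     (\<forall>\<mu>. f ` component M \<mu> \<subseteq> component N \<mu>)}"


section \<open>Graded injective resolutions\<close>

text \<open>Injective objects of the category of graded modules whose elements are taken from one
  type \<open>'u\<close>. If \<open>'u\<close> is infinite and at least as large as the type of the ring, this
  category contains copies of all homogeneous ideals and of all shifts of \<open>A\<close>, so by the
  graded version of Baer's criterion these are exactly the graded modules that are injective in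
  the category of all graded modules.\<close>

definition graded_injective :: "'a graded_ring \<Rightarrow> ('a, 'u) graded_module \<Rightarrow> bool" where
  "graded_injective A Q \<longleftrightarrow> graded_module A Q \<and>
     (\<forall>(N :: ('a, 'u) graded_module) (N' :: ('a, 'u) graded_module) f g.
        graded_module A N \<and> graded_module A N' \<and>
        f \<in> graded_hom A N N' \<and> inj_on f (carrier N) \<and> g \<in> graded_hom A N Q \<longrightarrow>
        (\<exists>h \<in> graded_hom A N' Q. \<forall>x\<in>carrier N. h (f x) = g x))"

definition graded_injective_resolution ::
    "'a graded_ring \<Rightarrow> ('a, 'm) graded_module \<Rightarrow> (nat \<Rightarrow> ('a, 'u) graded_module) \<Rightarrow>
     ('m \<Rightarrow> 'u) \<Rightarrow> (nat \<Rightarrow> 'u \<Rightarrow> 'u) \<Rightarrow> bool" where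
  "graded_injective_resolution A E Q \<epsilon> d \<longleftrightarrow>
     graded_module A E \<and>
     (\<forall>i. graded_injective A (Q i)) \<and>
     \<epsilon> \<in> graded_hom A E (Q 0) \<and> inj_on \<epsilon> (carrier E) \<and>
     (\<forall>i. d i \<in> graded_hom A (Q i) (Q (Suc i))) \<and>
     \<epsilon> ` carrier E = {x \<in> carrier (Q 0). d 0 x = \<zero>\<^bsub>Q 1\<^esub>} \<and>
     (\<forall>i. d i ` carrier (Q i) = {x \<in> carrier (Q (Suc i)). d (Suc i) x = \<zero>\<^bsub>Q (Suc (Suc i))\<^esub>})"

text \<open>A type that holds an injective resolution of every graded module \<open>E\<close> with elements
  of type \<open>'m\<close> over a Noetherian graded ring \<open>A\<close> with elements of type \<open>'a\<close>. Put
  \<open>\<kappa> = max (|'a|, |'m|, \<aleph>\<^sub>0)\<close>, the cardinality of this type. Ideals of \<open>A\<close>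
  are finitely generated, so a graded module with at most \<open>\<kappa>\<close> elements has at most
  \<open>\<kappa>\<close> homomorphisms into it from shifted homogeneous ideals; adjoining extensions of all
  of them to \<open>A\<close>, and repeating this countably often, embeds it into a graded injective module
  with at most \<open>\<kappa>\<close> elements.\<close>

type_synonym ('a, 'm) universe = "('a \<times> 'm) list"


section \<open>Local cohomology and regularity\<close>

definition torsion_functor ::
    "'a graded_ring \<Rightarrow> 'a set \<Rightarrow> ('a, 'm) graded_module \<Rightarrow> ('a, 'm) graded_module" where
  "torsion_functor A I E = graded_submodule E
     {x \<in> carrier E. \<exists>n::nat. \<forall>a \<in> I [^]\<^bsub>ideals_set A\<^esub> n. a \<odot>\<^bsub>E\<^esub> x = \<zero>\<^bsub>E\<^esub>}"

text \<open>The degree \<open>\<mu>\<close> part of the \<open>i\<close>-th cohomology module of a complex of graded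
  modules, as an abelian group.\<close>

definition cohomology_component ::
    "(nat \<Rightarrow> ('a, 'u) graded_module) \<Rightarrow> (nat \<Rightarrow> 'u \<Rightarrow> 'u) \<Rightarrow> nat \<Rightarrow> int \<Rightarrow> 'u set monoid" where
  "cohomology_component C d i \<mu> =
     (C i)\<lparr>carrier := {x \<in> component (C i) \<mu>. d i x = \<zero>\<^bsub>C (Suc i)\<^esub>}\<rparr>
       A_Mod (if i = 0 then {\<zero>\<^bsub>C 0\<^esub>} else d (i - 1) ` component (C (i - 1)) \<mu>)"

text \<open>\<open>H\<^sup>i\<^sub>I(E)\<^sub>\<mu> \<noteq> 0\<close>, where \<open>H\<^sup>i\<^sub>I\<close> is the \<open>i\<close>-th right derived
  functor of the \<open>I\<close>-torsion functor on graded modules. The cohomology does not depend, up to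
  isomorphism, on the resolution, and a resolution over \<open>universe\<close> exists.\<close>

definition local_cohomology_nonzero ::
    "'a graded_ring \<Rightarrow> 'a set \<Rightarrow> nat \<Rightarrow> ('a, 'm) graded_module \<Rightarrow> int \<Rightarrow> bool" where
  "local_cohomology_nonzero A I i E \<mu> \<longleftrightarrow>
     (\<exists>(Q :: nat \<Rightarrow> ('a, ('a, 'm) universe) graded_module) \<epsilon> d.
        graded_injective_resolution A E Q \<epsilon> d \<and>
        \<not> trivial_group (cohomology_component (\<lambda>j. torsion_functor A I (Q j)) d i \<mu>))"

text \<open>The supremum of the empty set is \<open>-\<infinity>\<close>.\<close>

definition a_invariant :: "'a graded_ring \<Rightarrow> nat \<Rightarrow> ('a, 'm) graded_module \<Rightarrow> ereal" where
  "a_invariant A i E =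
     Sup {ereal (of_int \<mu>) | \<mu>. local_cohomology_nonzero A (irrelevant_ideal A) i E \<mu>}"

definition regularity :: "'a graded_ring \<Rightarrow> ('a, 'm) graded_module \<Rightarrow> ereal" where
  "regularity A E = (SUP i. a_invariant A i E + ereal (of_nat i))"

end

theory Submission
  imports Defs
begin

text \<open>Local cohomology is computed from a graded injective resolution \<open>Q\<close> of \<open>E\<close>. For generators
  \<open>xs\<close> of \<open>A\<^sub>+\<close> of degree 1, multiplication by a member of \<open>xs\<close> on \<open>Q\<close> is surjective up to torsion, so an
  induction on \<open>xs\<close> shows that vanishing of the Koszul cohomology of \<open>E\<close> in degrees \<open>\<ge> \<mu>\<close> forces
  vanishing of local cohomology in degree \<open>\<mu>\<close>. It remains to bound the Koszul cohomology of
  \<open>I\<^sub>1\<^bsup>n\<^sub>1\<^esup> \<cdots> I\<^sub>t\<^bsup>n\<^sub>t\<^esup> M\<close>, uniformly in \<open>n\<close>. The sum of these Koszul complexes over all \<open>n\<close> is a finitely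
  generated module over the Rees algebra, whose cocycles are finitely generated. Because the members of
  \<open>xs\<close> annihilate the cohomology, the latter is already generated over \<open>A\<^sub>0\<close> and the generators of the
  \<open>I\<^sub>j\<close>; each factor from \<open>I\<^sub>j\<close> raises \<open>n\<^sub>1 + \<cdots> + n\<^sub>t\<close> by one and the degree by at most a constant
  \<open>k\<close>, whence the linear bound.\<close>

section \<open>Groups with a Noetherian family of operators\<close>

text \<open>The modules involved vary with the exponents n, the Koszul degree and the step of the
  resolution, whereas a carrier has one element type. So every complex is placed in one product
  module with one differential, and degrees are recorded by families of subgroups
  \<open>C i \<mu>\<close>; quotient complexes are replaced by conditions on representatives. The
  Rees algebra occurs only as a set of commuting operators, which is why Hilbert's basis theorem is
  proved for groups with operators. The operators must be homogeneous: a cocycle is a sum of words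
  in them applied to finitely many cocycles, each word has a multidegree, and projecting to one
  multidegree isolates the words that matter. Vanishing in all internal degrees from \<mu> on is
  needed because the induction on torsion exponents replaces z by x z, one degree higher. The
  argument works for every resolution, since nonvanishing of local cohomology only supplies some
  resolution. Koszul cohomology is zero above \<open>length xs\<close>, and this turns the summand i
  of the regularity into a constant.\<close>

definition additive_map :: "('a, 'r) ring_scheme \<Rightarrow> ('b, 's) ring_scheme \<Rightarrow> ('a \<Rightarrow> 'b) \<Rightarrow> bool" where
  "additive_map G H f \<longleftrightarrow> f \<in> carrier G \<rightarrow> carrier H \<and>
     (\<forall>x\<in>carrier G. \<forall>y\<in>carrier G. f (x \<oplus>\<^bsub>G\<^esub> y) = f x \<oplus>\<^bsub>H\<^esub> f y)"

lemma additive_map_closed: "additive_map G H f \<Longrightarrow> x \<in> carrier G \<Longrightarrow> f x \<in> carrier H"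
  unfolding additive_map_def by auto

lemma additive_map_add:
  "additive_map G H f \<Longrightarrow> x \<in> carrier G \<Longrightarrow> y \<in> carrier G \<Longrightarrow> f (x \<oplus>\<^bsub>G\<^esub> y) = f x \<oplus>\<^bsub>H\<^esub> f y"
  unfolding additive_map_def by auto

lemma additive_map_hom:
  assumes "abelian_group G" "abelian_group H" "additive_map G H f"
  shows "abelian_group_hom G H f"
  using assms unfolding additive_map_def
  by (intro abelian_group_homI group_hom.intro group_hom_axioms.intro
      abelian_group.a_group) (auto simp: hom_def)

lemma additive_map_zero:
  assumes "abelian_group G" "abelian_group H" "additive_map G H f"
  shows "f \<zero>\<^bsub>G\<^esub> = \<zero>\<^bsub>H\<^esub>"
  using abelian_group_hom.hom_zero[OF additive_map_hom[OF assms]] .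

lemma additive_map_neg:
  assumes "abelian_group G" "abelian_group H" "additive_map G H f" "x \<in> carrier G"
  shows "f (\<ominus>\<^bsub>G\<^esub> x) = \<ominus>\<^bsub>H\<^esub> f x"
  using abelian_group_hom.hom_a_inv[OF additive_map_hom[OF assms(1-3)] assms(4)] .

lemma additive_map_minus:
  assumes "abelian_group G" "abelian_group H" "additive_map G H f" "x \<in> carrier G" "y \<in> carrier G"
  shows "f (x \<ominus>\<^bsub>G\<^esub> y) = f x \<ominus>\<^bsub>H\<^esub> f y"
proof -
  have "f (x \<oplus>\<^bsub>G\<^esub> (\<ominus>\<^bsub>G\<^esub> y)) = f x \<oplus>\<^bsub>H\<^esub> f (\<ominus>\<^bsub>G\<^esub> y)"
    using assms by (intro additive_map_add) (auto intro: abelian_group.a_inv_closed)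
  then show ?thesis
    using additive_map_neg[OF assms(1-3,5)] by (simp add: a_minus_def)
qed

lemma (in module) smult_additive_map: "a \<in> carrier R \<Longrightarrow> additive_map M M (\<lambda>x. a \<odot>\<^bsub>M\<^esub> x)"
  unfolding additive_map_def by (auto simp: smult_r_distr)

lemma (in abelian_group) additive_subgroupI2:
  assumes "H \<subseteq> carrier G" "\<zero> \<in> H" "\<And>x y. x \<in> H \<Longrightarrow> y \<in> H \<Longrightarrow> x \<oplus> y \<in> H"
    "\<And>x. x \<in> H \<Longrightarrow> \<ominus> x \<in> H"
  shows "additive_subgroup H G"
  using assms by (intro additive_subgroupI subgroup.intro) (auto simp: a_inv_def)

lemma (in abelian_group) additive_subgroup_neg:
  assumes "additive_subgroup H G" "x \<in> H" shows "\<ominus> x \<in> H"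
  using subgroup.m_inv_closed[OF additive_subgroup.a_subgroup[OF assms(1)] assms(2)]
  by (simp add: a_inv_def)

lemma (in abelian_group) additive_subgroup_minus:
  assumes "additive_subgroup H G" "x \<in> H" "y \<in> H" shows "x \<ominus> y \<in> H"
  using assms additive_subgroup_neg[OF assms(1,3)]
  by (simp add: a_minus_def additive_subgroup.a_closed)

section \<open>Spans under families of operators\<close>

inductive_set words :: "('m \<Rightarrow> 'm) set \<Rightarrow> 'm set \<Rightarrow> 'm set" for \<Phi> S where
  base: "s \<in> S \<Longrightarrow> s \<in> words \<Phi> S"
| step: "w \<in> words \<Phi> S \<Longrightarrow> \<phi> \<in> \<Phi> \<Longrightarrow> \<phi> w \<in> words \<Phi> S"

inductive_set add_span :: "('m, 'r) ring_scheme \<Rightarrow> 'm set \<Rightarrow> 'm set" for G T where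
  zero: "\<zero>\<^bsub>G\<^esub> \<in> add_span G T"
| incl: "t \<in> T \<Longrightarrow> t \<in> add_span G T"
| neg: "x \<in> add_span G T \<Longrightarrow> \<ominus>\<^bsub>G\<^esub> x \<in> add_span G T"
| add: "x \<in> add_span G T \<Longrightarrow> y \<in> add_span G T \<Longrightarrow> x \<oplus>\<^bsub>G\<^esub> y \<in> add_span G T"

text \<open>The submodule generated by \<open>S\<close> over the ring of endomorphisms that
  \<open>\<Phi>\<close> generates, described by words so that this ring need not be built.\<close>

definition op_span :: "('m, 'r) ring_scheme \<Rightarrow> ('m \<Rightarrow> 'm) set \<Rightarrow> 'm set \<Rightarrow> 'm set" where
  "op_span G \<Phi> S = add_span G (words \<Phi> S)"

definition op_closed :: "('m, 'r) ring_scheme \<Rightarrow> ('m \<Rightarrow> 'm) set \<Rightarrow> 'm set \<Rightarrow> bool" where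
  "op_closed G \<Phi> N \<longleftrightarrow> additive_subgroup N G \<and> (\<forall>\<phi>\<in>\<Phi>. \<phi> ` N \<subseteq> N)"

text \<open>Stated for arbitrary subsets \<open>S\<close>, with the finite set chosen inside
  \<open>S\<close>. This later yields generators of the cocycles that are themselves homogeneous
  cocycles.\<close>

definition op_noetherian :: "('m, 'r) ring_scheme \<Rightarrow> ('m \<Rightarrow> 'm) set \<Rightarrow> 'm set \<Rightarrow> bool" where
  "op_noetherian G \<Phi> N \<longleftrightarrow> (\<forall>S\<subseteq>N. \<exists>S'\<subseteq>S. finite S' \<and> S \<subseteq> op_span G \<Phi> S')"

lemma words_mono: "S \<subseteq> T \<Longrightarrow> \<Phi> \<subseteq> \<Psi> \<Longrightarrow> words \<Phi> S \<subseteq> words \<Psi> T"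
proof
  fix x assume "S \<subseteq> T" "\<Phi> \<subseteq> \<Psi>" "x \<in> words \<Phi> S"
  from this(3,1,2) show "x \<in> words \<Psi> T"
    by (induction) (auto intro: words.intros)
qed

lemma add_span_mono: "S \<subseteq> T \<Longrightarrow> add_span G S \<subseteq> add_span G T"
proof
  fix x assume "S \<subseteq> T" "x \<in> add_span G S"
  from this(2,1) show "x \<in> add_span G T"
    by induction (auto intro: add_span.intros)
qed

lemma op_span_mono: "S \<subseteq> T \<Longrightarrow> \<Phi> \<subseteq> \<Psi> \<Longrightarrow> op_span G \<Phi> S \<subseteq> op_span G \<Psi> T"
  unfolding op_span_def by (intro add_span_mono words_mono)

lemma op_span_incl: "S \<subseteq> op_span G \<Phi> S"
  unfolding op_span_def by (auto intro: add_span.incl words.base)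

context abelian_group
begin

lemma add_span_subgroup:
  assumes "T \<subseteq> carrier G"
  shows "additive_subgroup (add_span G T) G"
proof (rule additive_subgroupI2)
  show "add_span G T \<subseteq> carrier G"
  proof
    fix x assume "x \<in> add_span G T" then show "x \<in> carrier G"
      using assms by induction auto
  qed
qed (auto intro: add_span.intros)

lemma add_span_minimal:
  assumes "T \<subseteq> H" "additive_subgroup H G"
  shows "add_span G T \<subseteq> H"
proof
  fix x assume "x \<in> add_span G T" then show "x \<in> H"
    using assms
    by induction (auto intro: additive_subgroup.zero_closed additive_subgroup.a_closed additive_subgroup_neg)
qed

text \<open>The target \<open>H\<close> is free: it serves both with \<open>H\<close> a span that is
  to be closed under an operator and with \<open>H\<close> the coboundaries in
  \<open>koszul_vanishing\<close>.\<close>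

lemma add_span_image:
  assumes "T \<subseteq> carrier G" "additive_map G G f" "\<And>t. t \<in> T \<Longrightarrow> f t \<in> H" "additive_subgroup H G"
    "x \<in> add_span G T"
  shows "f x \<in> H"
proof -
  have sub: "add_span G T \<subseteq> carrier G"
    using add_span_subgroup[OF assms(1)] additive_subgroup.a_subset by blast
  show ?thesis
    using assms(5)
  proof induction
    case zero show ?case
      using additive_map_zero[OF abelian_group_axioms abelian_group_axioms assms(2)]
        additive_subgroup.zero_closed[OF assms(4)] by simp
  next
    case (neg x) then show ?case
      using additive_map_neg[OF abelian_group_axioms abelian_group_axioms assms(2), of x] sub
        additive_subgroup_neg[OF assms(4)] by auto
  next
    case (add x y)
    then have "f (x \<oplus> y) = f x \<oplus> f y" using sub by (intro additive_map_add[OF assms(2)]) auto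
    then show ?case using add additive_subgroup.a_closed[OF assms(4)] by simp
  qed (auto simp: assms)
qed

definition operators :: "('a \<Rightarrow> 'a) set \<Rightarrow> bool" where
  "operators \<Phi> \<longleftrightarrow> (\<forall>\<phi>\<in>\<Phi>. additive_map G G \<phi>)"

lemma words_carrier:
  assumes "operators \<Phi>" "S \<subseteq> carrier G" shows "words \<Phi> S \<subseteq> carrier G"
proof
  fix x assume "x \<in> words \<Phi> S" then show "x \<in> carrier G"
    using assms by induction (auto simp: operators_def intro: additive_map_closed)
qed

lemma op_span_closed:
  assumes "operators \<Phi>" "S \<subseteq> carrier G" shows "op_closed G \<Phi> (op_span G \<Phi> S)"
  unfolding op_closed_def
proof (intro conjI ballI)
  show sg: "additive_subgroup (op_span G \<Phi> S) G"
    unfolding op_span_def by (intro add_span_subgroup words_carrier assms)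
  fix \<phi> assume p: "\<phi> \<in> \<Phi>"
  show "\<phi> ` op_span G \<Phi> S \<subseteq> op_span G \<Phi> S"
  proof clarify
    fix x assume "x \<in> op_span G \<Phi> S"
    then have x: "x \<in> add_span G (words \<Phi> S)" by (simp add: op_span_def)
    show "\<phi> x \<in> op_span G \<Phi> S"
      by (rule add_span_image[OF words_carrier[OF assms] _ _ sg x])
        (use p assms in \<open>auto simp: operators_def op_span_def intro: add_span.incl words.step\<close>)
  qed
qed

lemma op_closed_carrier: "op_closed G \<Phi> N \<Longrightarrow> N \<subseteq> carrier G"
  unfolding op_closed_def by (auto dest: additive_subgroup.a_subset)

lemma op_closed_add: "op_closed G \<Phi> N \<Longrightarrow> x \<in> N \<Longrightarrow> y \<in> N \<Longrightarrow> x \<oplus> y \<in> N"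
  unfolding op_closed_def by (auto dest: additive_subgroup.a_closed)

lemma op_closed_zero: "op_closed G \<Phi> N \<Longrightarrow> \<zero> \<in> N"
  unfolding op_closed_def by (auto dest: additive_subgroup.zero_closed)

lemma op_closed_neg: "op_closed G \<Phi> N \<Longrightarrow> x \<in> N \<Longrightarrow> \<ominus> x \<in> N"
  unfolding op_closed_def by (auto dest: additive_subgroup_neg)

lemma op_closed_minus: "op_closed G \<Phi> N \<Longrightarrow> x \<in> N \<Longrightarrow> y \<in> N \<Longrightarrow> x \<ominus> y \<in> N"
  unfolding op_closed_def by (auto dest: additive_subgroup_minus)

lemma op_closed_op: "op_closed G \<Phi> N \<Longrightarrow> \<phi> \<in> \<Phi> \<Longrightarrow> x \<in> N \<Longrightarrow> \<phi> x \<in> N"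
  unfolding op_closed_def by auto

lemma op_closedI:
  assumes "N \<subseteq> carrier G" "\<zero> \<in> N" "\<And>x y. x \<in> N \<Longrightarrow> y \<in> N \<Longrightarrow> x \<oplus> y \<in> N"
    "\<And>x. x \<in> N \<Longrightarrow> \<ominus> x \<in> N" "\<And>\<phi> x. \<phi> \<in> \<Phi> \<Longrightarrow> x \<in> N \<Longrightarrow> \<phi> x \<in> N"
  shows "op_closed G \<Phi> N"
  unfolding op_closed_def using assms by (auto intro!: additive_subgroupI2)

lemma op_closed_subset: "op_closed G \<Phi> N \<Longrightarrow> \<Psi> \<subseteq> \<Phi> \<Longrightarrow> op_closed G \<Psi> N"
  unfolding op_closed_def by auto

lemma op_span_minimal:
  assumes "op_closed G \<Phi> N" "S \<subseteq> N" shows "op_span G \<Phi> S \<subseteq> N"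
proof -
  have "words \<Phi> S \<subseteq> N"
  proof
    fix x assume "x \<in> words \<Phi> S" then show "x \<in> N"
      using assms by induction (auto simp: op_closed_def)
  qed
  then show ?thesis
    unfolding op_span_def using assms by (intro add_span_minimal) (auto simp: op_closed_def)
qed

lemma op_span_finitary:
  assumes "w \<in> op_span G \<Phi> S"
  shows "\<exists>S'\<subseteq>S. finite S' \<and> w \<in> op_span G \<Phi> S'"
proof -
  have words: "\<exists>S'\<subseteq>S. finite S' \<and> w \<in> words \<Phi> S'" if "w \<in> words \<Phi> S" for w
    using that
  proof induction
    case (base s) then show ?case by (intro exI[of _ "{s}"]) (auto intro: words.base)
  next
    case (step w \<phi>) then show ?case by (auto intro: words.step)
  qed
  show ?thesis
    using assms unfolding op_span_def
  proof induction
    case zero then show ?case by (intro exI[of _ "{}"]) (auto intro: add_span.zero)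
  next
    case (incl t) with words[OF this] show ?case by (auto intro: add_span.incl)
  next
    case (neg x) then show ?case by (auto intro: add_span.neg)
  next
    case (add x y)
    then obtain S1 S2 where *: "S1 \<subseteq> S" "finite S1" "x \<in> add_span G (words \<Phi> S1)"
      "S2 \<subseteq> S" "finite S2" "y \<in> add_span G (words \<Phi> S2)" by auto
    have "add_span G (words \<Phi> S1) \<subseteq> add_span G (words \<Phi> (S1 \<union> S2))"
      "add_span G (words \<Phi> S2) \<subseteq> add_span G (words \<Phi> (S1 \<union> S2))"
      by (intro add_span_mono words_mono; simp)+
    with * show ?case by (intro exI[of _ "S1 \<union> S2"]) (auto intro: add_span.add)
  qed
qed

lemma op_span_finitary_finite:
  assumes "finite T" "T \<subseteq> op_span G \<Phi> S"
  shows "\<exists>S'\<subseteq>S. finite S' \<and> T \<subseteq> op_span G \<Phi> S'"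
  using assms
proof (induction T)
  case empty then show ?case by auto
next
  case (insert t T)
  then obtain S1 where 1: "S1 \<subseteq> S" "finite S1" "T \<subseteq> op_span G \<Phi> S1" by auto
  obtain S2 where 2: "S2 \<subseteq> S" "finite S2" "t \<in> op_span G \<Phi> S2"
    using op_span_finitary[of t \<Phi> S] insert by auto
  have "op_span G \<Phi> S1 \<subseteq> op_span G \<Phi> (S1 \<union> S2)" "op_span G \<Phi> S2 \<subseteq> op_span G \<Phi> (S1 \<union> S2)"
    by (intro op_span_mono; simp)+
  with 1 2 show ?case by (intro exI[of _ "S1 \<union> S2"]) auto
qed

section \<open>Polynomials in one operator and Hilbert's basis theorem\<close>

lemma diff_zero: "x \<in> carrier G \<Longrightarrow> x \<ominus> \<zero> = x"
  by (simp add: a_minus_def)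

lemma diff_self: "x \<in> carrier G \<Longrightarrow> x \<ominus> x = \<zero>"
  by (simp add: a_minus_def r_neg)

lemma neg_zero: "\<ominus> \<zero> = \<zero>"
  by (rule minus_equality[OF l_zero]) simp_all

lemma add_diff_cancel:
  assumes "x \<in> carrier G" "y \<in> carrier G" "z \<in> carrier G"
  shows "(x \<oplus> y) \<ominus> (x \<oplus> z) = y \<ominus> z"
proof -
  have "(x \<oplus> y) \<ominus> (x \<oplus> z) = (x \<oplus> \<ominus> x) \<oplus> (y \<oplus> \<ominus> z)"
    using assms by (simp add: a_minus_def minus_add a_ac del: r_neg)
  then show ?thesis using assms by (simp add: a_minus_def r_neg)
qed

lemma add_diff_restore:
  assumes "x \<in> carrier G" "y \<in> carrier G" "z \<in> carrier G"
  shows "(x \<oplus> z) \<oplus> (y \<ominus> z) = x \<oplus> y"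
proof -
  have "(x \<oplus> z) \<oplus> (y \<ominus> z) = (x \<oplus> y) \<oplus> (z \<oplus> \<ominus> z)"
    using assms by (simp add: a_minus_def a_ac del: r_neg)
  then show ?thesis using assms by (simp add: r_neg)
qed

lemma operators_insert: "operators (insert \<psi> \<Phi>) \<longleftrightarrow> additive_map G G \<psi> \<and> operators \<Phi>"
  unfolding operators_def by auto

lemma additive_map_power: "additive_map G G \<psi> \<Longrightarrow> additive_map G G (\<psi> ^^ k)"
  by (induction k) (auto simp: additive_map_def Pi_iff)

lemmas op_zero = additive_map_zero[OF abelian_group_axioms abelian_group_axioms]
lemmas op_neg = additive_map_neg[OF abelian_group_axioms abelian_group_axioms]
lemmas op_minus = additive_map_minus[OF abelian_group_axioms abelian_group_axioms]

text \<open>Polynomials in \<open>\<psi>\<close> of degree less than \<open>k\<close> with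
  coefficients in \<open>N\<close>. The strict bound makes this the set of admissible lower order
  terms of an element of degree \<open>k\<close>.\<close>

primrec low_part :: "('a \<Rightarrow> 'a) \<Rightarrow> 'a set \<Rightarrow> nat \<Rightarrow> 'a set" where
  "low_part \<psi> N 0 = {\<zero>}"
| "low_part \<psi> N (Suc k) = {(\<psi> ^^ k) u \<oplus> v | u v. u \<in> N \<and> v \<in> low_part \<psi> N k}"

lemma power_commute:
  assumes "additive_map G G \<psi>" "\<And>x. x \<in> carrier G \<Longrightarrow> \<phi> (\<psi> x) = \<psi> (\<phi> x)" "x \<in> carrier G"
  shows "\<phi> ((\<psi> ^^ k) x) = (\<psi> ^^ k) (\<phi> x)"
proof (induction k)
  case (Suc k)
  then show ?case
    using assms additive_map_closed[OF additive_map_power[OF assms(1)] assms(3)] by simp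
qed simp

lemma low_part_closed:
  assumes "additive_map G G \<psi>" "operators \<Phi>" "op_closed G \<Phi> N"
    "\<And>\<phi> x. \<phi> \<in> \<Phi> \<Longrightarrow> x \<in> carrier G \<Longrightarrow> \<phi> (\<psi> x) = \<psi> (\<phi> x)"
  shows "op_closed G \<Phi> (low_part \<psi> N k)"
proof (induction k)
  case 0
  show ?case
    using assms(2) by (intro op_closedI) (auto simp: operators_def op_zero)
next
  case (Suc k)
  note p = additive_map_power[OF assms(1), of k]
  note N = op_closed_carrier[OF assms(3)]
  note L = op_closed_carrier[OF Suc]
  show ?case
  proof (rule op_closedI)
    show "low_part \<psi> N (Suc k) \<subseteq> carrier G"
      using N L additive_map_closed[OF p] by auto
    show "\<zero> \<in> low_part \<psi> N (Suc k)"
      using op_closed_zero[OF assms(3)] op_closed_zero[OF Suc] op_zero[OF p]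
      by (auto intro!: exI[of _ \<zero>])
  next
    fix x y assume "x \<in> low_part \<psi> N (Suc k)" "y \<in> low_part \<psi> N (Suc k)"
    then obtain u v u' v' where *: "x = (\<psi> ^^ k) u \<oplus> v" "u \<in> N" "v \<in> low_part \<psi> N k"
      "y = (\<psi> ^^ k) u' \<oplus> v'" "u' \<in> N" "v' \<in> low_part \<psi> N k" by auto
    then have c: "u \<in> carrier G" "v \<in> carrier G" "u' \<in> carrier G" "v' \<in> carrier G"
      using N L by auto
    note d = c additive_map_closed[OF p c(1)] additive_map_closed[OF p c(3)]
    have "x \<oplus> y = (\<psi> ^^ k) (u \<oplus> u') \<oplus> (v \<oplus> v')"
      using d additive_map_add[OF p, of u u'] * by (simp add: a_ac)
    then show "x \<oplus> y \<in> low_part \<psi> N (Suc k)"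
      unfolding low_part.simps using * op_closed_add[OF assms(3)] op_closed_add[OF Suc] by blast
  next
    fix x assume "x \<in> low_part \<psi> N (Suc k)"
    then obtain u v where *: "x = (\<psi> ^^ k) u \<oplus> v" "u \<in> N" "v \<in> low_part \<psi> N k" by auto
    then have c: "u \<in> carrier G" "v \<in> carrier G" using N L by auto
    have "\<ominus> x = (\<psi> ^^ k) (\<ominus> u) \<oplus> \<ominus> v"
      using c additive_map_closed[OF p c(1)] op_neg[OF p, of u] * by (simp add: minus_add)
    then show "\<ominus> x \<in> low_part \<psi> N (Suc k)"
      unfolding low_part.simps using * op_closed_neg[OF assms(3)] op_closed_neg[OF Suc] by blast
  next
    fix \<phi> x assume f: "\<phi> \<in> \<Phi>" and "x \<in> low_part \<psi> N (Suc k)"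
    then obtain u v where *: "x = (\<psi> ^^ k) u \<oplus> v" "u \<in> N" "v \<in> low_part \<psi> N k" by auto
    then have c: "u \<in> carrier G" "v \<in> carrier G" using N L by auto
    have "additive_map G G \<phi>" using f assms(2) by (auto simp: operators_def)
    then have "\<phi> x = (\<psi> ^^ k) (\<phi> u) \<oplus> \<phi> v"
      using c additive_map_closed[OF p c(1)] power_commute[where \<phi> = \<phi>, OF assms(1) assms(4)[OF f] c(1)] *
        additive_map_add[of G G \<phi> "(\<psi> ^^ k) u" v] by simp
    then show "\<phi> x \<in> low_part \<psi> N (Suc k)"
      unfolding low_part.simps using * op_closed_op[OF assms(3) f] op_closed_op[OF Suc f] by blast
  qed
qed

lemma low_part_shift:
  assumes "additive_map G G \<psi>" "op_closed G \<Phi> N" "\<And>k. low_part \<psi> N k \<subseteq> carrier G"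
    "x \<in> low_part \<psi> N k"
  shows "\<psi> x \<in> low_part \<psi> N (Suc k)"
  using assms(4)
proof (induction k arbitrary: x)
  case 0
  then show ?case
    using op_zero[OF assms(1)] op_closed_zero[OF assms(2)] by (auto intro!: exI[of _ \<zero>])
next
  case (Suc k)
  then obtain u v where *: "x = (\<psi> ^^ k) u \<oplus> v" "u \<in> N" "v \<in> low_part \<psi> N k" by auto
  have c: "u \<in> carrier G" "v \<in> carrier G"
    using * assms(3) op_closed_carrier[OF assms(2)] by auto
  have "\<psi> x = (\<psi> ^^ Suc k) u \<oplus> \<psi> v"
    using additive_map_add[OF assms(1), of "(\<psi> ^^ k) u" v] c
      additive_map_closed[OF additive_map_power[OF assms(1)] c(1)] * by simp
  then show ?case using Suc.IH[OF *(3)] *(2) by (subst low_part.simps(2)) blast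
qed

lemma low_part_incr:
  assumes "additive_map G G \<psi>" "op_closed G \<Phi> N" "\<And>k. low_part \<psi> N k \<subseteq> carrier G"
  shows "low_part \<psi> N k \<subseteq> low_part \<psi> N (Suc k)"
proof
  fix v assume v: "v \<in> low_part \<psi> N k"
  then have "v = (\<psi> ^^ k) \<zero> \<oplus> v"
    using op_zero[OF additive_map_power[OF assms(1)]] subsetD[OF assms(3) v] by simp
  then show "v \<in> low_part \<psi> N (Suc k)"
    unfolding low_part.simps using v op_closed_zero[OF assms(2)] by blast
qed

text \<open>Hilbert's basis theorem inside an ambient group: the new operator \<open>\<psi>\<close> plays the role of the
  variable, and \<open>lead k\<close> consists of the leading coefficients of the elements of degree \<open>k\<close>.
  Expressions as polynomials in \<open>\<psi>\<close> need not be unique.\<close>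

lemma op_noetherian_adjoin:
  assumes psi: "additive_map G G \<psi>" and ops: "operators \<Phi>"
    and comm: "\<And>\<phi> x. \<phi> \<in> \<Phi> \<Longrightarrow> x \<in> carrier G \<Longrightarrow> \<phi> (\<psi> x) = \<psi> (\<phi> x)"
    and F: "F \<subseteq> carrier G"
    and noeth: "op_noetherian G \<Phi> (op_span G \<Phi> F)"
  shows "op_noetherian G (insert \<psi> \<Phi>) (op_span G (insert \<psi> \<Phi>) F)"
  unfolding op_noetherian_def
proof (intro allI impI)
  define N where "N = op_span G \<Phi> F"
  have N: "op_closed G \<Phi> N" unfolding N_def by (rule op_span_closed[OF ops F])
  have ops': "operators (insert \<psi> \<Phi>)" using psi ops by (simp add: operators_insert)
  let ?P = "low_part \<psi> N"
  have P: "op_closed G \<Phi> (?P k)" for k by (rule low_part_closed[OF psi ops N comm])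
  have Pc: "?P k \<subseteq> carrier G" for k using op_closed_carrier[OF P] .
  have Nc: "N \<subseteq> carrier G" using op_closed_carrier[OF N] .
  note shift = low_part_shift[OF psi N Pc]
  note incr = low_part_incr[OF psi N Pc]
  have mono: "?P k \<subseteq> ?P l" if "k \<le> l" for k l using lift_Suc_mono_le[of ?P, OF incr that] .
  note pw = additive_map_power[OF psi]
  note pwc = additive_map_closed[OF pw]
  have whole: "op_span G (insert \<psi> \<Phi>) F \<subseteq> (\<Union>k. ?P k)"
  proof (rule op_span_minimal)
    show "op_closed G (insert \<psi> \<Phi>) (\<Union>k. ?P k)"
    proof (rule op_closedI)
      show "(\<Union>k. ?P k) \<subseteq> carrier G" using Pc by auto
      show "\<zero> \<in> (\<Union>k. ?P k)" using op_closed_zero[OF P[of 0]] by blast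
    next
      fix x y assume "x \<in> (\<Union>k. ?P k)" "y \<in> (\<Union>k. ?P k)"
      then obtain k l where "x \<in> ?P k" "y \<in> ?P l" by auto
      then have "x \<in> ?P (max k l)" "y \<in> ?P (max k l)" using mono[of k "max k l"] mono[of l "max k l"] by auto
      then show "x \<oplus> y \<in> (\<Union>k. ?P k)" using op_closed_add[OF P] by blast
    next
      fix x assume "x \<in> (\<Union>k. ?P k)" then show "\<ominus> x \<in> (\<Union>k. ?P k)" using op_closed_neg[OF P] by blast
    next
      fix \<phi> x assume "\<phi> \<in> insert \<psi> \<Phi>" "x \<in> (\<Union>k. ?P k)"
      then show "\<phi> x \<in> (\<Union>k. ?P k)" using shift op_closed_op[OF P] by blast
    qed
    show "F \<subseteq> (\<Union>k. ?P k)"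
    proof
      fix x assume "x \<in> F"
      then have "x \<in> N" unfolding N_def by (rule subsetD[OF op_span_incl])
      then have "(\<psi> ^^ 0) x \<oplus> \<zero> \<in> ?P (Suc 0)" unfolding low_part.simps by blast
      moreover have "(\<psi> ^^ 0) x \<oplus> \<zero> = x" using subsetD[OF Nc \<open>x \<in> N\<close>] by simp
      ultimately have "x \<in> ?P (Suc 0)" by metis
      then show "x \<in> (\<Union>k. ?P k)" by blast
    qed
  qed
  fix S assume S: "S \<subseteq> op_span G (insert \<psi> \<Phi>) F"
  have Sc: "S \<subseteq> carrier G" using S op_closed_carrier[OF op_span_closed[OF ops' F]] by auto
  define W where "W = op_span G (insert \<psi> \<Phi>) S"
  have W: "op_closed G (insert \<psi> \<Phi>) W" unfolding W_def by (rule op_span_closed[OF ops' Sc])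
  have SW: "S \<subseteq> W" unfolding W_def by (rule op_span_incl)
  define lead where "lead V k = {u \<in> N. \<exists>v\<in>?P k. (\<psi> ^^ k) u \<oplus> v \<in> V}" for V k
  have leadN: "lead V k \<subseteq> N" for V k unfolding lead_def by auto
  have lead_closed: "op_closed G \<Phi> (lead V k)" if V: "op_closed G (insert \<psi> \<Phi>) V" for V k
  proof (rule op_closedI)
    show "lead V k \<subseteq> carrier G" unfolding lead_def using Nc by auto
    have "(\<psi> ^^ k) \<zero> \<oplus> \<zero> \<in> V" using op_zero[OF pw] op_closed_zero[OF V] by simp
    then show "\<zero> \<in> lead V k"
      unfolding lead_def using op_closed_zero[OF N] op_closed_zero[OF P] by blast
  next
    fix x y assume "x \<in> lead V k" "y \<in> lead V k"
    then obtain v w where *: "x \<in> N" "y \<in> N" "v \<in> ?P k" "w \<in> ?P k" "(\<psi> ^^ k) x \<oplus> v \<in> V"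
      "(\<psi> ^^ k) y \<oplus> w \<in> V" unfolding lead_def by auto
    have c: "x \<in> carrier G" "y \<in> carrier G" "v \<in> carrier G" "w \<in> carrier G" using * Nc Pc by auto
    have "(\<psi> ^^ k) (x \<oplus> y) \<oplus> (v \<oplus> w) = ((\<psi> ^^ k) x \<oplus> v) \<oplus> ((\<psi> ^^ k) y \<oplus> w)"
      using c pwc[OF c(1)] pwc[OF c(2)] additive_map_add[OF pw] by (simp add: a_ac)
    then have "(\<psi> ^^ k) (x \<oplus> y) \<oplus> (v \<oplus> w) \<in> V" using op_closed_add[OF V *(5,6)] by simp
    then show "x \<oplus> y \<in> lead V k"
      unfolding lead_def using * op_closed_add[OF N] op_closed_add[OF P] by blast
  next
    fix x assume "x \<in> lead V k"
    then obtain v where *: "x \<in> N" "v \<in> ?P k" "(\<psi> ^^ k) x \<oplus> v \<in> V" unfolding lead_def by auto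
    have c: "x \<in> carrier G" "v \<in> carrier G" using * Nc Pc by auto
    have "(\<psi> ^^ k) (\<ominus> x) \<oplus> \<ominus> v = \<ominus> ((\<psi> ^^ k) x \<oplus> v)"
      using c pwc[OF c(1)] op_neg[OF pw] by (simp add: minus_add)
    then have "(\<psi> ^^ k) (\<ominus> x) \<oplus> \<ominus> v \<in> V" using op_closed_neg[OF V *(3)] by simp
    then show "\<ominus> x \<in> lead V k"
      unfolding lead_def using * op_closed_neg[OF N] op_closed_neg[OF P] by blast
  next
    fix \<phi> x assume f: "\<phi> \<in> \<Phi>" and "x \<in> lead V k"
    then obtain v where *: "x \<in> N" "v \<in> ?P k" "(\<psi> ^^ k) x \<oplus> v \<in> V" unfolding lead_def by auto
    have c: "x \<in> carrier G" "v \<in> carrier G" using * Nc Pc by auto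
    have "additive_map G G \<phi>" using f ops by (auto simp: operators_def)
    then have "\<phi> ((\<psi> ^^ k) x \<oplus> v) = (\<psi> ^^ k) (\<phi> x) \<oplus> \<phi> v"
      using c pwc[OF c(1)] power_commute[where \<phi> = \<phi>, OF psi comm[OF f] c(1)]
        additive_map_add[of G G \<phi> "(\<psi> ^^ k) x" v] by simp
    then have "(\<psi> ^^ k) (\<phi> x) \<oplus> \<phi> v \<in> V" using op_closed_op[OF V _ *(3), of \<phi>] f by simp
    then show "\<phi> x \<in> lead V k"
      unfolding lead_def using * op_closed_op[OF N f] op_closed_op[OF P f] by blast
  qed
  have lead_shift: "lead V k \<subseteq> lead V (Suc k)" if V: "op_closed G (insert \<psi> \<Phi>) V" for V k
  proof
    fix x assume "x \<in> lead V k"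
    then obtain v where *: "x \<in> N" "v \<in> ?P k" "(\<psi> ^^ k) x \<oplus> v \<in> V" unfolding lead_def by auto
    have c: "x \<in> carrier G" "v \<in> carrier G" using * Nc Pc by auto
    have "\<psi> ((\<psi> ^^ k) x \<oplus> v) = (\<psi> ^^ Suc k) x \<oplus> \<psi> v"
      using c pwc[OF c(1)] additive_map_add[OF psi, of "(\<psi> ^^ k) x" v] by simp
    then have "(\<psi> ^^ Suc k) x \<oplus> \<psi> v \<in> V" using op_closed_op[OF V _ *(3), of \<psi>] by simp
    then show "x \<in> lead V (Suc k)" unfolding lead_def using * shift by blast
  qed
  have lead_mono: "lead V k \<subseteq> lead V l" if "op_closed G (insert \<psi> \<Phi>) V" "k \<le> l" for V k l
    using lift_Suc_mono_le[of "lead V", OF lead_shift[OF that(1)] that(2)] .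
  have noethN: "\<exists>T\<subseteq>U. finite T \<and> U \<subseteq> op_span G \<Phi> T" if "U \<subseteq> N" for U
    using noeth that unfolding op_noetherian_def N_def by auto
  \<comment> \<open>Applying \<open>\<psi>\<close> makes \<open>lead W k\<close> increase with
    \<open>k\<close>, so finitely many generators of the union all occur at one stage
    \<open>K\<close>.\<close>
  obtain T where T: "T \<subseteq> (\<Union>k. lead W k)" "finite T" "(\<Union>k. lead W k) \<subseteq> op_span G \<Phi> T"
    using noethN[of "\<Union>k. lead W k"] leadN by blast
  have "\<exists>K. T \<subseteq> lead W K"
    using T(2,1)
  proof (induction T)
    case (insert t T)
    then obtain K k where "T \<subseteq> lead W K" "t \<in> lead W k" by auto
    then have "insert t T \<subseteq> lead W (max K k)"
      using lead_mono[OF W, of K "max K k"] lead_mono[OF W, of k "max K k"] by auto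
    then show ?case ..
  qed auto
  then obtain K where K: "T \<subseteq> lead W K" ..
  have stable: "lead W k \<subseteq> lead W K" for k
    using T(3) op_span_minimal[OF lead_closed[OF W] K] by auto
  \<comment> \<open>In one fixed degree, finitely many generators of \<open>lead W k\<close> are
    leading coefficients of elements of \<open>W\<close>, and each of these elements involves only
    finitely many members of \<open>S\<close>.\<close>
  have "\<forall>k. \<exists>S'. S' \<subseteq> S \<and> finite S' \<and> lead W k \<subseteq> lead (op_span G (insert \<psi> \<Phi>) S') k"
  proof
    fix k
    obtain U where U: "U \<subseteq> lead W k" "finite U" "lead W k \<subseteq> op_span G \<Phi> U"
      using noethN[of "lead W k"] leadN by blast
    have "\<exists>w. \<forall>u\<in>U. w u \<in> ?P k \<and> (\<psi> ^^ k) u \<oplus> w u \<in> W"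
      using U(1) unfolding lead_def by (intro bchoice) auto
    then obtain w where w: "\<And>u. u \<in> U \<Longrightarrow> w u \<in> ?P k" "\<And>u. u \<in> U \<Longrightarrow> (\<psi> ^^ k) u \<oplus> w u \<in> W" by auto
    obtain S' where S': "S' \<subseteq> S" "finite S'" "(\<lambda>u. (\<psi> ^^ k) u \<oplus> w u) ` U \<subseteq> op_span G (insert \<psi> \<Phi>) S'"
      using op_span_finitary_finite[of "(\<lambda>u. (\<psi> ^^ k) u \<oplus> w u) ` U" "insert \<psi> \<Phi>" S] U w
      unfolding W_def by blast
    have "op_closed G (insert \<psi> \<Phi>) (op_span G (insert \<psi> \<Phi>) S')"
      using S' Sc by (intro op_span_closed[OF ops']) auto
    moreover have "U \<subseteq> lead (op_span G (insert \<psi> \<Phi>) S') k"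
    proof
      fix u assume u: "u \<in> U"
      then have "u \<in> N" using U(1) leadN by auto
      moreover have "(\<psi> ^^ k) u \<oplus> w u \<in> op_span G (insert \<psi> \<Phi>) S'" using S'(3) u by auto
      ultimately show "u \<in> lead (op_span G (insert \<psi> \<Phi>) S') k"
        unfolding lead_def using w(1)[OF u] by auto
    qed
    ultimately have "op_span G \<Phi> U \<subseteq> lead (op_span G (insert \<psi> \<Phi>) S') k"
      by (intro op_span_minimal lead_closed)
    with U(3) have "lead W k \<subseteq> lead (op_span G (insert \<psi> \<Phi>) S') k" by (rule subset_trans)
    with S'(1,2) show "\<exists>S'. S' \<subseteq> S \<and> finite S' \<and> lead W k \<subseteq> lead (op_span G (insert \<psi> \<Phi>) S') k"
      by (intro exI[of _ S'] conjI)
  qed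
  from choice[OF this] obtain Sk where Sk: "\<And>k. Sk k \<subseteq> S" "\<And>k. finite (Sk k)"
    "\<And>k. lead W k \<subseteq> lead (op_span G (insert \<psi> \<Phi>) (Sk k)) k" by auto
  define S' where "S' = (\<Union>k\<in>{..K}. Sk k)"
  define W' where "W' = op_span G (insert \<psi> \<Phi>) S'"
  have S': "S' \<subseteq> S" "finite S'" unfolding S'_def using Sk by auto
  have W': "op_closed G (insert \<psi> \<Phi>) W'"
    unfolding W'_def using S' Sc by (intro op_span_closed[OF ops']) auto
  have W'W: "W' \<subseteq> W" unfolding W_def W'_def by (intro op_span_mono S' subset_refl)
  have small: "lead W k \<subseteq> lead W' k" if "k \<le> K" for k
  proof -
    have "op_span G (insert \<psi> \<Phi>) (Sk k) \<subseteq> W'"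
      unfolding W'_def S'_def using that by (intro op_span_mono) auto
    then show ?thesis using Sk(3)[of k] unfolding lead_def by blast
  qed
  \<comment> \<open>Beyond \<open>K\<close> no new leading coefficients appear in \<open>W\<close>,
    and those of degree \<open>K\<close> are carried up inside \<open>W'\<close> by powers of
    \<open>\<psi>\<close>. So the members of \<open>S\<close> chosen for degrees up to
    \<open>K\<close> suffice.\<close>
  have all: "lead W k \<subseteq> lead W' k" for k
  proof (cases "k \<le> K")
    case False
    then show ?thesis using stable[of k] small[of K] lead_mono[OF W', of K k] by auto
  qed (rule small)
  \<comment> \<open>Division with remainder: subtracting an element of \<open>W'\<close> with the
    same leading coefficient leaves an element of \<open>W\<close> of smaller degree. The lower
    terms \<open>v\<close> and \<open>v'\<close> may differ, but their difference is again in
    \<open>?P k\<close>.\<close>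
  have "W \<inter> ?P k \<subseteq> W'" for k
  proof (induction k)
    case 0 then show ?case using op_closed_zero[OF W'] by auto
  next
    case (Suc k)
    show ?case
    proof
      fix x assume x: "x \<in> W \<inter> ?P (Suc k)"
      then obtain u v where *: "x = (\<psi> ^^ k) u \<oplus> v" "u \<in> N" "v \<in> ?P k" by auto
      then have "u \<in> lead W k" using x unfolding lead_def by auto
      with all obtain v' where v': "v' \<in> ?P k" "(\<psi> ^^ k) u \<oplus> v' \<in> W'" unfolding lead_def by blast
      have c: "u \<in> carrier G" "v \<in> carrier G" "v' \<in> carrier G" using * v' Nc Pc by auto
      have "v \<ominus> v' = x \<ominus> ((\<psi> ^^ k) u \<oplus> v')"
        using c pwc[OF c(1)] *(1) by (simp add: add_diff_cancel)
      then have "v \<ominus> v' \<in> W" using op_closed_minus[OF W] x v' W'W by auto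
      then have "v \<ominus> v' \<in> W'" using Suc op_closed_minus[OF P *(3) v'(1)] by auto
      moreover have "x = ((\<psi> ^^ k) u \<oplus> v') \<oplus> (v \<ominus> v')"
        using c pwc[OF c(1)] *(1) by (simp add: add_diff_restore)
      ultimately show "x \<in> W'" using op_closed_add[OF W' v'(2)] by simp
    qed
  qed
  then have "S \<subseteq> W'" using SW S whole by blast
  then show "\<exists>S'\<subseteq>S. finite S' \<and> S \<subseteq> op_span G (insert \<psi> \<Phi>) S'"
    using S' unfolding W'_def by blast
qed

text \<open>The extension argument for Noetherian modules without a quotient: the submodule
  \<open>W\<close> generated by a subset is controlled by its \<open>g\<close>-parts
  \<open>lead W\<close> and by its intersection with the span of \<open>F\<close>. The sum of the
  two spans need not be direct.\<close>

lemma op_noetherian_insert: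
  assumes ops: "operators \<Phi>" and F: "F \<subseteq> carrier G" and g: "g \<in> carrier G"
    and n1: "op_noetherian G \<Phi> (op_span G \<Phi> F)" and n2: "op_noetherian G \<Phi> (op_span G \<Phi> {g})"
  shows "op_noetherian G \<Phi> (op_span G \<Phi> (insert g F))"
  unfolding op_noetherian_def
proof (intro allI impI)
  let ?M = "op_span G \<Phi> F" and ?N = "op_span G \<Phi> {g}"
  have M: "op_closed G \<Phi> ?M" and N: "op_closed G \<Phi> ?N" using op_span_closed[OF ops] F g by auto
  note Mc = op_closed_carrier[OF M] note Nc = op_closed_carrier[OF N]
  have whole: "op_span G \<Phi> (insert g F) \<subseteq> {u \<oplus> v | u v. u \<in> ?N \<and> v \<in> ?M}" (is "_ \<subseteq> ?T")
  proof (rule op_span_minimal)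
    show "op_closed G \<Phi> ?T"
    proof (rule op_closedI)
      show "?T \<subseteq> carrier G" using Mc Nc by auto
      show "\<zero> \<in> ?T" using op_closed_zero[OF M] op_closed_zero[OF N] l_zero[OF zero_closed] by force
    next
      fix x y assume "x \<in> ?T" "y \<in> ?T"
      then obtain u v u' v' where *: "x = u \<oplus> v" "y = u' \<oplus> v'" "u \<in> ?N" "u' \<in> ?N" "v \<in> ?M" "v' \<in> ?M" by auto
      then have "x \<oplus> y = (u \<oplus> u') \<oplus> (v \<oplus> v')" using Mc Nc by (simp add: a_ac subset_iff)
      then show "x \<oplus> y \<in> ?T" using * op_closed_add[OF M] op_closed_add[OF N] by blast
    next
      fix x assume "x \<in> ?T"
      then obtain u v where *: "x = u \<oplus> v" "u \<in> ?N" "v \<in> ?M" by auto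
      then have "\<ominus> x = \<ominus> u \<oplus> \<ominus> v" using Mc Nc by (simp add: minus_add subset_iff)
      then show "\<ominus> x \<in> ?T" using * op_closed_neg[OF M] op_closed_neg[OF N] by blast
    next
      fix \<phi> x assume f: "\<phi> \<in> \<Phi>" and "x \<in> ?T"
      then obtain u v where *: "x = u \<oplus> v" "u \<in> ?N" "v \<in> ?M" by auto
      then have "\<phi> x = \<phi> u \<oplus> \<phi> v"
        using Mc Nc ops f additive_map_add[of G G \<phi> u v] by (auto simp: operators_def)
      then show "\<phi> x \<in> ?T" using * f op_closed_op[OF M] op_closed_op[OF N] by blast
    qed
    show "insert g F \<subseteq> ?T"
    proof
      fix x assume "x \<in> insert g F"
      then consider "x = g" | "x \<in> F" by auto
      then show "x \<in> ?T"
      proof cases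
        case 1
        have "g = g \<oplus> \<zero>" using g by simp
        then show ?thesis using 1 op_closed_zero[OF M] op_span_incl[of "{g}" G \<Phi>] by blast
      next
        case 2
        then have "x = \<zero> \<oplus> x" using F by auto
        then show ?thesis using 2 op_closed_zero[OF N] op_span_incl[of F G \<Phi>] by blast
      qed
    qed
  qed
  fix S assume S: "S \<subseteq> op_span G \<Phi> (insert g F)"
  have Sc: "S \<subseteq> carrier G" using S op_closed_carrier[OF op_span_closed[OF ops, of "insert g F"]] F g by auto
  define W where "W = op_span G \<Phi> S"
  have W: "op_closed G \<Phi> W" unfolding W_def by (rule op_span_closed[OF ops Sc])
  have SW: "S \<subseteq> W" unfolding W_def by (rule op_span_incl)
  define lead where "lead V = {u \<in> ?N. \<exists>v\<in>?M. u \<oplus> v \<in> V}" for V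
  have lead_closed: "op_closed G \<Phi> (lead V)" if V: "op_closed G \<Phi> V" for V
  proof (rule op_closedI)
    show "lead V \<subseteq> carrier G" unfolding lead_def using Nc by auto
    have "\<zero> \<oplus> \<zero> \<in> V" using op_closed_zero[OF V] by simp
    then show "\<zero> \<in> lead V" unfolding lead_def using op_closed_zero[OF N] op_closed_zero[OF M] by blast
  next
    fix x y assume "x \<in> lead V" "y \<in> lead V"
    then obtain v w where *: "x \<in> ?N" "y \<in> ?N" "v \<in> ?M" "w \<in> ?M" "x \<oplus> v \<in> V" "y \<oplus> w \<in> V"
      unfolding lead_def by auto
    have "(x \<oplus> y) \<oplus> (v \<oplus> w) = (x \<oplus> v) \<oplus> (y \<oplus> w)"
      using * Mc Nc by (simp add: a_ac subset_iff)
    then have "(x \<oplus> y) \<oplus> (v \<oplus> w) \<in> V" using op_closed_add[OF V *(5,6)] by simp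
    then show "x \<oplus> y \<in> lead V" unfolding lead_def using * op_closed_add[OF N] op_closed_add[OF M] by blast
  next
    fix x assume "x \<in> lead V"
    then obtain v where *: "x \<in> ?N" "v \<in> ?M" "x \<oplus> v \<in> V" unfolding lead_def by auto
    have "\<ominus> x \<oplus> \<ominus> v = \<ominus> (x \<oplus> v)" using * Mc Nc by (simp add: minus_add subset_iff)
    then have "\<ominus> x \<oplus> \<ominus> v \<in> V" using op_closed_neg[OF V *(3)] by simp
    then show "\<ominus> x \<in> lead V" unfolding lead_def using * op_closed_neg[OF N] op_closed_neg[OF M] by blast
  next
    fix \<phi> x assume f: "\<phi> \<in> \<Phi>" and "x \<in> lead V"
    then obtain v where *: "x \<in> ?N" "v \<in> ?M" "x \<oplus> v \<in> V" unfolding lead_def by auto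
    have "\<phi> (x \<oplus> v) = \<phi> x \<oplus> \<phi> v"
      using * Mc Nc ops f additive_map_add[of G G \<phi> x v] by (auto simp: operators_def)
    then have "\<phi> x \<oplus> \<phi> v \<in> V" using op_closed_op[OF V f *(3)] by simp
    then show "\<phi> x \<in> lead V" unfolding lead_def using * op_closed_op[OF N f] op_closed_op[OF M f] by blast
  qed
  obtain T where T: "T \<subseteq> lead W" "finite T" "lead W \<subseteq> op_span G \<Phi> T"
    using n2[unfolded op_noetherian_def, rule_format, of "lead W"] unfolding lead_def by blast
  have "\<exists>w. \<forall>u\<in>T. w u \<in> ?M \<and> u \<oplus> w u \<in> W"
    using T(1) unfolding lead_def by (intro bchoice) auto
  then obtain w where w: "\<And>u. u \<in> T \<Longrightarrow> w u \<in> ?M" "\<And>u. u \<in> T \<Longrightarrow> u \<oplus> w u \<in> W" by auto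
  obtain U where U: "U \<subseteq> W \<inter> ?M" "finite U" "W \<inter> ?M \<subseteq> op_span G \<Phi> U"
    using n1[unfolded op_noetherian_def, rule_format, of "W \<inter> ?M"] by blast
  have "finite ((\<lambda>u. u \<oplus> w u) ` T \<union> U)" "(\<lambda>u. u \<oplus> w u) ` T \<union> U \<subseteq> op_span G \<Phi> S"
    using T U w unfolding W_def by auto
  from op_span_finitary_finite[OF this] obtain S' where S': "S' \<subseteq> S" "finite S'"
    "(\<lambda>u. u \<oplus> w u) ` T \<union> U \<subseteq> op_span G \<Phi> S'" by blast
  define W' where "W' = op_span G \<Phi> S'"
  have W': "op_closed G \<Phi> W'"
    unfolding W'_def using S' Sc by (intro op_span_closed[OF ops]) auto
  have W'W: "W' \<subseteq> W" unfolding W_def W'_def by (intro op_span_mono S' subset_refl)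
  have lead: "lead W \<subseteq> lead W'"
  proof -
    have "T \<subseteq> lead W'"
    proof
      fix u assume u: "u \<in> T"
      then have "u \<in> ?N" using T(1) unfolding lead_def by auto
      moreover have "u \<oplus> w u \<in> W'" unfolding W'_def using S'(3) u by auto
      ultimately show "u \<in> lead W'" unfolding lead_def using w(1)[OF u] by auto
    qed
    then show ?thesis using T(3) op_span_minimal[OF lead_closed[OF W']] by blast
  qed
  have low: "W \<inter> ?M \<subseteq> W'"
    using U(3) op_span_minimal[OF W', of U] S'(3) unfolding W'_def by blast
  have "S \<subseteq> W'"
  proof
    fix x assume "x \<in> S"
    then have x: "x \<in> W" "x \<in> ?T" using SW S whole by auto
    then obtain u v where *: "x = u \<oplus> v" "u \<in> ?N" "v \<in> ?M" by auto
    then have "u \<in> lead W" using x unfolding lead_def by auto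
    with lead obtain v' where v': "v' \<in> ?M" "u \<oplus> v' \<in> W'" unfolding lead_def by blast
    have c: "u \<in> carrier G" "v \<in> carrier G" "v' \<in> carrier G" using * v' Nc Mc by auto
    have "v \<ominus> v' = x \<ominus> (u \<oplus> v')"
      using c *(1) by (simp add: add_diff_cancel)
    then have "v \<ominus> v' \<in> W" using op_closed_minus[OF W] x v' W'W by auto
    then have "v \<ominus> v' \<in> W'" using low op_closed_minus[OF M *(3) v'(1)] by auto
    moreover have "x = (u \<oplus> v') \<oplus> (v \<ominus> v')"
      using c *(1) by (simp add: add_diff_restore)
    ultimately show "x \<in> W'" using op_closed_add[OF W' v'(2)] by simp
  qed
  then show "\<exists>S'\<subseteq>S. finite S' \<and> S \<subseteq> op_span G \<Phi> S'"
    using S' unfolding W'_def by blast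
qed

lemma op_noetherian_finite:
  assumes ops: "operators \<Phi>" and F: "finite F" "F \<subseteq> carrier G"
    and cyclic: "\<And>g. g \<in> F \<Longrightarrow> op_noetherian G \<Phi> (op_span G \<Phi> {g})"
  shows "op_noetherian G \<Phi> (op_span G \<Phi> F)"
  using F cyclic
proof (induction F)
  case empty
  have "op_span G \<Phi> {} \<subseteq> {\<zero>}"
    using ops op_zero by (intro op_span_minimal op_closedI) (auto simp: operators_def)
  then show ?case
    unfolding op_noetherian_def
    by (metis add_span.zero op_span_def empty_subsetI finite.emptyI singletonD subsetD subsetI)
next
  case (insert g F)
  have "op_noetherian G \<Phi> (op_span G \<Phi> F)" using insert.prems by (intro insert.IH) auto
  with insert.prems show ?case by - (rule op_noetherian_insert[OF ops], simp_all)
qed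

lemma op_noetherian_adjoin_finite:
  assumes fin: "finite \<Psi>" and opP: "operators \<Psi>" and ops: "operators \<Phi>"
    and comm: "\<And>\<phi> \<psi> x. \<phi> \<in> \<Phi> \<union> \<Psi> \<Longrightarrow> \<psi> \<in> \<Psi> \<Longrightarrow> x \<in> carrier G \<Longrightarrow> \<phi> (\<psi> x) = \<psi> (\<phi> x)"
    and F: "F \<subseteq> carrier G"
    and noeth: "op_noetherian G \<Phi> (op_span G \<Phi> F)"
  shows "op_noetherian G (\<Phi> \<union> \<Psi>) (op_span G (\<Phi> \<union> \<Psi>) F)"
  using fin opP comm
proof (induction \<Psi>)
  case empty then show ?case using noeth by simp
next
  case (insert \<psi> \<Psi>)
  have "op_noetherian G (insert \<psi> (\<Phi> \<union> \<Psi>)) (op_span G (insert \<psi> (\<Phi> \<union> \<Psi>)) F)"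
  proof (rule op_noetherian_adjoin)
    show "additive_map G G \<psi>" "operators (\<Phi> \<union> \<Psi>)" using insert ops by (auto simp: operators_def)
    show "op_noetherian G (\<Phi> \<union> \<Psi>) (op_span G (\<Phi> \<union> \<Psi>) F)"
      using insert.prems by (intro insert.IH) (auto simp: operators_insert)
  qed (use insert.prems F in auto)
  then show ?case by simp
qed

end

section \<open>Modules over a ring as groups with operators\<close>

lemma (in cring) idealI2:
  assumes "additive_subgroup I R" "\<And>a x. a \<in> I \<Longrightarrow> x \<in> carrier R \<Longrightarrow> x \<otimes> a \<in> I"
  shows "ideal I R"
proof (rule idealI)
  show "subgroup I (add_monoid R)" by (rule additive_subgroup.a_subgroup[OF assms(1)])
  fix a x assume *: "a \<in> I" "x \<in> carrier R"
  then have "a \<otimes> x = x \<otimes> a" using additive_subgroup.a_Hcarr[OF assms(1)] by (simp add: m_comm)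
  with assms(2)[OF *] show "a \<otimes> x \<in> I" by simp
qed (rule ring_axioms, rule assms(2))

text \<open>Scalars are restricted to a set \<open>B\<close> that will generate the ring: its
  members can be chosen homogeneous, which arbitrary ring elements are not, and
  \<open>op_closed_smult\<close> recovers the remaining scalars.\<close>

definition smult_ops :: "('a, 'm, 'z) module_scheme \<Rightarrow> 'a set \<Rightarrow> ('m \<Rightarrow> 'm) set" where
  "smult_ops M B = (\<lambda>a x. a \<odot>\<^bsub>M\<^esub> x) ` B"

context module
begin

lemma smult_ops_operators: "B \<subseteq> carrier R \<Longrightarrow> M.operators (smult_ops M B)"
  unfolding M.operators_def smult_ops_def using smult_additive_map by auto

text \<open>The scalars that carry \<open>N\<close> into itself form a subring, so it is enough that
  they include \<open>B\<close>.\<close>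

lemma op_closed_smult:
  assumes B: "generate_ring R B = carrier R" "B \<subseteq> carrier R"
    and N: "op_closed M (smult_ops M B) N" and "a \<in> carrier R" "x \<in> N"
  shows "a \<odot>\<^bsub>M\<^esub> x \<in> N"
proof -
  note Nc = M.op_closed_carrier[OF N]
  have "a \<in> generate_ring R B" using B assms by simp
  then show ?thesis
    using \<open>x \<in> N\<close>
  proof (induction arbitrary: x)
    case one then show ?case using Nc by auto
  next
    case (incl h) then show ?case using M.op_closed_op[OF N] by (auto simp: smult_ops_def)
  next
    case (a_inv h)
    then have "h \<in> carrier R" using B by simp
    then show ?case using a_inv M.op_closed_neg[OF N] Nc by (auto simp: smult_l_minus)
  next
    case (eng_add h1 h2)
    then have "h1 \<in> carrier R" "h2 \<in> carrier R" using B by auto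
    then show ?case using eng_add M.op_closed_add[OF N] Nc by (auto simp: smult_l_distr)
  next
    case (eng_mult h1 h2)
    then have "h1 \<in> carrier R" "h2 \<in> carrier R" using B by auto
    then show ?case using eng_mult Nc by (auto simp: smult_assoc1)
  qed
qed

text \<open>Submodules of a cyclic module correspond to ideals: a span \<open>W\<close> among the
  multiples of \<open>g\<close> is determined by the scalars \<open>a\<close> with
  \<open>a g\<close> in \<open>W\<close>, and finite generation of that ideal is transported along
  \<open>a \<mapsto> a g\<close>.\<close>

lemma op_noetherian_cyclic:
  assumes noeth: "noetherian_ring R"
    and B: "generate_ring R B = carrier R" "B \<subseteq> carrier R" and g: "g \<in> carrier M"
  shows "op_noetherian M (smult_ops M B) (op_span M (smult_ops M B) {g})"
  unfolding op_noetherian_def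
proof (intro allI impI)
  let ?\<Phi> = "smult_ops M B"
  note ops = smult_ops_operators[OF B(2)]
  have cyc: "op_span M ?\<Phi> {g} \<subseteq> {a \<odot>\<^bsub>M\<^esub> g | a. a \<in> carrier R}" (is "_ \<subseteq> ?C")
  proof (rule M.op_span_minimal)
    show "op_closed M ?\<Phi> ?C"
    proof (rule M.op_closedI)
      show "?C \<subseteq> carrier M" using g by auto
      have "\<zero>\<^bsub>M\<^esub> = \<zero> \<odot>\<^bsub>M\<^esub> g" using g by simp
      then show "\<zero>\<^bsub>M\<^esub> \<in> ?C" by blast
    next
      fix x y assume "x \<in> ?C" "y \<in> ?C"
      then obtain a b where *: "a \<in> carrier R" "b \<in> carrier R" "x = a \<odot>\<^bsub>M\<^esub> g" "y = b \<odot>\<^bsub>M\<^esub> g" by auto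
      then have "x \<oplus>\<^bsub>M\<^esub> y = (a \<oplus> b) \<odot>\<^bsub>M\<^esub> g" using g by (simp add: smult_l_distr)
      then show "x \<oplus>\<^bsub>M\<^esub> y \<in> ?C" using * by blast
    next
      fix x assume "x \<in> ?C"
      then obtain a where *: "a \<in> carrier R" "x = a \<odot>\<^bsub>M\<^esub> g" by auto
      then have "\<ominus>\<^bsub>M\<^esub> x = (\<ominus> a) \<odot>\<^bsub>M\<^esub> g" using g by (simp add: smult_l_minus)
      then show "\<ominus>\<^bsub>M\<^esub> x \<in> ?C" using * by blast
    next
      fix \<phi> x assume "\<phi> \<in> ?\<Phi>" "x \<in> ?C"
      then obtain a b where *: "a \<in> carrier R" "b \<in> carrier R" "x = a \<odot>\<^bsub>M\<^esub> g" "\<phi> = (\<lambda>x. b \<odot>\<^bsub>M\<^esub> x)"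
        using B by (auto simp: smult_ops_def)
      then have "\<phi> x = (b \<otimes> a) \<odot>\<^bsub>M\<^esub> g" using g by (simp add: smult_assoc1)
      then show "\<phi> x \<in> ?C" using * by blast
    qed
    have "g = \<one> \<odot>\<^bsub>M\<^esub> g" using g by simp
    then show "{g} \<subseteq> ?C" by blast
  qed
  fix S assume "S \<subseteq> op_span M ?\<Phi> {g}"
  with cyc have S: "S \<subseteq> ?C" by blast
  then have Sc: "S \<subseteq> carrier M" using g by auto
  have cl: "op_closed M ?\<Phi> (op_span M ?\<Phi> S')" if "S' \<subseteq> S" for S'
    using M.op_span_closed[OF ops] that Sc by auto
  define J where "J = {a \<in> carrier R. a \<odot>\<^bsub>M\<^esub> g \<in> op_span M ?\<Phi> S}"
  note clS = cl[OF subset_refl]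
  have "ideal J R"
  proof (rule R.idealI2)
    show "additive_subgroup J R"
      unfolding J_def using M.op_closed_zero[OF clS] M.op_closed_add[OF clS] M.op_closed_neg[OF clS] g
      by (intro R.additive_subgroupI2) (auto simp: smult_l_distr smult_l_minus)
  next
    fix a x assume "a \<in> J" "x \<in> carrier R"
    then show "x \<otimes> a \<in> J" unfolding J_def
      using op_closed_smult[OF B clS] g by (auto simp: smult_assoc1)
  qed
  then obtain T where T: "T \<subseteq> carrier R" "finite T" "J = Idl T"
    using noetherian_ring.finetely_gen[OF noeth] by blast
  have TJ: "T \<subseteq> J" using T R.genideal_self by auto
  have "finite ((\<lambda>a. a \<odot>\<^bsub>M\<^esub> g) ` T)" "(\<lambda>a. a \<odot>\<^bsub>M\<^esub> g) ` T \<subseteq> op_span M ?\<Phi> S"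
    using T TJ unfolding J_def by auto
  from M.op_span_finitary_finite[OF this] obtain S' where S': "S' \<subseteq> S" "finite S'"
    "(\<lambda>a. a \<odot>\<^bsub>M\<^esub> g) ` T \<subseteq> op_span M ?\<Phi> S'" by auto
  note cl' = cl[OF S'(1)]
  have "ideal {a \<in> carrier R. a \<odot>\<^bsub>M\<^esub> g \<in> op_span M ?\<Phi> S'} R"
  proof (rule R.idealI2)
    show "additive_subgroup {a \<in> carrier R. a \<odot>\<^bsub>M\<^esub> g \<in> op_span M ?\<Phi> S'} R"
      using M.op_closed_zero[OF cl'] M.op_closed_add[OF cl'] M.op_closed_neg[OF cl'] g
      by (intro R.additive_subgroupI2) (auto simp: smult_l_distr smult_l_minus)
  next
    fix a x assume "a \<in> {a \<in> carrier R. a \<odot>\<^bsub>M\<^esub> g \<in> op_span M ?\<Phi> S'}" "x \<in> carrier R"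
    then show "x \<otimes> a \<in> {a \<in> carrier R. a \<odot>\<^bsub>M\<^esub> g \<in> op_span M ?\<Phi> S'}"
      using op_closed_smult[OF B cl'] g by (auto simp: smult_assoc1)
  qed
  then have "J \<subseteq> {a \<in> carrier R. a \<odot>\<^bsub>M\<^esub> g \<in> op_span M ?\<Phi> S'}"
    unfolding T(3) using S'(3) T(1) by (intro R.genideal_minimal) auto
  moreover have "S \<subseteq> (\<lambda>a. a \<odot>\<^bsub>M\<^esub> g) ` J"
    using S op_span_incl[of S M ?\<Phi>] unfolding J_def by blast
  ultimately have "S \<subseteq> op_span M ?\<Phi> S'" by auto
  with S'(1,2) show "\<exists>S'\<subseteq>S. finite S' \<and> S \<subseteq> op_span M ?\<Phi> S'"
    by (intro exI[of _ S'] conjI)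
qed

end

section \<open>The Koszul complex as an iterated cone\<close>

text \<open>Indices and factors are arbitrary because three products are needed: chains over boolean
  lists, functions on exponents, and the product of the terms of a resolution. Each turns a whole
  family of modules into one.\<close>

definition prod_module :: "('i \<Rightarrow> ('a, 'm, 'z) module_scheme) \<Rightarrow> ('a, 'i \<Rightarrow> 'm) module" where
  "prod_module P = \<lparr>carrier = {w. \<forall>i. w i \<in> carrier (P i)}, monoid.mult = undefined, one = undefined,
     ring.zero = (\<lambda>i. \<zero>\<^bsub>P i\<^esub>), ring.add = (\<lambda>v w i. v i \<oplus>\<^bsub>P i\<^esub> w i), module.smult = (\<lambda>a w i. a \<odot>\<^bsub>P i\<^esub> w i)\<rparr>"

lemma prod_module_simps [simp]:
  "w \<in> carrier (prod_module P) \<longleftrightarrow> (\<forall>i. w i \<in> carrier (P i))"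
  "\<zero>\<^bsub>prod_module P\<^esub> = (\<lambda>i. \<zero>\<^bsub>P i\<^esub>)"
  "v \<oplus>\<^bsub>prod_module P\<^esub> w = (\<lambda>i. v i \<oplus>\<^bsub>P i\<^esub> w i)"
  "a \<odot>\<^bsub>prod_module P\<^esub> w = (\<lambda>i. a \<odot>\<^bsub>P i\<^esub> w i)"
  by (auto simp: prod_module_def)

lemma prod_module_abelian_group:
  assumes "\<And>i. abelian_group (P i)" shows "abelian_group (prod_module P)"
proof -
  interpret P: abelian_group "P i" for i by (rule assms)
  show ?thesis
  proof (rule abelian_groupI)
    show "\<exists>w\<in>carrier (prod_module P). w \<oplus>\<^bsub>prod_module P\<^esub> v = \<zero>\<^bsub>prod_module P\<^esub>"
      if "v \<in> carrier (prod_module P)" for v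
      using that by (intro bexI[of _ "\<lambda>i. \<ominus>\<^bsub>P i\<^esub> v i"]) (auto simp: P.l_neg)
  qed (auto simp: P.a_ac)
qed

lemma prod_module:
  assumes "cring R" "\<And>i. module R (P i)" shows "module R (prod_module P)"
proof -
  interpret P: module R "P i" for i by (rule assms)
  show ?thesis
  proof (rule moduleI)
    show "abelian_group (prod_module P)"
      by (intro prod_module_abelian_group P.M.abelian_group_axioms)
  qed (auto simp: assms(1) P.smult_l_distr P.smult_r_distr P.smult_assoc1)
qed

lemma prod_module_neg:
  assumes "\<And>i. abelian_group (P i)" "w \<in> carrier (prod_module P)"
  shows "\<ominus>\<^bsub>prod_module P\<^esub> w = (\<lambda>i. \<ominus>\<^bsub>P i\<^esub> w i)"
proof -
  have w: "w i \<in> carrier (P i)" for i using assms(2) unfolding prod_module_simps ..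
  have c: "(\<lambda>i. \<ominus>\<^bsub>P i\<^esub> w i) \<in> carrier (prod_module P)"
    unfolding prod_module_simps using abelian_group.a_inv_closed[OF assms(1) w] ..
  have "(\<lambda>i. \<ominus>\<^bsub>P i\<^esub> w i) \<oplus>\<^bsub>prod_module P\<^esub> w = \<zero>\<^bsub>prod_module P\<^esub>"
    unfolding prod_module_simps using abelian_group.l_neg[OF assms(1) w] by (rule ext)
  then show ?thesis
    by (rule abelian_group.minus_equality[OF prod_module_abelian_group[OF assms(1)] _ assms(2) c])
qed

lemma prod_module_minus:
  assumes "\<And>i. abelian_group (P i)" "w \<in> carrier (prod_module P)"
  shows "v \<ominus>\<^bsub>prod_module P\<^esub> w = (\<lambda>i. v i \<ominus>\<^bsub>P i\<^esub> w i)"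
  using prod_module_neg[OF assms] by (simp add: a_minus_def)

lemma prod_module_subgroup:
  assumes "\<And>i. abelian_group (P i)" "\<And>i. additive_subgroup (H i) (P i)"
  shows "additive_subgroup {w. \<forall>i. w i \<in> H i} (prod_module P)"
proof (rule abelian_group.additive_subgroupI2)
  have sub: "w \<in> carrier (prod_module P)" if "\<forall>i. w i \<in> H i" for w
    unfolding prod_module_simps using additive_subgroup.a_Hcarr[OF assms(2) spec[OF that]] ..
  then show "{w. \<forall>i. w i \<in> H i} \<subseteq> carrier (prod_module P)" by blast
  show "abelian_group (prod_module P)" by (rule prod_module_abelian_group[OF assms(1)])
  show "\<zero>\<^bsub>prod_module P\<^esub> \<in> {w. \<forall>i. w i \<in> H i}"
    unfolding prod_module_simps mem_Collect_eq using additive_subgroup.zero_closed[OF assms(2)] ..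
  fix x assume x: "x \<in> {w. \<forall>i. w i \<in> H i}"
  then have xi: "x i \<in> H i" for i by blast
  have "(\<ominus>\<^bsub>prod_module P\<^esub> x) i \<in> H i" for i
    unfolding prod_module_neg[OF assms(1) sub[OF allI, OF xi]]
    using abelian_group.additive_subgroup_neg[OF assms xi] .
  then show "\<ominus>\<^bsub>prod_module P\<^esub> x \<in> {w. \<forall>i. w i \<in> H i}" by blast
  fix y assume y: "y \<in> {w. \<forall>i. w i \<in> H i}"
  have "(x \<oplus>\<^bsub>prod_module P\<^esub> y) i \<in> H i" for i
    unfolding prod_module_simps using xi y additive_subgroup.a_closed[OF assms(2)] by blast
  then show "x \<oplus>\<^bsub>prod_module P\<^esub> y \<in> {w. \<forall>i. w i \<in> H i}" by blast
qed

section \<open>Coordinates and chains of iterated cones\<close>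

definition cone_fst :: "(bool list \<Rightarrow> 'c) \<Rightarrow> bool list \<Rightarrow> 'c" where
  "cone_fst w = (\<lambda>l. w (False # l))"

definition cone_snd :: "(bool list \<Rightarrow> 'c) \<Rightarrow> bool list \<Rightarrow> 'c" where
  "cone_snd w = (\<lambda>l. w (True # l))"

definition cone_pair :: "'c \<Rightarrow> (bool list \<Rightarrow> 'c) \<Rightarrow> (bool list \<Rightarrow> 'c) \<Rightarrow> bool list \<Rightarrow> 'c" where
  "cone_pair z u v = (\<lambda>l. case l of [] \<Rightarrow> z | b # l' \<Rightarrow> if b then v l' else u l')"

lemma cone_simps [simp]:
  "cone_fst (cone_pair z u v) = u" "cone_snd (cone_pair z u v) = v"
  "cone_pair z u v [] = z" "cone_pair z u v (b # l) = (if b then v l else u l)"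
  by (auto simp: cone_fst_def cone_snd_def cone_pair_def)

lemma cone_pair_eq: "w = cone_pair z u v \<longleftrightarrow> w [] = z \<and> cone_fst w = u \<and> cone_snd w = v"
  by (auto simp: cone_fst_def cone_snd_def cone_pair_def fun_eq_iff split: list.splits)

lemma cone_eqI: "v [] = w [] \<Longrightarrow> cone_fst v = cone_fst w \<Longrightarrow> cone_snd v = cone_snd w \<Longrightarrow> v = w"
  using cone_pair_eq by metis

definition chain_module :: "('a, 'c, 'z) module_scheme \<Rightarrow> ('a, bool list \<Rightarrow> 'c) module" where
  "chain_module M = prod_module (\<lambda>_. M)"

lemma chain_module_simps [simp]:
  "w \<in> carrier (chain_module M) \<longleftrightarrow> (\<forall>l. w l \<in> carrier M)"
  "\<zero>\<^bsub>chain_module M\<^esub> = (\<lambda>l. \<zero>\<^bsub>M\<^esub>)"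
  "v \<oplus>\<^bsub>chain_module M\<^esub> w = (\<lambda>l. v l \<oplus>\<^bsub>M\<^esub> w l)"
  "a \<odot>\<^bsub>chain_module M\<^esub> w = (\<lambda>l. a \<odot>\<^bsub>M\<^esub> w l)"
  by (auto simp: chain_module_def)

text \<open>The Koszul complex of a sequence is the iterated mapping cone of multiplication by its
  members; a chain of the \<open>n\<close>-fold cone is indexed by the boolean lists of length \<open>n\<close>, and
  \<open>True\<close> marks the shifted copy. The cohomological degree drops and the internal degree rises by
  the number of \<open>True\<close>s.\<close>

primrec koszul_diff ::
    "('a, 'c, 'z) module_scheme \<Rightarrow> ('c \<Rightarrow> 'c) \<Rightarrow> 'a list \<Rightarrow> (bool list \<Rightarrow> 'c) \<Rightarrow> bool list \<Rightarrow> 'c" where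
  "koszul_diff M D [] w = (\<lambda>l. D (w l))"
| "koszul_diff M D (y # ys) w = cone_pair \<zero>\<^bsub>M\<^esub> (koszul_diff M D ys (cone_fst w))
     (\<lambda>l. y \<odot>\<^bsub>M\<^esub> cone_fst w l \<ominus>\<^bsub>M\<^esub> koszul_diff M D ys (cone_snd w) l)"

definition twist :: "bool list \<Rightarrow> int" where
  "twist l = int (count_list l True)"

lemma twist_simps [simp]: "twist [] = 0" "twist (b # l) = (if b then twist l + 1 else twist l)"
  by (auto simp: twist_def)

text \<open>If \<open>C\<close> is concentrated in cohomological degree 0, only the lists with
  exactly \<open>i\<close> entries \<open>True\<close> contribute and the usual Koszul complex
  results. In general this is the total complex of \<open>C\<close> with the Koszul complex.\<close>

definition koszul_chains ::
    "('a, 'c, 'z) module_scheme \<Rightarrow> nat \<Rightarrow> (int \<Rightarrow> int \<Rightarrow> 'c set) \<Rightarrow> int \<Rightarrow> int \<Rightarrow> (bool list \<Rightarrow> 'c) set" where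
  "koszul_chains M n C i \<mu> =
     {w. \<forall>l. w l \<in> (if length l = n then C (i - twist l) (\<mu> + twist l) else {\<zero>\<^bsub>M\<^esub>})}"

lemma koszul_chains_0:
  "w \<in> koszul_chains M 0 C i \<mu> \<longleftrightarrow> w [] \<in> C i \<mu> \<and> (\<forall>l. l \<noteq> [] \<longrightarrow> w l = \<zero>\<^bsub>M\<^esub>)"
proof -
  have "w l \<in> (if length l = 0 then C (i - twist l) (\<mu> + twist l) else {\<zero>\<^bsub>M\<^esub>}) \<longleftrightarrow>
      (l = [] \<longrightarrow> w [] \<in> C i \<mu>) \<and> (l \<noteq> [] \<longrightarrow> w l = \<zero>\<^bsub>M\<^esub>)" for l
    by simp
  then show ?thesis unfolding koszul_chains_def by simp blast
qed

lemma all_bool_list: "(\<forall>l. P l) \<longleftrightarrow> P [] \<and> (\<forall>l. P (False # l)) \<and> (\<forall>l. P (True # l))"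
  by (metis (full_types) list.exhaust)

lemma koszul_chains_Suc:
  "w \<in> koszul_chains M (Suc n) C i \<mu> \<longleftrightarrow>
     w [] = \<zero>\<^bsub>M\<^esub> \<and> cone_fst w \<in> koszul_chains M n C i \<mu> \<and> cone_snd w \<in> koszul_chains M n C (i - 1) (\<mu> + 1)"
proof -
  have eq: "i - (twist l + 1) = i - 1 - twist l" "\<mu> + (twist l + 1) = \<mu> + 1 + twist l" for l
    by simp_all
  then show ?thesis
    unfolding koszul_chains_def cone_fst_def cone_snd_def
    by (simp only: mem_Collect_eq) (subst all_bool_list, simp add: eq)
qed

definition acyclic_at ::
    "('c, 'z) ring_scheme \<Rightarrow> ('c \<Rightarrow> 'c) \<Rightarrow> (int \<Rightarrow> int \<Rightarrow> 'c set) \<Rightarrow> int \<Rightarrow> int \<Rightarrow> bool" where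
  "acyclic_at G D C i \<mu> \<longleftrightarrow> (\<forall>z\<in>C i \<mu>. D z = \<zero>\<^bsub>G\<^esub> \<longrightarrow> (\<exists>b\<in>C (i - 1) \<mu>. D b = z))"

text \<open>\<open>D\<close> is ungraded; bidegrees enter only through families
  \<open>C i \<mu>\<close> of subgroups. Hence a resolution, the image of its augmentation and its
  torsion are all treated inside the same module.\<close>

locale differential_module = module R M for R (structure) and M (structure) +
  fixes D
  assumes D_additive: "additive_map M M D"
    and D_smult: "a \<in> carrier R \<Longrightarrow> x \<in> carrier M \<Longrightarrow> D (a \<odot>\<^bsub>M\<^esub> x) = a \<odot>\<^bsub>M\<^esub> D x"
    and D_D: "x \<in> carrier M \<Longrightarrow> D (D x) = \<zero>\<^bsub>M\<^esub>"

sublocale differential_module \<subseteq> Ch: module R "chain_module M"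
  unfolding chain_module_def by (rule prod_module[OF R.is_cring module_axioms])

context differential_module
begin

lemma chain_neg: "w \<in> carrier (chain_module M) \<Longrightarrow> \<ominus>\<^bsub>chain_module M\<^esub> w = (\<lambda>l. \<ominus>\<^bsub>M\<^esub> w l)"
  unfolding chain_module_def by (rule prod_module_neg[OF M.abelian_group_axioms])

lemma chain_minus:
  "w \<in> carrier (chain_module M) \<Longrightarrow> v \<ominus>\<^bsub>chain_module M\<^esub> w = (\<lambda>l. v l \<ominus>\<^bsub>M\<^esub> w l)"
  unfolding chain_module_def by (rule prod_module_minus[OF M.abelian_group_axioms])

lemma D_closed: "x \<in> carrier M \<Longrightarrow> D x \<in> carrier M"
  using additive_map_closed[OF D_additive] .

lemma D_zero: "D \<zero>\<^bsub>M\<^esub> = \<zero>\<^bsub>M\<^esub>"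
  using M.op_zero[OF D_additive] .

lemma cone_carrier:
  assumes "w \<in> carrier (chain_module M)"
  shows "cone_fst w \<in> carrier (chain_module M)" "cone_snd w \<in> carrier (chain_module M)"
  using assms by (auto simp: cone_fst_def cone_snd_def)

lemma cone_pair_carrier:
  "u \<in> carrier (chain_module M) \<Longrightarrow> v \<in> carrier (chain_module M) \<Longrightarrow>
    cone_pair \<zero>\<^bsub>M\<^esub> u v \<in> carrier (chain_module M)"
  by (auto simp: cone_pair_def split: list.splits)

lemma koszul_diff_carrier:
  "set ys \<subseteq> carrier R \<Longrightarrow> w \<in> carrier (chain_module M) \<Longrightarrow> koszul_diff M D ys w \<in> carrier (chain_module M)"
proof (induction ys arbitrary: w)
  case Nil then show ?case by (auto intro: D_closed)
next
  case (Cons y ys)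
  note c = cone_carrier[OF Cons.prems(2)]
  show ?case
    using Cons.IH[OF _ c(1)] Cons.IH[OF _ c(2)] c Cons.prems
    by (simp only: koszul_diff.simps, intro cone_pair_carrier) auto
qed

lemma koszul_diff_Cons:
  assumes "set ys \<subseteq> carrier R" "w \<in> carrier (chain_module M)"
  shows "koszul_diff M D (y # ys) w = cone_pair \<zero>\<^bsub>M\<^esub> (koszul_diff M D ys (cone_fst w))
     (y \<odot>\<^bsub>chain_module M\<^esub> cone_fst w \<ominus>\<^bsub>chain_module M\<^esub> koszul_diff M D ys (cone_snd w))"
  using chain_minus[OF koszul_diff_carrier[OF assms(1) cone_carrier(2)[OF assms(2)]]] by simp

lemma minus_add_minus:
  assumes "a \<in> carrier M" "b \<in> carrier M" "c \<in> carrier M" "d \<in> carrier M"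
  shows "(a \<oplus>\<^bsub>M\<^esub> b) \<ominus>\<^bsub>M\<^esub> (c \<oplus>\<^bsub>M\<^esub> d) = (a \<ominus>\<^bsub>M\<^esub> c) \<oplus>\<^bsub>M\<^esub> (b \<ominus>\<^bsub>M\<^esub> d)"
  using assms by (simp add: a_minus_def M.minus_add M.a_ac)

lemma koszul_diff_additive:
  "set ys \<subseteq> carrier R \<Longrightarrow> additive_map (chain_module M) (chain_module M) (koszul_diff M D ys)"
proof (induction ys)
  case Nil
  show ?case using D_closed additive_map_add[OF D_additive] by (auto simp: additive_map_def)
next
  case (Cons y ys)
  then have ys: "set ys \<subseteq> carrier R" and y: "y \<in> carrier R" by auto
  note IH = Cons.IH[OF ys]
  show ?case
    unfolding additive_map_def
  proof (intro conjI ballI funcsetI koszul_diff_carrier Cons.prems)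
    fix v w assume v: "v \<in> carrier (chain_module M)" and w: "w \<in> carrier (chain_module M)"
    note cv = cone_carrier[OF v] note cw = cone_carrier[OF w]
    have e: "cone_fst (v \<oplus>\<^bsub>chain_module M\<^esub> w) = cone_fst v \<oplus>\<^bsub>chain_module M\<^esub> cone_fst w"
      "cone_snd (v \<oplus>\<^bsub>chain_module M\<^esub> w) = cone_snd v \<oplus>\<^bsub>chain_module M\<^esub> cone_snd w"
      by (auto simp: cone_fst_def cone_snd_def)
    have k: "koszul_diff M D ys u l \<in> carrier M" if "u \<in> carrier (chain_module M)" for u l
      using koszul_diff_carrier[OF ys that] by simp
    show "koszul_diff M D (y # ys) (v \<oplus>\<^bsub>chain_module M\<^esub> w) =
        koszul_diff M D (y # ys) v \<oplus>\<^bsub>chain_module M\<^esub> koszul_diff M D (y # ys) w"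
    proof (rule cone_eqI)
      show "cone_snd (koszul_diff M D (y # ys) (v \<oplus>\<^bsub>chain_module M\<^esub> w)) =
        cone_snd (koszul_diff M D (y # ys) v \<oplus>\<^bsub>chain_module M\<^esub> koszul_diff M D (y # ys) w)"
        unfolding koszul_diff.simps(2) e additive_map_add[OF IH cv(2) cw(2)]
        using cv cw k[OF cv(2)] k[OF cw(2)] y
        by (simp add: cone_snd_def minus_add_minus smult_r_distr)
    qed (simp, unfold koszul_diff.simps(2) e additive_map_add[OF IH cv(1) cw(1)],
         simp add: cone_fst_def)
  qed
qed

end

text \<open>Naturality is required on a subgroup \<open>H\<close> only. The application maps
  functions in the Rees module to a resolution of \<open>N n\<close>, and the augmentation is known
  to be a homomorphism on \<open>N n\<close> alone.\<close>

lemma koszul_diff_natural: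
  assumes M: "differential_module R M D" and M': "abelian_group M'"
    and H: "additive_subgroup H M" "\<And>x. x \<in> H \<Longrightarrow> D x \<in> H"
      "\<And>a x. a \<in> set ys \<Longrightarrow> x \<in> H \<Longrightarrow> a \<odot>\<^bsub>M\<^esub> x \<in> H"
    and f: "\<And>x. x \<in> H \<Longrightarrow> f x \<in> carrier M'" "\<And>x y. x \<in> H \<Longrightarrow> y \<in> H \<Longrightarrow> f (x \<oplus>\<^bsub>M\<^esub> y) = f x \<oplus>\<^bsub>M'\<^esub> f y"
      "\<And>x. x \<in> H \<Longrightarrow> f (D x) = D' (f x)"
      "\<And>a x. a \<in> set ys \<Longrightarrow> x \<in> H \<Longrightarrow> f (a \<odot>\<^bsub>M\<^esub> x) = a \<odot>\<^bsub>M'\<^esub> f x"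
    and w: "\<And>l. w l \<in> H"
  shows "koszul_diff M' D' ys (\<lambda>l. f (w l)) = (\<lambda>l. f (koszul_diff M D ys w l)) \<and>
    (\<forall>l. koszul_diff M D ys w l \<in> H)"
proof -
  interpret differential_module R M D by (rule M)
  interpret M': abelian_group M' by (rule M')
  have H0: "\<zero>\<^bsub>M\<^esub> \<in> H" and Hm: "\<And>x y. x \<in> H \<Longrightarrow> y \<in> H \<Longrightarrow> x \<ominus>\<^bsub>M\<^esub> y \<in> H"
    and Hn: "\<And>x. x \<in> H \<Longrightarrow> \<ominus>\<^bsub>M\<^esub> x \<in> H"
    using additive_subgroup.zero_closed[OF H(1)] M.additive_subgroup_minus[OF H(1)]
      M.additive_subgroup_neg[OF H(1)] by auto
  have Hc: "x \<in> carrier M" if "x \<in> H" for x using additive_subgroup.a_subset[OF H(1)] that by auto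
  have f0: "f \<zero>\<^bsub>M\<^esub> = \<zero>\<^bsub>M'\<^esub>"
    using f(2)[OF H0 H0] f(1)[OF H0] by (metis M'.add.r_cancel_one' M.l_zero M.zero_closed)
  have fn: "f (\<ominus>\<^bsub>M\<^esub> x) = \<ominus>\<^bsub>M'\<^esub> f x" if "x \<in> H" for x
    using f(2)[OF Hn[OF that] that] f(1)[OF that] f(1)[OF Hn[OF that]] f0 Hc[OF that]
    by (metis M'.minus_equality M.l_neg)
  have fm: "f (x \<ominus>\<^bsub>M\<^esub> y) = f x \<ominus>\<^bsub>M'\<^esub> f y" if "x \<in> H" "y \<in> H" for x y
    using f(2)[OF that(1) Hn[OF that(2)]] fn[OF that(2)] by (simp add: a_minus_def)
  show ?thesis
    using w H(3) f(4)
  proof (induction ys arbitrary: w)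
    case Nil then show ?case using H f by auto
  next
    case (Cons y ys)
    have 1: "koszul_diff M' D' ys (\<lambda>l. f (cone_fst w l)) = (\<lambda>l. f (koszul_diff M D ys (cone_fst w) l)) \<and>
      (\<forall>l. koszul_diff M D ys (cone_fst w) l \<in> H)"
      using Cons.prems by (intro Cons.IH) (auto simp: cone_fst_def)
    have 2: "koszul_diff M' D' ys (\<lambda>l. f (cone_snd w l)) = (\<lambda>l. f (koszul_diff M D ys (cone_snd w) l)) \<and>
      (\<forall>l. koszul_diff M D ys (cone_snd w) l \<in> H)"
      using Cons.prems by (intro Cons.IH) (auto simp: cone_snd_def)
    have w: "cone_fst w l \<in> H" for l using Cons.prems by (simp add: cone_fst_def)
    have e: "cone_fst (\<lambda>l. f (w l)) = (\<lambda>l. f (cone_fst w l))" "cone_snd (\<lambda>l. f (w l)) = (\<lambda>l. f (cone_snd w l))"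
      by (auto simp: cone_fst_def cone_snd_def)
    have H2: "y \<odot>\<^bsub>M\<^esub> cone_fst w l \<in> H" for l using Cons.prems w by simp
    show ?case
    proof
      show "\<forall>l. koszul_diff M D (y # ys) w l \<in> H"
        using 1 2 H0 Hm[OF H2] by (auto simp: cone_pair_def split: list.splits)
      show "koszul_diff M' D' (y # ys) (\<lambda>l. f (w l)) = (\<lambda>l. f (koszul_diff M D (y # ys) w l))"
        unfolding koszul_diff.simps e using 1 2 fm[OF H2] f0 Cons.prems(3)[OF _ w]
        by (auto simp: cone_pair_def fun_eq_iff split: list.splits)
    qed
  qed
qed

context differential_module
begin

lemma koszul_diff_map:
  assumes "set ys \<subseteq> carrier R" "additive_map M M f"
    "\<And>x. x \<in> carrier M \<Longrightarrow> f (D x) = D (f x)"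
    "\<And>a x. a \<in> set ys \<Longrightarrow> x \<in> carrier M \<Longrightarrow> f (a \<odot>\<^bsub>M\<^esub> x) = a \<odot>\<^bsub>M\<^esub> f x"
    "w \<in> carrier (chain_module M)"
  shows "koszul_diff M D ys (\<lambda>l. f (w l)) = (\<lambda>l. f (koszul_diff M D ys w l))"
  by (rule conjunct1[OF koszul_diff_natural[where H = "carrier M"]])
    (use assms additive_map_closed[OF assms(2)] additive_map_add[OF assms(2)] D_closed in
      \<open>auto intro!: differential_module_axioms M.abelian_group_axioms M.additive_subgroupI2\<close>)

lemma koszul_diff_smult:
  assumes "set ys \<subseteq> carrier R" "a \<in> carrier R" "w \<in> carrier (chain_module M)"
  shows "koszul_diff M D ys (a \<odot>\<^bsub>chain_module M\<^esub> w) = a \<odot>\<^bsub>chain_module M\<^esub> koszul_diff M D ys w"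
proof -
  have "b \<odot>\<^bsub>M\<^esub> (a \<odot>\<^bsub>M\<^esub> x) = a \<odot>\<^bsub>M\<^esub> (b \<odot>\<^bsub>M\<^esub> x)" if "b \<in> carrier R" "x \<in> carrier M" for b x
    using that assms by (simp add: smult_assoc1[symmetric] R.m_comm)
  then show ?thesis
    using koszul_diff_map[of ys "\<lambda>x. a \<odot>\<^bsub>M\<^esub> x" w] assms smult_additive_map D_smult by (auto simp: subset_iff)
qed

text \<open>On a pair \<open>(u, v)\<close> the second coordinate of the square is
  \<open>y (d u) - d (y u - d v)\<close>, which vanishes by linearity of \<open>d\<close> and by
  induction.\<close>

lemma koszul_diff_D:
  "set ys \<subseteq> carrier R \<Longrightarrow> w \<in> carrier (chain_module M) \<Longrightarrow>
    koszul_diff M D ys (koszul_diff M D ys w) = \<zero>\<^bsub>chain_module M\<^esub>"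
proof (induction ys arbitrary: w)
  case Nil then show ?case by (auto simp: D_D)
next
  case (Cons y ys)
  then have ys: "set ys \<subseteq> carrier R" and y: "y \<in> carrier R" by auto
  let ?C = "chain_module M" and ?d = "koszul_diff M D ys"
  let ?u = "cone_fst w" and ?v = "cone_snd w"
  note c = cone_carrier[OF Cons.prems(2)]
  note k = koszul_diff_carrier[OF ys]
  have yu: "y \<odot>\<^bsub>?C\<^esub> ?u \<in> carrier ?C" "y \<odot>\<^bsub>?C\<^esub> ?d ?u \<in> carrier ?C"
    using y c k[OF c(1)] Ch.smult_closed by blast+
  have e: "koszul_diff M D (y # ys) w = cone_pair \<zero>\<^bsub>M\<^esub> (?d ?u) (y \<odot>\<^bsub>?C\<^esub> ?u \<ominus>\<^bsub>?C\<^esub> ?d ?v)"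
    by (rule koszul_diff_Cons[OF ys Cons.prems(2)])
  have m: "y \<odot>\<^bsub>?C\<^esub> ?u \<ominus>\<^bsub>?C\<^esub> ?d ?v \<in> carrier ?C"
    using yu k[OF c(2)] Ch.M.minus_closed by blast
  have "?d (y \<odot>\<^bsub>?C\<^esub> ?u \<ominus>\<^bsub>?C\<^esub> ?d ?v) = ?d (y \<odot>\<^bsub>?C\<^esub> ?u) \<ominus>\<^bsub>?C\<^esub> ?d (?d ?v)"
    by (rule Ch.M.op_minus[OF koszul_diff_additive[OF ys] yu(1) k[OF c(2)]])
  also have "\<dots> = y \<odot>\<^bsub>?C\<^esub> ?d ?u \<ominus>\<^bsub>?C\<^esub> \<zero>\<^bsub>?C\<^esub>"
    unfolding koszul_diff_smult[OF ys y c(1)] Cons.IH[OF ys c(2)] ..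
  finally have 2: "?d (y \<odot>\<^bsub>?C\<^esub> ?u \<ominus>\<^bsub>?C\<^esub> ?d ?v) = y \<odot>\<^bsub>?C\<^esub> ?d ?u"
    using yu(2) Ch.M.diff_zero by metis
  have "y \<odot>\<^bsub>?C\<^esub> ?d ?u \<ominus>\<^bsub>?C\<^esub> y \<odot>\<^bsub>?C\<^esub> ?d ?u = \<zero>\<^bsub>?C\<^esub>"
    using yu(2) Ch.M.diff_self by blast
  with 2 have "koszul_diff M D (y # ys) (koszul_diff M D (y # ys) w) =
      cone_pair \<zero>\<^bsub>M\<^esub> \<zero>\<^bsub>?C\<^esub> \<zero>\<^bsub>?C\<^esub>"
    by (subst koszul_diff_Cons[OF ys koszul_diff_carrier[OF Cons.prems]])
      (simp only: e cone_simps Cons.IH[OF ys c(1)])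
  then show ?case by (auto simp: cone_pair_def split: list.splits)
qed

end

section \<open>Relative acyclicity and torsion\<close>

text \<open>For \<open>C'\<close> inside \<open>C\<close> this is exactness of the quotient complex
  \<open>C / C'\<close> in all bidegrees, in terms of representatives; the inclusion is then a
  quasi-isomorphism.\<close>

definition relatively_acyclic ::
    "('c, 'z) ring_scheme \<Rightarrow> ('c \<Rightarrow> 'c) \<Rightarrow> (int \<Rightarrow> int \<Rightarrow> 'c set) \<Rightarrow> (int \<Rightarrow> int \<Rightarrow> 'c set) \<Rightarrow> bool" where
  "relatively_acyclic G D C C' \<longleftrightarrow>
     (\<forall>i \<mu>. \<forall>z\<in>C i \<mu>. D z \<in> C' (i + 1) \<mu> \<longrightarrow> (\<exists>q\<in>C (i - 1) \<mu>. z \<ominus>\<^bsub>G\<^esub> D q \<in> C' i \<mu>))"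

lemma acyclic_atD:
  "acyclic_at G D C i \<mu> \<Longrightarrow> z \<in> C i \<mu> \<Longrightarrow> D z = \<zero>\<^bsub>G\<^esub> \<Longrightarrow> \<exists>b\<in>C (i - 1) \<mu>. D b = z"
  unfolding acyclic_at_def by blast

lemma relatively_acyclicD:
  "relatively_acyclic G D C C' \<Longrightarrow> z \<in> C i \<mu> \<Longrightarrow> D z \<in> C' (i + 1) \<mu> \<Longrightarrow>
    \<exists>q\<in>C (i - 1) \<mu>. z \<ominus>\<^bsub>G\<^esub> D q \<in> C' i \<mu>"
  unfolding relatively_acyclic_def by blast

context abelian_group
begin

lemma diff_add_cancel:
  assumes "x \<in> carrier G" "y \<in> carrier G" shows "(x \<ominus> y) \<oplus> y = x"
  using assms by (simp add: a_minus_def a_assoc l_neg)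

lemma diff_diff_eq:
  assumes "x \<in> carrier G" "y \<in> carrier G" "z \<in> carrier G"
  shows "(x \<ominus> y) \<ominus> (x \<ominus> z) = z \<ominus> y"
proof -
  have "(x \<ominus> y) \<ominus> (x \<ominus> z) = (x \<oplus> \<ominus> y) \<ominus> (x \<oplus> \<ominus> z)" by (simp add: a_minus_def)
  also have "\<dots> = \<ominus> y \<ominus> \<ominus> z" using assms by (intro add_diff_cancel) auto
  also have "\<dots> = z \<ominus> y" using assms by (simp add: a_minus_def a_comm)
  finally show ?thesis .
qed

lemma neg_diff:
  assumes "x \<in> carrier G" "y \<in> carrier G" shows "\<ominus> (x \<ominus> y) = y \<ominus> x"
  using assms by (simp add: a_minus_def minus_add a_comm)

lemma diff_eq_zero_iff:
  assumes "x \<in> carrier G" "y \<in> carrier G" shows "x \<ominus> y = \<zero> \<longleftrightarrow> x = y"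
  using assms diff_add_cancel[OF assms] diff_self by (metis l_zero)

text \<open>A cocycle of \<open>C\<close> is a cocycle of the quotient, hence cohomologous to one of
  \<open>C'\<close>, and that one bounds by assumption.\<close>

lemma relatively_acyclic_transfer:
  assumes D: "additive_map G G D" "\<And>z. z \<in> carrier G \<Longrightarrow> D (D z) = \<zero>"
    and C: "\<And>j \<nu>. additive_subgroup (C j \<nu>) G" "\<And>j \<nu>. additive_subgroup (C' j \<nu>) G" "\<And>j \<nu>. C' j \<nu> \<subseteq> C j \<nu>"
    and rel: "relatively_acyclic G D C C'" and ac: "acyclic_at G D C' i \<mu>"
  shows "acyclic_at G D C i \<mu>"
  unfolding acyclic_at_def
proof (intro ballI impI)
  fix z assume z: "z \<in> C i \<mu>" "D z = \<zero>"
  have Cc: "x \<in> carrier G" if "x \<in> C j \<nu>" for x j \<nu>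
    using additive_subgroup.a_Hcarr[OF C(1) that] .
  note Dc = additive_map_closed[OF D(1)]
  have "D z \<in> C' (i + 1) \<mu>" using z(2) additive_subgroup.zero_closed[OF C(2)] by simp
  then obtain q where q: "q \<in> C (i - 1) \<mu>" "z \<ominus> D q \<in> C' i \<mu>"
    using relatively_acyclicD[OF rel z(1)] by blast
  note zc = Cc[OF z(1)] note qc = Cc[OF q(1)]
  have "D (z \<ominus> D q) = D z \<ominus> D (D q)" by (rule op_minus[OF D(1) zc Dc[OF qc]])
  then have "D (z \<ominus> D q) = \<zero>" using z(2) D(2)[OF qc] diff_self by simp
  then obtain e where e: "e \<in> C' (i - 1) \<mu>" "D e = z \<ominus> D q"
    using acyclic_atD[OF ac q(2)] by blast
  have eC: "e \<in> C (i - 1) \<mu>" using e C(3) by blast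
  have "D (e \<oplus> q) = (z \<ominus> D q) \<oplus> D q"
    using additive_map_add[OF D(1) Cc[OF eC] qc] e(2) by simp
  then have "D (e \<oplus> q) = z" using diff_add_cancel[OF zc Dc[OF qc]] by simp
  then show "\<exists>b\<in>C (i - 1) \<mu>. D b = z"
    using additive_subgroup.a_closed[OF C(1) eC q(1)] by blast
qed

text \<open>The cone of \<open>\<xi>\<close> on an exact quotient complex is exact. Modulo
  \<open>C'\<close> the pair \<open>(c, c')\<close> is a cocycle of this cone, and
  \<open>(q, q')\<close> bounds it.\<close>

lemma relatively_acyclic_cone:
  assumes D: "additive_map G G D" "\<And>z. z \<in> carrier G \<Longrightarrow> D (D z) = \<zero>"
    and \<xi>: "additive_map G G \<xi>" "\<And>z. z \<in> carrier G \<Longrightarrow> D (\<xi> z) = \<xi> (D z)"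
    and C: "\<And>j \<nu>. additive_subgroup (C j \<nu>) G" "\<And>j \<nu>. additive_subgroup (C' j \<nu>) G"
    and CD: "\<And>j \<nu> c. c \<in> C j \<nu> \<Longrightarrow> D c \<in> C (j + 1) \<nu>"
    and CX: "\<And>j \<nu> c. c \<in> C j \<nu> \<Longrightarrow> \<xi> c \<in> C j (\<nu> + 1)" "\<And>j \<nu> c. c \<in> C' j \<nu> \<Longrightarrow> \<xi> c \<in> C' j (\<nu> + 1)"
    and rel: "relatively_acyclic G D C C'"
    and c: "c \<in> C i \<mu>" "c' \<in> C (i - 1) (\<mu> + 1)" "D c \<in> C' (i + 1) \<mu>" "\<xi> c \<ominus> D c' \<in> C' i (\<mu> + 1)"
  shows "\<exists>q\<in>C (i - 1) \<mu>. \<exists>q'\<in>C (i - 1 - 1) (\<mu> + 1).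
    c \<ominus> D q \<in> C' i \<mu> \<and> c' \<ominus> (\<xi> q \<ominus> D q') \<in> C' (i - 1) (\<mu> + 1)"
proof -
  have Cc: "x \<in> carrier G" if "x \<in> C j \<nu>" for x j \<nu>
    using additive_subgroup.a_Hcarr[OF C(1) that] .
  note Dc = additive_map_closed[OF D(1)] and Xc = additive_map_closed[OF \<xi>(1)]
  obtain q where q: "q \<in> C (i - 1) \<mu>" "c \<ominus> D q \<in> C' i \<mu>"
    using relatively_acyclicD[OF rel c(1) c(3)] by blast
  note qc = Cc[OF q(1)] and cc = Cc[OF c(1)] and cc' = Cc[OF c(2)]
  \<comment> \<open>Subtracting the boundary of \<open>(q, 0)\<close> leaves
    \<open>c' - \<xi> q\<close> in the second coordinate. Its negative \<open>p\<close> is a cocycle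
    modulo \<open>C'\<close>, so it is the boundary of some \<open>q'\<close> modulo
    \<open>C'\<close>.\<close>
  define p where "p = \<xi> q \<ominus> c'"
  have p: "p \<in> C (i - 1) (\<mu> + 1)"
    unfolding p_def by (rule additive_subgroup_minus[OF C(1) CX(1)[OF q(1)] c(2)])
  have "\<xi> (c \<ominus> D q) = \<xi> c \<ominus> D (\<xi> q)"
    using op_minus[OF \<xi>(1) cc Dc[OF qc]] \<xi>(2)[OF qc] by simp
  moreover have "D p = D (\<xi> q) \<ominus> D c'" unfolding p_def by (rule op_minus[OF D(1) Xc[OF qc] cc'])
  ultimately have "(\<xi> c \<ominus> D c') \<ominus> \<xi> (c \<ominus> D q) = D p"
    using diff_diff_eq[OF Xc[OF cc] Dc[OF cc'] Dc[OF Xc[OF qc]]] by simp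
  then have "D p \<in> C' (i - 1 + 1) (\<mu> + 1)"
    using additive_subgroup_minus[OF C(2) c(4) CX(2)[OF q(2)]] by simp
  then obtain q' where q': "q' \<in> C (i - 1 - 1) (\<mu> + 1)" "p \<ominus> D q' \<in> C' (i - 1) (\<mu> + 1)"
    using relatively_acyclicD[OF rel p] by blast
  note qc' = Cc[OF q'(1)]
  have "c' \<ominus> (\<xi> q \<ominus> D q') = \<ominus> (p \<ominus> D q')"
  proof -
    have "\<ominus> (p \<ominus> D q') = D q' \<ominus> (\<xi> q \<ominus> c')"
      unfolding p_def[symmetric] by (rule neg_diff[OF Cc[OF p] Dc[OF qc']])
    then show ?thesis
      using Xc[OF qc] cc' Dc[OF qc'] by (simp add: a_minus_def minus_add a_ac)
  qed
  then have "c' \<ominus> (\<xi> q \<ominus> D q') \<in> C' (i - 1) (\<mu> + 1)"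
    using additive_subgroup_neg[OF C(2) q'(2)] by simp
  with q q'(1) show ?thesis by blast
qed

text \<open>On classes killed by a power of \<open>\<xi>\<close>, injectivity of \<open>\<xi>\<close> on cohomology, which the cone
  measures, forces vanishing; divisibility moves a primitive into the torsion part.\<close>

lemma torsion_acyclic:
  fixes C :: "int \<Rightarrow> int \<Rightarrow> 'a set"
  assumes D: "additive_map G G D" "\<And>z. z \<in> carrier G \<Longrightarrow> D (D z) = \<zero>"
    and \<xi>: "additive_map G G \<xi>" "\<And>z. z \<in> carrier G \<Longrightarrow> D (\<xi> z) = \<xi> (D z)"
    and C: "\<And>j \<nu>. additive_subgroup (C j \<nu>) G"
    and CD: "\<And>j \<nu> c. c \<in> C j \<nu> \<Longrightarrow> D c \<in> C (j + 1) \<nu>"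
    and CX: "\<And>j \<nu> c. c \<in> C j \<nu> \<Longrightarrow> \<xi> c \<in> C j (\<nu> + 1)"
    and div: "\<And>j \<nu> b. b \<in> C j (\<nu> + 1) \<Longrightarrow> \<exists>c\<in>C j \<nu>. \<exists>l. (\<xi> ^^ Suc l) c = (\<xi> ^^ l) b"
    and cone: "\<And>\<nu> c c'. \<mu> \<le> \<nu> \<Longrightarrow> c \<in> C i \<nu> \<Longrightarrow> c' \<in> C (i - 1) (\<nu> + 1) \<Longrightarrow> D c = \<zero> \<Longrightarrow> \<xi> c = D c' \<Longrightarrow>
      \<exists>b\<in>C (i - 1) \<nu>. \<exists>b'\<in>C (i - 2) (\<nu> + 1). c = D b \<and> c' = \<xi> b \<ominus> D b'"
    and z: "z \<in> C i \<mu>" "D z = \<zero>" "(\<xi> ^^ l) z = \<zero>"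
  shows "\<exists>w\<in>C (i - 1) \<mu>. (\<exists>m. (\<xi> ^^ m) w = \<zero>) \<and> D w = z"
proof -
  have Cc: "x \<in> carrier G" if "x \<in> C j \<nu>" for x j \<nu>
    using additive_subgroup.a_Hcarr[OF C(1) that] .
  note Dc = additive_map_closed[OF D(1)] and Xc = additive_map_closed[OF \<xi>(1)]
  note Xp = additive_map_power[OF \<xi>(1)]
  note Xpc = additive_map_closed[OF Xp]
  have DXp: "D ((\<xi> ^^ n) x) = (\<xi> ^^ n) (D x)" if "x \<in> carrier G" for n x
    by (rule power_commute[where \<phi> = D, OF \<xi>(1) \<xi>(2) that])
  \<comment> \<open>The claim is made for all degrees \<open>\<nu>\<close> from \<open>\<mu>\<close>
    on, since the induction on the torsion exponent passes from \<open>z\<close> to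
    \<open>\<xi> z\<close>, which is one degree higher.\<close>
  have "\<exists>w\<in>C (i - 1) \<nu>. (\<exists>m. (\<xi> ^^ m) w = \<zero>) \<and> D w = z"
    if "\<mu> \<le> \<nu>" "z \<in> C i \<nu>" "D z = \<zero>" "(\<xi> ^^ l) z = \<zero>" for l \<nu> z
    using that
  proof (induction l arbitrary: z \<nu>)
    case 0
    have "D \<zero> = z" using 0 op_zero[OF D(1)] by simp
    moreover have "(\<xi> ^^ 0) \<zero> = \<zero>" by simp
    ultimately show ?case using additive_subgroup.zero_closed[OF C] by blast
  next
    case (Suc l)
    note z = Suc.prems(2)
    have "D (\<xi> z) = \<zero>" using \<xi>(2)[OF Cc[OF z]] Suc.prems(3) op_zero[OF \<xi>(1)] by simp
    moreover have "(\<xi> ^^ l) (\<xi> z) = \<zero>" using Suc.prems(4) by (simp add: funpow_swap1)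
    moreover have "\<mu> \<le> \<nu> + 1" using Suc.prems(1) by simp
    ultimately obtain w' m where w': "w' \<in> C (i - 1) (\<nu> + 1)" "(\<xi> ^^ m) w' = \<zero>" "D w' = \<xi> z"
      using Suc.IH[OF _ CX[OF z]] by blast
    obtain b b' where b: "b \<in> C (i - 1) \<nu>" "b' \<in> C (i - 2) (\<nu> + 1)" "z = D b" "w' = \<xi> b \<ominus> D b'"
      using cone[OF Suc.prems(1) z w'(1) Suc.prems(3) w'(3)[symmetric]] by blast
    \<comment> \<open>The primitive \<open>b\<close> of \<open>z\<close> satisfies
      \<open>\<xi> b = w' + D b'\<close> with \<open>w'\<close> torsion, so only \<open>D b'\<close>
      keeps \<open>b\<close> from being torsion. Dividing \<open>b'\<close> by \<open>\<xi>\<close>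
      up to torsion gives \<open>c\<close>, and \<open>b - D c\<close> is torsion with the same
      boundary.\<close>
    obtain c n where c: "c \<in> C (i - 2) \<nu>" "(\<xi> ^^ Suc n) c = (\<xi> ^^ n) b'" using div[OF b(2)] by blast
    note bc = Cc[OF b(1)] and bc' = Cc[OF b(2)] and cc = Cc[OF c(1)] and wc' = Cc[OF w'(1)]
    define w where "w = b \<ominus> D c"
    have "D c \<in> C (i - 1) \<nu>" using CD[OF c(1)] by simp
    then have w: "w \<in> C (i - 1) \<nu>" unfolding w_def by (rule additive_subgroup_minus[OF C b(1)])
    have Dw: "D w = z"
      using op_minus[OF D(1) bc Dc[OF cc]] D(2)[OF cc] diff_zero[OF Dc[OF bc]] b(3)
      unfolding w_def by simp
    have "(\<xi> ^^ n) (\<xi> w) = (\<xi> ^^ n) (\<xi> b) \<ominus> (\<xi> ^^ n) (\<xi> (D c))"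
      unfolding w_def op_minus[OF \<xi>(1) bc Dc[OF cc]] by (rule op_minus[OF Xp Xc[OF bc] Xc[OF Dc[OF cc]]])
    also have "(\<xi> ^^ n) (\<xi> (D c)) = D ((\<xi> ^^ Suc n) c)"
      unfolding DXp[OF cc] by (simp add: funpow_swap1)
    also have "\<dots> = (\<xi> ^^ n) (D b')" unfolding c(2) by (rule DXp[OF bc'])
    also have "(\<xi> ^^ n) (\<xi> b) \<ominus> (\<xi> ^^ n) (D b') = (\<xi> ^^ n) w'"
      unfolding b(4) by (rule op_minus[OF Xp Xc[OF bc] Dc[OF bc'], symmetric])
    finally have "(\<xi> ^^ m) ((\<xi> ^^ n) (\<xi> w)) = (\<xi> ^^ m) ((\<xi> ^^ n) w')" by simp
    also have "\<dots> = (\<xi> ^^ n) ((\<xi> ^^ m) w')" by (metis comp_apply funpow_add add.commute)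
    also have "\<dots> = \<zero>" unfolding w'(2) by (rule op_zero[OF Xp])
    finally have "(\<xi> ^^ (m + n + 1)) w = \<zero>" by (simp add: funpow_add funpow_swap1)
    with w Dw show ?case by blast
  qed
  then show ?thesis using z by blast
qed

end

section \<open>Powers of one multiplier\<close>

context module
begin

lemma smult_power_commute:
  assumes "x \<in> carrier R" "y \<in> carrier R" "c \<in> carrier M"
  shows "x \<odot>\<^bsub>M\<^esub> (((\<lambda>q. y \<odot>\<^bsub>M\<^esub> q) ^^ m) c) = ((\<lambda>q. y \<odot>\<^bsub>M\<^esub> q) ^^ m) (x \<odot>\<^bsub>M\<^esub> c)"
proof (rule M.power_commute[where \<phi> = "\<lambda>q. x \<odot>\<^bsub>M\<^esub> q", OF smult_additive_map[OF assms(2)] _ assms(3)])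
  fix q assume "q \<in> carrier M"
  then show "x \<odot>\<^bsub>M\<^esub> (y \<odot>\<^bsub>M\<^esub> q) = y \<odot>\<^bsub>M\<^esub> (x \<odot>\<^bsub>M\<^esub> q)"
    using assms R.m_comm[OF assms(1,2)] by (simp add: smult_assoc1[symmetric])
qed

lemma smult_power_torsion_mono:
  assumes "x \<in> carrier R" "((\<lambda>q. x \<odot>\<^bsub>M\<^esub> q) ^^ m) c = \<zero>\<^bsub>M\<^esub>" "m \<le> n"
  shows "((\<lambda>q. x \<odot>\<^bsub>M\<^esub> q) ^^ n) c = \<zero>\<^bsub>M\<^esub>"
proof -
  have "((\<lambda>q. x \<odot>\<^bsub>M\<^esub> q) ^^ n) c = ((\<lambda>q. x \<odot>\<^bsub>M\<^esub> q) ^^ (n - m)) (((\<lambda>q. x \<odot>\<^bsub>M\<^esub> q) ^^ m) c)"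
    using assms(3) by (metis comp_apply funpow_add le_add_diff_inverse2)
  then show ?thesis
    unfolding assms(2) M.op_zero[OF M.additive_map_power[OF smult_additive_map[OF assms(1)]]] .
qed

lemma smult_power:
  assumes "x \<in> carrier R" "c \<in> carrier M"
  shows "((\<lambda>q. x \<odot>\<^bsub>M\<^esub> q) ^^ m) c = (x [^]\<^bsub>R\<^esub> m) \<odot>\<^bsub>M\<^esub> c"
proof (induction m)
  case (Suc m)
  have "x \<otimes>\<^bsub>R\<^esub> x [^]\<^bsub>R\<^esub> m = x [^]\<^bsub>R\<^esub> Suc m"
    using assms(1) R.nat_pow_closed R.m_comm by simp
  then show ?case using Suc assms smult_assoc1[of x "x [^]\<^bsub>R\<^esub> m" c] by simp
qed (use assms in simp)

end

text \<open>For the empty list this is \<open>C\<close>, and for generators of A_+ it is the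
  A_+-torsion of \<open>C\<close>. The stages in between allow the variables to be treated one at a
  time.\<close>

definition torsion_part ::
    "('a, 'c, 'z) module_scheme \<Rightarrow> 'a list \<Rightarrow> (int \<Rightarrow> int \<Rightarrow> 'c set) \<Rightarrow> int \<Rightarrow> int \<Rightarrow> 'c set" where
  "torsion_part M xs C i \<mu> =
     {c \<in> C i \<mu>. \<forall>x\<in>set xs. \<exists>m. ((\<lambda>q. x \<odot>\<^bsub>M\<^esub> q) ^^ m) c = \<zero>\<^bsub>M\<^esub>}"

section \<open>Koszul complexes of subcomplexes: comparison and torsion\<close>

context differential_module
begin

definition subcomplex :: "'a set \<Rightarrow> (int \<Rightarrow> int \<Rightarrow> 'c set) \<Rightarrow> bool" where
  "subcomplex V C \<longleftrightarrow> V \<subseteq> carrier R \<and> (\<forall>i \<mu>. additive_subgroup (C i \<mu>) M \<and>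
     (\<forall>c\<in>C i \<mu>. D c \<in> C (i + 1) \<mu> \<and> (\<forall>x\<in>V. x \<odot>\<^bsub>M\<^esub> c \<in> C i (\<mu> + 1))))"

lemma subcomplexD:
  assumes "subcomplex V C"
  shows "V \<subseteq> carrier R" "additive_subgroup (C i \<mu>) M" "c \<in> C i \<mu> \<Longrightarrow> D c \<in> C (i + 1) \<mu>"
    "x \<in> V \<Longrightarrow> c \<in> C i \<mu> \<Longrightarrow> x \<odot>\<^bsub>M\<^esub> c \<in> C i (\<mu> + 1)"
  using assms unfolding subcomplex_def by blast+

lemma zero_subgroup: "additive_subgroup {\<zero>\<^bsub>M\<^esub>} M"
  by (rule M.additive_subgroupI2) auto

lemma koszul_chains_subgroup:
  assumes "subcomplex V C"
  shows "additive_subgroup (koszul_chains M n C i \<mu>) (chain_module M)"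
  unfolding koszul_chains_def chain_module_def
proof (rule prod_module_subgroup)
  fix l :: "bool list"
  show "additive_subgroup (if length l = n then C (i - twist l) (\<mu> + twist l) else {\<zero>\<^bsub>M\<^esub>}) M"
    using subcomplexD(2)[OF assms] zero_subgroup by simp
qed (rule M.abelian_group_axioms)

lemma koszul_chains_carrier:
  assumes "subcomplex V C" "w \<in> koszul_chains M n C i \<mu>"
  shows "w \<in> carrier (chain_module M)"
  using additive_subgroup.a_Hcarr[OF koszul_chains_subgroup[OF assms(1)] assms(2)] .

lemma koszul_chains_smult:
  assumes "subcomplex V C" "x \<in> V" "w \<in> koszul_chains M n C i \<mu>"
  shows "x \<odot>\<^bsub>chain_module M\<^esub> w \<in> koszul_chains M n C i (\<mu> + 1)"
  unfolding koszul_chains_def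
proof (intro CollectI allI)
  fix l
  have x: "x \<in> carrier R" using subcomplexD(1)[OF assms(1)] assms(2) by blast
  have w: "w l \<in> (if length l = n then C (i - twist l) (\<mu> + twist l) else {\<zero>\<^bsub>M\<^esub>})"
    using assms(3) unfolding koszul_chains_def by blast
  show "(x \<odot>\<^bsub>chain_module M\<^esub> w) l \<in> (if length l = n then C (i - twist l) (\<mu> + 1 + twist l) else {\<zero>\<^bsub>M\<^esub>})"
  proof (cases "length l = n")
    case True
    then have "x \<odot>\<^bsub>M\<^esub> w l \<in> C (i - twist l) (\<mu> + twist l + 1)"
      using subcomplexD(4)[OF assms(1,2)] w by simp
    moreover have "\<mu> + twist l + 1 = \<mu> + 1 + twist l" by simp
    ultimately show ?thesis using True by simp
  qed (use w x in simp)
qed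

lemma koszul_diff_chains:
  assumes "subcomplex V C" "set ys \<subseteq> V" "w \<in> koszul_chains M (length ys) C i \<mu>"
  shows "koszul_diff M D ys w \<in> koszul_chains M (length ys) C (i + 1) \<mu>"
  using assms(2,3)
proof (induction ys arbitrary: w i \<mu>)
  case Nil
  then show ?case
    unfolding list.size koszul_chains_0 koszul_diff.simps
    using subcomplexD(3)[OF assms(1)] D_zero by simp
next
  case (Cons y ys)
  then have ys: "set ys \<subseteq> V" and y: "y \<in> V" by auto
  have ysR: "set ys \<subseteq> carrier R" using ys subcomplexD(1)[OF assms(1)] by blast
  have w: "cone_fst w \<in> koszul_chains M (length ys) C i \<mu>"
    "cone_snd w \<in> koszul_chains M (length ys) C (i - 1) (\<mu> + 1)"
    using Cons.prems(2) unfolding length_Cons koszul_chains_Suc by auto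
  have "koszul_diff M D ys (cone_snd w) \<in> koszul_chains M (length ys) C i (\<mu> + 1)"
    using Cons.IH[OF ys w(2)] by simp
  then have "y \<odot>\<^bsub>chain_module M\<^esub> cone_fst w \<ominus>\<^bsub>chain_module M\<^esub> koszul_diff M D ys (cone_snd w)
      \<in> koszul_chains M (length ys) C i (\<mu> + 1)"
    by (rule Ch.M.additive_subgroup_minus[OF koszul_chains_subgroup[OF assms(1)] koszul_chains_smult[OF assms(1) y w(1)]])
  then show ?case
    unfolding koszul_diff_Cons[OF ysR koszul_chains_carrier[OF assms(1) Cons.prems(2)]] length_Cons koszul_chains_Suc
    using Cons.IH[OF ys w(1)] by simp
qed

lemma koszul_chains_mono:
  assumes "\<And>j \<nu>. C' j \<nu> \<subseteq> C j \<nu>" shows "koszul_chains M n C' i \<mu> \<subseteq> koszul_chains M n C i \<mu>"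
  unfolding koszul_chains_def using assms by (fastforce split: if_splits)

lemma chain_smult_additive: "a \<in> carrier R \<Longrightarrow>
    additive_map (chain_module M) (chain_module M) (\<lambda>w. a \<odot>\<^bsub>chain_module M\<^esub> w)"
  by (rule Ch.smult_additive_map)

text \<open>Each further variable forms a cone, and \<open>relatively_acyclic_cone\<close> says that
  cones preserve exactness of the quotient.\<close>

theorem koszul_relatively_acyclic:
  assumes C: "subcomplex V C" and C': "subcomplex V C'" and ys: "set ys \<subseteq> V"
    and rel: "relatively_acyclic M D C C'"
  shows "relatively_acyclic (chain_module M) (koszul_diff M D ys)
    (koszul_chains M (length ys) C) (koszul_chains M (length ys) C')"
  using ys
proof (induction ys)
  case Nil
  show ?case
    unfolding relatively_acyclic_def
  proof (intro allI ballI impI)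
    fix i \<mu> z assume z: "z \<in> koszul_chains M (length []) C i \<mu>"
      and dz: "koszul_diff M D [] z \<in> koszul_chains M (length []) C' (i + 1) \<mu>"
    have z0: "z [] \<in> C i \<mu>" "\<And>l. l \<noteq> [] \<Longrightarrow> z l = \<zero>\<^bsub>M\<^esub>"
      using z unfolding list.size koszul_chains_0 by blast+
    have "D (z []) \<in> C' (i + 1) \<mu>" using dz unfolding list.size koszul_chains_0 by simp
    then obtain q where q: "q \<in> C (i - 1) \<mu>" "z [] \<ominus>\<^bsub>M\<^esub> D q \<in> C' i \<mu>"
      using relatively_acyclicD[OF rel z0(1)] by blast
    let ?q = "\<lambda>l. if l = [] then q else \<zero>\<^bsub>M\<^esub>"
    have q': "?q \<in> koszul_chains M (length []) C (i - 1) \<mu>" using q unfolding list.size koszul_chains_0 by simp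
    have "koszul_diff M D [] ?q \<in> carrier (chain_module M)"
      by (rule koszul_diff_carrier[OF _ koszul_chains_carrier[OF C q']]) simp
    then have "(z \<ominus>\<^bsub>chain_module M\<^esub> koszul_diff M D [] ?q) = (\<lambda>l. z l \<ominus>\<^bsub>M\<^esub> D (?q l))"
      by (subst chain_minus) auto
    moreover have "(\<lambda>l. z l \<ominus>\<^bsub>M\<^esub> D (?q l)) \<in> koszul_chains M (length []) C' i \<mu>"
      unfolding list.size koszul_chains_0 using q z0 D_zero M.diff_zero[OF M.zero_closed] by simp
    ultimately show "\<exists>q\<in>koszul_chains M (length []) C (i - 1) \<mu>.
        z \<ominus>\<^bsub>chain_module M\<^esub> koszul_diff M D [] q \<in> koszul_chains M (length []) C' i \<mu>"
      using q' by (intro bexI[of _ ?q]) auto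
  qed
next
  case (Cons y ys)
  then have ys: "set ys \<subseteq> V" and y: "y \<in> V" by auto
  note VR = subcomplexD(1)[OF C]
  have ysR: "set ys \<subseteq> carrier R" and yR: "y \<in> carrier R" using ys y VR by auto
  note IH = Cons.IH[OF ys]
  let ?C = "chain_module M" and ?d = "koszul_diff M D ys" and ?n = "length ys"
  show ?case
    unfolding relatively_acyclic_def
  proof (intro allI ballI impI)
    fix i \<mu> z assume z: "z \<in> koszul_chains M (length (y # ys)) C i \<mu>"
      and dz: "koszul_diff M D (y # ys) z \<in> koszul_chains M (length (y # ys)) C' (i + 1) \<mu>"
    have zz: "z [] = \<zero>\<^bsub>M\<^esub>" "cone_fst z \<in> koszul_chains M ?n C i \<mu>"
      "cone_snd z \<in> koszul_chains M ?n C (i - 1) (\<mu> + 1)"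
      using z unfolding length_Cons koszul_chains_Suc by blast+
    have dd: "?d (cone_fst z) \<in> koszul_chains M ?n C' (i + 1) \<mu>"
      "y \<odot>\<^bsub>?C\<^esub> cone_fst z \<ominus>\<^bsub>?C\<^esub> ?d (cone_snd z) \<in> koszul_chains M ?n C' i (\<mu> + 1)"
      using dz unfolding koszul_diff_Cons[OF ysR koszul_chains_carrier[OF C z]] length_Cons koszul_chains_Suc
      by simp_all
    obtain q q' where q: "q \<in> koszul_chains M ?n C (i - 1) \<mu>" "q' \<in> koszul_chains M ?n C (i - 1 - 1) (\<mu> + 1)"
      "cone_fst z \<ominus>\<^bsub>?C\<^esub> ?d q \<in> koszul_chains M ?n C' i \<mu>"
      "cone_snd z \<ominus>\<^bsub>?C\<^esub> (y \<odot>\<^bsub>?C\<^esub> q \<ominus>\<^bsub>?C\<^esub> ?d q') \<in> koszul_chains M ?n C' (i - 1) (\<mu> + 1)"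
      using Ch.M.relatively_acyclic_cone[OF koszul_diff_additive[OF ysR] koszul_diff_D[OF ysR]
          chain_smult_additive[OF yR] koszul_diff_smult[OF ysR yR]
          koszul_chains_subgroup[OF C] koszul_chains_subgroup[OF C']
          koszul_diff_chains[OF C ys] koszul_chains_smult[OF C y] koszul_chains_smult[OF C' y]
          IH zz(2,3) dd] by blast
    let ?q = "cone_pair \<zero>\<^bsub>M\<^esub> q q'"
    have qK: "?q \<in> koszul_chains M (Suc ?n) C (i - 1) \<mu>"
      unfolding koszul_chains_Suc using q(1,2) by simp
    have qc: "?q \<in> carrier ?C" by (rule koszul_chains_carrier[OF C qK])
    have dqc: "koszul_diff M D (y # ys) ?q \<in> carrier ?C"
      by (rule koszul_diff_carrier[OF _ qc]) (use ysR yR in auto)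
    have e: "koszul_diff M D (y # ys) ?q = cone_pair \<zero>\<^bsub>M\<^esub> (?d q) (y \<odot>\<^bsub>?C\<^esub> q \<ominus>\<^bsub>?C\<^esub> ?d q')"
      using koszul_diff_Cons[OF ysR qc] by simp
    have c: "?d q \<in> carrier ?C" "y \<odot>\<^bsub>?C\<^esub> q \<ominus>\<^bsub>?C\<^esub> ?d q' \<in> carrier ?C"
      using cone_carrier[OF dqc] unfolding e by simp_all
    have "z \<ominus>\<^bsub>?C\<^esub> koszul_diff M D (y # ys) ?q = cone_pair \<zero>\<^bsub>M\<^esub> (cone_fst z \<ominus>\<^bsub>?C\<^esub> ?d q)
        (cone_snd z \<ominus>\<^bsub>?C\<^esub> (y \<odot>\<^bsub>?C\<^esub> q \<ominus>\<^bsub>?C\<^esub> ?d q'))"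
      unfolding chain_minus[OF dqc] chain_minus[OF c(1)] chain_minus[OF c(2)]
      unfolding cone_pair_eq e
      using zz(1) M.diff_zero[OF M.zero_closed] by (simp add: cone_fst_def cone_snd_def)
    then have "z \<ominus>\<^bsub>?C\<^esub> koszul_diff M D (y # ys) ?q \<in> koszul_chains M (Suc ?n) C' i \<mu>"
      unfolding koszul_chains_Suc using q(3,4) by simp
    then show "\<exists>q\<in>koszul_chains M (length (y # ys)) C (i - 1) \<mu>.
        z \<ominus>\<^bsub>?C\<^esub> koszul_diff M D (y # ys) q \<in> koszul_chains M (length (y # ys)) C' i \<mu>"
      unfolding length_Cons using qK by blast
  qed
qed

text \<open>With \<open>C\<close> a resolution and \<open>C'\<close> the image of the resolved
  module, this carries Koszul vanishing from the module to its injective resolution.\<close>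

corollary koszul_acyclic_transfer:
  assumes C: "subcomplex V C" and C': "subcomplex V C'" and ys: "set ys \<subseteq> V"
    and rel: "relatively_acyclic M D C C'" and sub: "\<And>j \<nu>. C' j \<nu> \<subseteq> C j \<nu>"
    and ac: "acyclic_at (chain_module M) (koszul_diff M D ys) (koszul_chains M (length ys) C') i \<mu>"
  shows "acyclic_at (chain_module M) (koszul_diff M D ys) (koszul_chains M (length ys) C) i \<mu>"
proof -
  have ysR: "set ys \<subseteq> carrier R" using ys subcomplexD(1)[OF C] by blast
  show ?thesis
    by (rule Ch.M.relatively_acyclic_transfer[OF koszul_diff_additive[OF ysR] koszul_diff_D[OF ysR]
        koszul_chains_subgroup[OF C] koszul_chains_subgroup[OF C'] koszul_chains_mono[OF sub]
        koszul_relatively_acyclic[OF C C' ys rel] ac])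
qed

lemma chain_smult_power:
  "((\<lambda>w. x \<odot>\<^bsub>chain_module M\<^esub> w) ^^ m) w = (\<lambda>l. ((\<lambda>q. x \<odot>\<^bsub>M\<^esub> q) ^^ m) (w l))"
  by (induction m) auto

lemma torsion_part_subcomplex:
  assumes C: "subcomplex V C" and xs: "set xs \<subseteq> V"
  shows "subcomplex V (torsion_part M xs C)"
  unfolding subcomplex_def
proof (intro conjI allI ballI)
  note VR = subcomplexD(1)[OF C]
  show "V \<subseteq> carrier R" by (rule VR)
  have xR: "x \<in> carrier R" if "x \<in> set xs" for x using that xs VR by blast
  note pw = M.additive_map_power[OF smult_additive_map]
  fix i \<mu>
  note Cc = additive_subgroup.a_Hcarr[OF subcomplexD(2)[OF C]]
  show "additive_subgroup (torsion_part M xs C i \<mu>) M"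
  proof (rule M.additive_subgroupI2)
    show "torsion_part M xs C i \<mu> \<subseteq> carrier M"
      unfolding torsion_part_def using Cc by blast
    have "((\<lambda>q. x \<odot>\<^bsub>M\<^esub> q) ^^ 0) \<zero>\<^bsub>M\<^esub> = \<zero>\<^bsub>M\<^esub>" for x by simp
    then show "\<zero>\<^bsub>M\<^esub> \<in> torsion_part M xs C i \<mu>"
      unfolding torsion_part_def using additive_subgroup.zero_closed[OF subcomplexD(2)[OF C]] by blast
  next
    fix a b assume ab: "a \<in> torsion_part M xs C i \<mu>" "b \<in> torsion_part M xs C i \<mu>"
    then have C': "a \<in> C i \<mu>" "b \<in> C i \<mu>" unfolding torsion_part_def by blast+
    have "\<exists>m. ((\<lambda>q. x \<odot>\<^bsub>M\<^esub> q) ^^ m) (a \<oplus>\<^bsub>M\<^esub> b) = \<zero>\<^bsub>M\<^esub>" if x: "x \<in> set xs" for x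
    proof -
      obtain m n where "((\<lambda>q. x \<odot>\<^bsub>M\<^esub> q) ^^ m) a = \<zero>\<^bsub>M\<^esub>" "((\<lambda>q. x \<odot>\<^bsub>M\<^esub> q) ^^ n) b = \<zero>\<^bsub>M\<^esub>"
        using ab x unfolding torsion_part_def by blast
      then have "((\<lambda>q. x \<odot>\<^bsub>M\<^esub> q) ^^ max m n) a = \<zero>\<^bsub>M\<^esub>" "((\<lambda>q. x \<odot>\<^bsub>M\<^esub> q) ^^ max m n) b = \<zero>\<^bsub>M\<^esub>"
        by (auto intro: smult_power_torsion_mono[OF xR[OF x]])
      then have "((\<lambda>q. x \<odot>\<^bsub>M\<^esub> q) ^^ max m n) (a \<oplus>\<^bsub>M\<^esub> b) = \<zero>\<^bsub>M\<^esub>"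
        using additive_map_add[OF pw[OF xR[OF x]] Cc[OF C'(1)] Cc[OF C'(2)]] by simp
      then show ?thesis by blast
    qed
    then show "a \<oplus>\<^bsub>M\<^esub> b \<in> torsion_part M xs C i \<mu>"
      unfolding torsion_part_def using additive_subgroup.a_closed[OF subcomplexD(2)[OF C] C'] by blast
  next
    fix a assume a: "a \<in> torsion_part M xs C i \<mu>"
    then have C': "a \<in> C i \<mu>" unfolding torsion_part_def by blast
    have "\<exists>m. ((\<lambda>q. x \<odot>\<^bsub>M\<^esub> q) ^^ m) (\<ominus>\<^bsub>M\<^esub> a) = \<zero>\<^bsub>M\<^esub>" if x: "x \<in> set xs" for x
    proof -
      obtain m where "((\<lambda>q. x \<odot>\<^bsub>M\<^esub> q) ^^ m) a = \<zero>\<^bsub>M\<^esub>"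
        using a x unfolding torsion_part_def by blast
      then have "((\<lambda>q. x \<odot>\<^bsub>M\<^esub> q) ^^ m) (\<ominus>\<^bsub>M\<^esub> a) = \<zero>\<^bsub>M\<^esub>"
        using M.op_neg[OF pw[OF xR[OF x]] Cc[OF C']] by simp
      then show ?thesis by blast
    qed
    then show "\<ominus>\<^bsub>M\<^esub> a \<in> torsion_part M xs C i \<mu>"
      unfolding torsion_part_def using M.additive_subgroup_neg[OF subcomplexD(2)[OF C] C'] by blast
  qed
  fix c assume c: "c \<in> torsion_part M xs C i \<mu>"
  then have cC: "c \<in> C i \<mu>" unfolding torsion_part_def by blast
  have op: "\<exists>m. ((\<lambda>q. x \<odot>\<^bsub>M\<^esub> q) ^^ m) (f c) = \<zero>\<^bsub>M\<^esub>"
    if f: "additive_map M M f" "\<And>q. q \<in> carrier M \<Longrightarrow> f (x \<odot>\<^bsub>M\<^esub> q) = x \<odot>\<^bsub>M\<^esub> f q" and x: "x \<in> set xs" for x f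
  proof -
    obtain m where "((\<lambda>q. x \<odot>\<^bsub>M\<^esub> q) ^^ m) c = \<zero>\<^bsub>M\<^esub>"
      using c x unfolding torsion_part_def by blast
    then have "((\<lambda>q. x \<odot>\<^bsub>M\<^esub> q) ^^ m) (f c) = f \<zero>\<^bsub>M\<^esub>"
      using M.power_commute[where \<phi> = f, OF smult_additive_map[OF xR[OF x]] f(2) Cc[OF cC], of m] by simp
    then show ?thesis using M.op_zero[OF f(1)] by metis
  qed
  show "D c \<in> torsion_part M xs C (i + 1) \<mu>"
  proof -
    have "\<exists>m. ((\<lambda>q. x \<odot>\<^bsub>M\<^esub> q) ^^ m) (D c) = \<zero>\<^bsub>M\<^esub>" if x: "x \<in> set xs" for x
      by (rule op[OF D_additive _ x]) (rule D_smult[OF xR[OF x]])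
    then show ?thesis unfolding torsion_part_def using subcomplexD(3)[OF C cC] by blast
  qed
  fix y assume y: "y \<in> V"
  then have yR: "y \<in> carrier R" using VR by blast
  have "\<exists>m. ((\<lambda>q. x \<odot>\<^bsub>M\<^esub> q) ^^ m) (y \<odot>\<^bsub>M\<^esub> c) = \<zero>\<^bsub>M\<^esub>" if x: "x \<in> set xs" for x
    by (rule op[OF smult_additive_map[OF yR] _ x])
      (use smult_power_commute[OF yR xR[OF x], of _ "Suc 0"] in simp)
  then show "y \<odot>\<^bsub>M\<^esub> c \<in> torsion_part M xs C i (\<mu> + 1)"
    unfolding torsion_part_def using subcomplexD(4)[OF C y cC] by blast
qed

lemma finite_bool_lists: "finite {l :: bool list. length l = n}"
  using finite_lists_length_eq[of "UNIV :: bool set" n] by simp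

text \<open>Torsion exponents are found separately for each entry of a chain; there are finitely
  many lists of length \<open>n\<close>, so the maximum serves for all of them.\<close>

lemma uniform_bound:
  fixes P :: "bool list \<Rightarrow> nat \<Rightarrow> bool"
  assumes "\<And>l. length l = n \<Longrightarrow> \<exists>m. P l m" "\<And>l m m'. length l = n \<Longrightarrow> P l m \<Longrightarrow> m \<le> m' \<Longrightarrow> P l m'"
  shows "\<exists>m. \<forall>l. length l = n \<longrightarrow> P l m"
proof -
  have "\<forall>l. \<exists>m. length l = n \<longrightarrow> P l m" using assms(1) by blast
  from choice[OF this] obtain m where m: "\<And>l. length l = n \<Longrightarrow> P l (m l)" by blast
  have "P l (Max (m ` {l. length l = n}))" if "length l = n" for l
    using that m by (intro assms(2)[OF that m[OF that]] Max_ge finite_imageI finite_bool_lists) simp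
  then show ?thesis by blast
qed

text \<open>Translates entrywise torsion into torsion of the chain as one element of the chain
  module, the form in which \<open>torsion_acyclic\<close> speaks of it.\<close>

lemma koszul_chains_torsion:
  assumes C: "subcomplex V C" and y: "y \<in> V" and w: "w \<in> koszul_chains M n (torsion_part M xs C) i \<mu>"
  shows "w \<in> koszul_chains M n (torsion_part M (y # xs) C) i \<mu> \<longleftrightarrow>
    (\<exists>m. ((\<lambda>w. y \<odot>\<^bsub>chain_module M\<^esub> w) ^^ m) w = \<zero>\<^bsub>chain_module M\<^esub>)" (is "?L \<longleftrightarrow> ?R")
proof
  have yR: "y \<in> carrier R" using subcomplexD(1)[OF C] y by blast
  let ?t = "\<lambda>l m. ((\<lambda>q. y \<odot>\<^bsub>M\<^esub> q) ^^ m) (w l) = \<zero>\<^bsub>M\<^esub>"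
  {
    assume ?L
    then have wl: "w l \<in> (if length l = n then torsion_part M (y # xs) C (i - twist l) (\<mu> + twist l) else {\<zero>\<^bsub>M\<^esub>})"
      for l unfolding koszul_chains_def by blast
    have "\<exists>m. \<forall>l. length l = n \<longrightarrow> ?t l m"
    proof (rule uniform_bound)
      fix l :: "bool list" assume "length l = n"
      then have "w l \<in> torsion_part M (y # xs) C (i - twist l) (\<mu> + twist l)" using wl[of l] by simp
      then show "\<exists>m. ?t l m" unfolding torsion_part_def by simp
    next
      fix l m m' assume "?t l m" "m \<le> m'"
      then show "?t l m'" by (rule smult_power_torsion_mono[OF yR])
    qed
    then obtain m where m: "\<And>l. length l = n \<Longrightarrow> ?t l m" by blast
    have "?t l m" for l
    proof (cases "length l = n")
      case False
      then have "w l = \<zero>\<^bsub>M\<^esub>" using wl[of l] by simp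
      then show ?thesis using M.op_zero[OF M.additive_map_power[OF smult_additive_map[OF yR]]] by simp
    qed (rule m)
    then have "((\<lambda>w. y \<odot>\<^bsub>chain_module M\<^esub> w) ^^ m) w = \<zero>\<^bsub>chain_module M\<^esub>"
      unfolding chain_smult_power unfolding chain_module_simps by (rule ext)
    then show ?R by blast
  next
    assume ?R
    then obtain m where m: "((\<lambda>w. y \<odot>\<^bsub>chain_module M\<^esub> w) ^^ m) w = \<zero>\<^bsub>chain_module M\<^esub>" by blast
    have t: "?t l m" for l using fun_cong[OF m, of l] unfolding chain_smult_power unfolding chain_module_simps .
    show ?L
      unfolding koszul_chains_def
    proof (intro CollectI allI)
      fix l
      have "w l \<in> (if length l = n then torsion_part M xs C (i - twist l) (\<mu> + twist l) else {\<zero>\<^bsub>M\<^esub>})"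
        using w unfolding koszul_chains_def by blast
      then show "w l \<in> (if length l = n then torsion_part M (y # xs) C (i - twist l) (\<mu> + twist l) else {\<zero>\<^bsub>M\<^esub>})"
        using t[of l] unfolding torsion_part_def by (cases "length l = n") auto
    qed
  }
qed

text \<open>The first clause says that \<open>b - x c\<close> is killed by a power of
  \<open>x\<close>; true divisibility \<open>b = x c\<close> fails in general if \<open>x\<close> is
  a zero divisor. The annihilator clause passes torsion for the other multipliers on from
  \<open>b\<close> to \<open>c\<close>, so that the property is inherited by
  \<open>torsion_part\<close>.\<close>

definition divisible :: "'a set \<Rightarrow> (int \<Rightarrow> int \<Rightarrow> 'c set) \<Rightarrow> bool" where
  "divisible V C \<longleftrightarrow> (\<forall>x\<in>V. \<forall>i \<mu>. \<forall>b\<in>C i (\<mu> + 1). \<exists>c\<in>C i \<mu>.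
     (\<exists>l. ((\<lambda>q. x \<odot>\<^bsub>M\<^esub> q) ^^ Suc l) c = ((\<lambda>q. x \<odot>\<^bsub>M\<^esub> q) ^^ l) b) \<and>
     (\<forall>a\<in>carrier R. a \<odot>\<^bsub>M\<^esub> b = \<zero>\<^bsub>M\<^esub> \<longrightarrow> a \<odot>\<^bsub>M\<^esub> c = \<zero>\<^bsub>M\<^esub>))"

lemma divisible_torsion_part:
  assumes C: "subcomplex V C" and div: "divisible V C" and xs: "set xs \<subseteq> V" and y: "y \<in> V"
    and b: "b \<in> torsion_part M xs C i (\<mu> + 1)"
  shows "\<exists>c\<in>torsion_part M xs C i \<mu>. \<exists>l. ((\<lambda>q. y \<odot>\<^bsub>M\<^esub> q) ^^ Suc l) c = ((\<lambda>q. y \<odot>\<^bsub>M\<^esub> q) ^^ l) b"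
proof -
  note VR = subcomplexD(1)[OF C]
  note Cc = additive_subgroup.a_Hcarr[OF subcomplexD(2)[OF C]]
  have bC: "b \<in> C i (\<mu> + 1)" using b unfolding torsion_part_def by blast
  obtain c l where c: "c \<in> C i \<mu>" "((\<lambda>q. y \<odot>\<^bsub>M\<^esub> q) ^^ Suc l) c = ((\<lambda>q. y \<odot>\<^bsub>M\<^esub> q) ^^ l) b"
    "\<forall>a\<in>carrier R. a \<odot>\<^bsub>M\<^esub> b = \<zero>\<^bsub>M\<^esub> \<longrightarrow> a \<odot>\<^bsub>M\<^esub> c = \<zero>\<^bsub>M\<^esub>"
    using div[unfolded divisible_def, rule_format, OF y bC] by blast
  have "\<exists>m. ((\<lambda>q. x \<odot>\<^bsub>M\<^esub> q) ^^ m) c = \<zero>\<^bsub>M\<^esub>" if x: "x \<in> set xs" for x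
  proof -
    have xR: "x \<in> carrier R" using x xs VR by blast
    obtain m where m: "((\<lambda>q. x \<odot>\<^bsub>M\<^esub> q) ^^ m) b = \<zero>\<^bsub>M\<^esub>"
      using b x unfolding torsion_part_def by blast
    \<comment> \<open>The annihilator clause is applied to the scalar \<open>x\<close> to the power
      \<open>m\<close>.\<close>
    have "(x [^]\<^bsub>R\<^esub> m) \<odot>\<^bsub>M\<^esub> c = \<zero>\<^bsub>M\<^esub>"
      using c(3) m unfolding smult_power[OF xR Cc[OF bC]] using R.nat_pow_closed[OF xR] by blast
    then show ?thesis unfolding smult_power[OF xR Cc[OF c(1)]] by blast
  qed
  then have "c \<in> torsion_part M xs C i \<mu>" unfolding torsion_part_def using c(1) by blast
  with c(2) show ?thesis by blast
qed

lemma divisible_koszul_chains: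
  assumes C: "subcomplex V C" and div: "divisible V C" and xs: "set xs \<subseteq> V" and y: "y \<in> V"
    and b: "b \<in> koszul_chains M n (torsion_part M xs C) i (\<mu> + 1)"
  shows "\<exists>c\<in>koszul_chains M n (torsion_part M xs C) i \<mu>. \<exists>l.
    ((\<lambda>w. y \<odot>\<^bsub>chain_module M\<^esub> w) ^^ Suc l) c = ((\<lambda>w. y \<odot>\<^bsub>chain_module M\<^esub> w) ^^ l) b"
proof -
  have yR: "y \<in> carrier R" using y subcomplexD(1)[OF C] by blast
  let ?T = "torsion_part M xs C" and ?p = "\<lambda>m. (\<lambda>q. y \<odot>\<^bsub>M\<^esub> q) ^^ m"
  have bl: "b l \<in> (if length l = n then ?T (i - twist l) (\<mu> + 1 + twist l) else {\<zero>\<^bsub>M\<^esub>})" for l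
    using b unfolding koszul_chains_def by blast
  have "\<exists>c. c \<in> (if length l = n then ?T (i - twist l) (\<mu> + twist l) else {\<zero>\<^bsub>M\<^esub>}) \<and>
      (\<exists>k. ?p (Suc k) c = ?p k (b l))" for l
  proof (cases "length l = n")
    case True
    then have "b l \<in> ?T (i - twist l) (\<mu> + twist l + 1)" using bl[of l] by (simp add: ac_simps)
    from divisible_torsion_part[OF C div xs y this] show ?thesis
      unfolding if_P[OF True] by blast
  next
    case False
    then have "b l = \<zero>\<^bsub>M\<^esub>" using bl[of l] by simp
    moreover have "?p (Suc 0) \<zero>\<^bsub>M\<^esub> = ?p 0 \<zero>\<^bsub>M\<^esub>" using yR by simp
    ultimately have "?p (Suc 0) \<zero>\<^bsub>M\<^esub> = ?p 0 (b l)" by simp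
    then show ?thesis unfolding if_not_P[OF False] by blast
  qed
  then have "\<forall>l. \<exists>c. c \<in> (if length l = n then ?T (i - twist l) (\<mu> + twist l) else {\<zero>\<^bsub>M\<^esub>}) \<and>
      (\<exists>k. ?p (Suc k) c = ?p k (b l))" by blast
  from choice[OF this] obtain c where
    c: "\<And>l. c l \<in> (if length l = n then ?T (i - twist l) (\<mu> + twist l) else {\<zero>\<^bsub>M\<^esub>})"
      "\<And>l. \<exists>k. ?p (Suc k) (c l) = ?p k (b l)" by blast
  \<comment> \<open>The identity for one exponent implies it for every larger one, by applying
    further powers of \<open>y\<close>; so the entries have a common exponent.\<close>
  have "\<exists>k. \<forall>l. length l = n \<longrightarrow> ?p (Suc k) (c l) = ?p k (b l)"
  proof (rule uniform_bound)
    fix l k k' assume e: "?p (Suc k) (c l) = ?p k (b l)" and "k \<le> k'"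
    then have k': "k' = (k' - k) + k" "Suc k' = (k' - k) + Suc k" by simp_all
    show "?p (Suc k') (c l) = ?p k' (b l)"
      unfolding k'(2) by (subst k'(1), unfold funpow_add comp_apply e, rule refl)
  qed (rule c(2))
  then obtain k where k: "\<And>l. length l = n \<Longrightarrow> ?p (Suc k) (c l) = ?p k (b l)" by blast
  have "?p (Suc k) (c l) = ?p k (b l)" for l
  proof (cases "length l = n")
    case False
    then have "c l = \<zero>\<^bsub>M\<^esub>" "b l = \<zero>\<^bsub>M\<^esub>" using c(1)[of l] bl[of l] by simp_all
    then show ?thesis using M.op_zero[OF M.additive_map_power[OF smult_additive_map[OF yR]]] by metis
  qed (rule k)
  then have "((\<lambda>w. y \<odot>\<^bsub>chain_module M\<^esub> w) ^^ Suc k) c = ((\<lambda>w. y \<odot>\<^bsub>chain_module M\<^esub> w) ^^ k) b"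
    unfolding chain_smult_power by (rule ext)
  moreover have "c \<in> koszul_chains M n ?T i \<mu>" unfolding koszul_chains_def using c(1) by blast
  ultimately show ?thesis by blast
qed

text \<open>Trades Koszul variables for torsion conditions: in each step \<open>y\<close> leaves the
  Koszul sequence and joins the torsion list, which is why \<open>ys\<close> ends up reversed.
  Without variables the Koszul complex is the complex itself.\<close>

theorem torsion_part_acyclic:
  assumes C: "subcomplex V C" and div: "divisible V C" and "set ys \<subseteq> V" "set xs \<subseteq> V"
    and ac: "\<And>\<nu>. \<mu> \<le> \<nu> \<Longrightarrow> acyclic_at (chain_module M) (koszul_diff M D ys)
      (koszul_chains M (length ys) (torsion_part M xs C)) i \<nu>"
  shows "acyclic_at M D (torsion_part M (rev ys @ xs) C) i \<mu>"
  using assms(3-5)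
proof (induction ys arbitrary: xs)
  case Nil
  have ac: "acyclic_at (chain_module M) (koszul_diff M D []) (koszul_chains M 0 (torsion_part M xs C)) i \<mu>"
    using Nil.prems(3)[OF order_refl] unfolding list.size .
  show ?case
    unfolding acyclic_at_def
  proof (intro ballI impI)
    fix z assume z: "z \<in> torsion_part M (rev [] @ xs) C i \<mu>" "D z = \<zero>\<^bsub>M\<^esub>"
    let ?z = "\<lambda>l. if l = [] then z else \<zero>\<^bsub>M\<^esub>"
    have "?z \<in> koszul_chains M 0 (torsion_part M xs C) i \<mu>"
      unfolding koszul_chains_0 using z(1) by simp
    moreover have "koszul_diff M D [] ?z = \<zero>\<^bsub>chain_module M\<^esub>" using z(2) D_zero by auto
    ultimately obtain b where b: "b \<in> koszul_chains M 0 (torsion_part M xs C) (i - 1) \<mu>"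
      "koszul_diff M D [] b = ?z" using acyclic_atD[OF ac] by blast
    have "b [] \<in> torsion_part M (rev [] @ xs) C (i - 1) \<mu>" using b(1) unfolding koszul_chains_0 by simp
    moreover have "D (b []) = z" using fun_cong[OF b(2), of "[]"] by simp
    ultimately show "\<exists>b\<in>torsion_part M (rev [] @ xs) C (i - 1) \<mu>. D b = z" by blast
  qed
next
  case (Cons y ys)
  then have ys: "set ys \<subseteq> V" and y: "y \<in> V" and xs: "set xs \<subseteq> V" by auto
  have yxs: "set (y # xs) \<subseteq> V" using y xs by simp
  note VR = subcomplexD(1)[OF C]
  have ysR: "set ys \<subseteq> carrier R" and yR: "y \<in> carrier R" using ys y VR by auto
  let ?C = "chain_module M" and ?d = "koszul_diff M D ys" and ?n = "length ys"
  let ?T = "torsion_part M xs C" and ?T' = "torsion_part M (y # xs) C"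
  note T = torsion_part_subcomplex[OF C xs]
  have TT: "?T' j \<nu> \<subseteq> ?T j \<nu>" for j \<nu> unfolding torsion_part_def by auto
  have "acyclic_at ?C ?d (koszul_chains M ?n ?T') i \<nu>" if \<nu>: "\<mu> \<le> \<nu>" for \<nu>
    unfolding acyclic_at_def
  proof (intro ballI impI)
    fix z assume z: "z \<in> koszul_chains M ?n ?T' i \<nu>" "?d z = \<zero>\<^bsub>?C\<^esub>"
    have zT: "z \<in> koszul_chains M ?n ?T i \<nu>" by (rule subsetD[OF koszul_chains_mono[where C' = ?T' and C = ?T, OF TT] z(1)])
    obtain m where m: "((\<lambda>w. y \<odot>\<^bsub>?C\<^esub> w) ^^ m) z = \<zero>\<^bsub>?C\<^esub>"
      using koszul_chains_torsion[OF C y zT] z(1) by blast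
    have "\<exists>w\<in>koszul_chains M ?n ?T (i - 1) \<nu>. (\<exists>m. ((\<lambda>w. y \<odot>\<^bsub>?C\<^esub> w) ^^ m) w = \<zero>\<^bsub>?C\<^esub>) \<and> ?d w = z"
    proof (rule Ch.M.torsion_acyclic[OF koszul_diff_additive[OF ysR] koszul_diff_D[OF ysR]
          chain_smult_additive[OF yR] koszul_diff_smult[OF ysR yR] koszul_chains_subgroup[OF T]
          koszul_diff_chains[OF T ys] koszul_chains_smult[OF T y] divisible_koszul_chains[OF C div xs y] _ zT z(2) m])
      fix \<rho> c c'
      assume \<rho>: "\<nu> \<le> \<rho>" and c: "c \<in> koszul_chains M ?n ?T i \<rho>" and c': "c' \<in> koszul_chains M ?n ?T (i - 1) (\<rho> + 1)"
        and dc: "?d c = \<zero>\<^bsub>?C\<^esub>" and e: "y \<odot>\<^bsub>?C\<^esub> c = ?d c'"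
      \<comment> \<open>A pair with \<open>d c = 0\<close> and \<open>y c = d c'\<close> is
        precisely a cocycle of the Koszul complex on \<open>y # ys\<close>; the two coordinates of
        its primitive are the elements that \<open>torsion_acyclic\<close> asks for.\<close>
      let ?z = "cone_pair \<zero>\<^bsub>M\<^esub> c c'"
      have zK: "?z \<in> koszul_chains M (Suc ?n) ?T i \<rho>" unfolding koszul_chains_Suc using c c' by simp
      have dc': "?d c' \<in> carrier ?C" by (rule koszul_diff_carrier[OF ysR koszul_chains_carrier[OF T c']])
      have "koszul_diff M D (y # ys) ?z = cone_pair \<zero>\<^bsub>M\<^esub> \<zero>\<^bsub>?C\<^esub> \<zero>\<^bsub>?C\<^esub>"
        unfolding koszul_diff_Cons[OF ysR koszul_chains_carrier[OF T zK]] cone_simps dc e Ch.M.diff_self[OF dc'] ..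
      then have "koszul_diff M D (y # ys) ?z = \<zero>\<^bsub>?C\<^esub>"
        by (auto simp: cone_pair_def split: list.splits)
      moreover have "acyclic_at ?C (koszul_diff M D (y # ys)) (koszul_chains M (length (y # ys)) ?T) i \<rho>"
        by (rule Cons.prems(3)) (use \<nu> \<rho> in simp)
      ultimately obtain b where b: "b \<in> koszul_chains M (Suc ?n) ?T (i - 1) \<rho>" "koszul_diff M D (y # ys) b = ?z"
        using acyclic_atD[of ?C "koszul_diff M D (y # ys)" "koszul_chains M (length (y # ys)) ?T" i \<rho> ?z] zK
        unfolding length_Cons by blast
      have b2: "cone_fst b \<in> koszul_chains M ?n ?T (i - 1) \<rho>" "cone_snd b \<in> koszul_chains M ?n ?T (i - 2) (\<rho> + 1)"
        using b(1) unfolding koszul_chains_Suc by simp_all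
      have "c = ?d (cone_fst b)" "c' = y \<odot>\<^bsub>?C\<^esub> cone_fst b \<ominus>\<^bsub>?C\<^esub> ?d (cone_snd b)"
        using arg_cong[OF b(2), of cone_fst] arg_cong[OF b(2), of cone_snd]
        unfolding koszul_diff_Cons[OF ysR koszul_chains_carrier[OF T b(1)]] cone_simps by simp_all
      with b2 show "\<exists>b\<in>koszul_chains M ?n ?T (i - 1) \<rho>. \<exists>b'\<in>koszul_chains M ?n ?T (i - 2) (\<rho> + 1).
          c = ?d b \<and> c' = y \<odot>\<^bsub>?C\<^esub> b \<ominus>\<^bsub>?C\<^esub> ?d b'" by blast
    qed
    then show "\<exists>b\<in>koszul_chains M ?n ?T' (i - 1) \<nu>. ?d b = z"
      using koszul_chains_torsion[OF C y] by blast
  qed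
  from Cons.IH[OF ys yxs this] show ?case by simp
qed

end

section \<open>Projections of an internal direct sum\<close>

definition ds_decomp :: "('m, 'b) ring_scheme \<Rightarrow> ('i \<Rightarrow> 'm set) \<Rightarrow> 'm \<Rightarrow> ('i \<Rightarrow> 'm) \<Rightarrow> bool" where
  "ds_decomp G H x c \<longleftrightarrow> (\<forall>i. c i \<in> H i) \<and> finite {i. c i \<noteq> \<zero>\<^bsub>G\<^esub>} \<and>
     x = (\<Oplus>\<^bsub>G\<^esub>i\<in>{i. c i \<noteq> \<zero>\<^bsub>G\<^esub>}. c i)"

definition ds_proj :: "('m, 'b) ring_scheme \<Rightarrow> ('i \<Rightarrow> 'm set) \<Rightarrow> 'i \<Rightarrow> 'm \<Rightarrow> 'm" where
  "ds_proj G H i x = (THE c. ds_decomp G H x c) i"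

lemma internal_direct_sum_iff:
  "internal_direct_sum G H \<longleftrightarrow> (\<forall>i. additive_subgroup (H i) G) \<and> (\<forall>x\<in>carrier G. \<exists>!c. ds_decomp G H x c)"
  unfolding internal_direct_sum_def ds_decomp_def
  by (auto intro: additive_subgroupI dest: additive_subgroup.a_subgroup)

context abelian_group
begin

lemma diff_add_neg_diff:
  assumes "p \<in> carrier G" "a \<in> carrier G" "b \<in> carrier G"
  shows "(p \<ominus> \<ominus> a) \<oplus> (\<ominus> (p \<ominus> b)) = a \<oplus> b"
proof -
  have "(p \<ominus> \<ominus> a) \<oplus> (\<ominus> (p \<ominus> b)) = (p \<oplus> \<ominus> p) \<oplus> (a \<oplus> b)"
    using assms by (simp add: a_minus_def minus_add a_ac del: r_neg)
  then show ?thesis using assms by (simp add: r_neg)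
qed

lemma add_diff_cancel_left:
  assumes "a \<in> carrier G" "b \<in> carrier G"
  shows "a \<oplus> (b \<ominus> a) = b"
proof -
  have "a \<oplus> (b \<ominus> a) = b \<oplus> (a \<oplus> \<ominus> a)" using assms by (simp add: a_minus_def a_ac del: r_neg)
  then show ?thesis using assms by (simp add: r_neg)
qed

lemma ds_subgroup: "internal_direct_sum G H \<Longrightarrow> additive_subgroup (H i) G"
  unfolding internal_direct_sum_iff by blast

lemma ds_decomp_proj:
  assumes "internal_direct_sum G H" "x \<in> carrier G" shows "ds_decomp G H x (\<lambda>i. ds_proj G H i x)"
proof -
  have "\<exists>!c. ds_decomp G H x c" using assms unfolding internal_direct_sum_iff by blast
  from theI'[OF this] show ?thesis unfolding ds_proj_def .
qed

lemma ds_proj_eq: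
  assumes "internal_direct_sum G H" "x \<in> carrier G" "ds_decomp G H x c" shows "ds_proj G H i x = c i"
proof -
  have "\<exists>!c. ds_decomp G H x c" using assms unfolding internal_direct_sum_iff by blast
  from the1_equality[where a = c, OF this] assms(3) show ?thesis unfolding ds_proj_def by simp
qed

lemma ds_proj_mem:
  assumes "internal_direct_sum G H" "x \<in> carrier G" shows "ds_proj G H i x \<in> H i"
  using ds_decomp_proj[OF assms] unfolding ds_decomp_def by blast

lemma finsum_support:
  assumes "finite S" "{i. c i \<noteq> \<zero>} \<subseteq> S" "\<And>i. c i \<in> carrier G"
  shows "(\<Oplus>i\<in>S. c i) = (\<Oplus>i\<in>{i. c i \<noteq> \<zero>}. c i)"
  by (rule add.finprod_mono_neutral_cong_left[symmetric]) (use assms in auto)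

lemma ds_decompI:
  assumes "internal_direct_sum G H" "finite S" "\<And>i. i \<notin> S \<Longrightarrow> c i = \<zero>" "\<And>i. c i \<in> H i" "x = (\<Oplus>i\<in>S. c i)"
  shows "ds_decomp G H x c"
proof -
  have sub: "{i. c i \<noteq> \<zero>} \<subseteq> S" using assms(3) by blast
  have c: "c i \<in> carrier G" for i using additive_subgroup.a_Hcarr[OF ds_subgroup[OF assms(1)] assms(4)] .
  show ?thesis
    unfolding ds_decomp_def using assms(4) finite_subset[OF sub assms(2)] finsum_support[OF assms(2) sub c] assms(5)
    by simp
qed

lemma ds_proj_component:
  assumes "internal_direct_sum G H" "x \<in> H j" shows "ds_proj G H i x = (if i = j then x else \<zero>)"
proof -
  note x = additive_subgroup.a_Hcarr[OF ds_subgroup[OF assms(1)] assms(2)]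
  have "ds_decomp G H x (\<lambda>i. if i = j then x else \<zero>)"
  proof (rule ds_decompI[OF assms(1), of "{j}"])
    show "(if i = j then x else \<zero>) \<in> H i" for i
      using assms(2) additive_subgroup.zero_closed[OF ds_subgroup[OF assms(1)]] by simp
    show "x = (\<Oplus>i\<in>{j}. if i = j then x else \<zero>)" using x by simp
  qed auto
  then show ?thesis using ds_proj_eq[OF assms(1) x] by simp
qed

lemma ds_proj_additive:
  assumes ds: "internal_direct_sum G H" shows "additive_map G G (ds_proj G H i)"
  unfolding additive_map_def
proof (intro conjI ballI funcsetI)
  note Hc = additive_subgroup.a_Hcarr[OF ds_subgroup[OF ds]]
  note pc = Hc[OF ds_proj_mem[OF ds]]
  fix x assume x: "x \<in> carrier G"
  show "ds_proj G H i x \<in> carrier G" by (rule pc[OF x])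
  fix y assume y: "y \<in> carrier G"
  let ?c = "\<lambda>i. ds_proj G H i x" and ?d = "\<lambda>i. ds_proj G H i y"
  let ?S = "{i. ?c i \<noteq> \<zero>} \<union> {i. ?d i \<noteq> \<zero>}"
  have fin: "finite {i. ?c i \<noteq> \<zero>}" "finite {i. ?d i \<noteq> \<zero>}"
    and sum: "x = (\<Oplus>i\<in>{i. ?c i \<noteq> \<zero>}. ?c i)" "y = (\<Oplus>i\<in>{i. ?d i \<noteq> \<zero>}. ?d i)"
    using ds_decomp_proj[OF ds x] ds_decomp_proj[OF ds y] unfolding ds_decomp_def by blast+
  have finS: "finite ?S" using fin by blast
  have "ds_decomp G H (x \<oplus> y) (\<lambda>i. ?c i \<oplus> ?d i)"
  proof (rule ds_decompI[OF ds finS])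
    fix i show "?c i \<oplus> ?d i \<in> H i"
      by (rule additive_subgroup.a_closed[OF ds_subgroup[OF ds] ds_proj_mem[OF ds x] ds_proj_mem[OF ds y]])
  next
    have "(\<Oplus>i\<in>?S. ?c i \<oplus> ?d i) = (\<Oplus>i\<in>?S. ?c i) \<oplus> (\<Oplus>i\<in>?S. ?d i)"
      by (rule finsum_addf) (use pc[OF x] pc[OF y] in blast)+
    also have "(\<Oplus>i\<in>?S. ?c i) = x" using finsum_support[OF finS _ pc[OF x]] sum(1) by simp
    also have "(\<Oplus>i\<in>?S. ?d i) = y" using finsum_support[OF finS _ pc[OF y]] sum(2) by simp
    finally show "x \<oplus> y = (\<Oplus>i\<in>?S. ?c i \<oplus> ?d i)" by simp
  qed simp
  then show "ds_proj G H i (x \<oplus> y) = ds_proj G H i x \<oplus> ds_proj G H i y"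
    using ds_proj_eq[OF ds a_closed[OF x y]] by simp
qed

lemma finsum_mem:
  assumes "additive_subgroup K G" "\<And>i. i \<in> S \<Longrightarrow> c i \<in> K"
  shows "(\<Oplus>i\<in>S. c i) \<in> K"
proof (cases "finite S")
  case True
  then show ?thesis
    using assms(2)
  proof (induction S)
    case empty then show ?case using additive_subgroup.zero_closed[OF assms(1)] by simp
  next
    case (insert s S)
    have "(\<Oplus>i\<in>insert s S. c i) = c s \<oplus> (\<Oplus>i\<in>S. c i)"
      by (rule finsum_insert) (use insert additive_subgroup.a_Hcarr[OF assms(1)] in auto)
    then show ?case using insert additive_subgroup.a_closed[OF assms(1)] by simp
  qed
qed (simp add: additive_subgroup.zero_closed[OF assms(1)])

lemma ds_sum_mem:
  assumes "internal_direct_sum G H" "x \<in> carrier G" "additive_subgroup K G" "\<And>i. ds_proj G H i x \<in> K"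
  shows "x \<in> K"
proof -
  have "x = (\<Oplus>i\<in>{i. ds_proj G H i x \<noteq> \<zero>}. ds_proj G H i x)"
    using ds_decomp_proj[OF assms(1,2)] unfolding ds_decomp_def by blast
  also have "\<dots> \<in> K" by (rule finsum_mem[OF assms(3,4)])
  finally show ?thesis .
qed

text \<open>Reduces a statement about all elements to homogeneous ones, provided that its solutions
  form a subgroup.\<close>

lemma ds_induct:
  assumes "internal_direct_sum G H" "additive_subgroup K G" "\<And>i. H i \<subseteq> K"
  shows "carrier G \<subseteq> K"
  using ds_sum_mem[OF assms(1) _ assms(2)] ds_proj_mem[OF assms(1)] assms(3) by blast

end

lemma ds_proj_natural:
  assumes G: "abelian_group G" "internal_direct_sum G H" and G': "abelian_group G'" "internal_direct_sum G' H'"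
    and f: "additive_map G G' f" "\<And>i x. x \<in> H i \<Longrightarrow> f x \<in> H' i" and x: "x \<in> carrier G"
  shows "ds_proj G' H' i (f x) = f (ds_proj G H i x)"
proof -
  interpret G: abelian_group G by fact
  interpret G': abelian_group G' by fact
  note p = G.ds_proj_additive[OF G(2)] G'.ds_proj_additive[OF G'(2)]
  let ?K = "{x \<in> carrier G. ds_proj G' H' i (f x) = f (ds_proj G H i x)}"
  have "carrier G \<subseteq> ?K"
  proof (rule G.ds_induct[OF G(2)])
    have fc: "f x \<in> carrier G'" if "x \<in> carrier G" for x by (rule additive_map_closed[OF f(1) that])
    show "additive_subgroup ?K G"
    proof (rule G.additive_subgroupI2)
      have "ds_proj G' H' i (f \<zero>\<^bsub>G\<^esub>) = f (ds_proj G H i \<zero>\<^bsub>G\<^esub>)"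
        using G'.op_zero[OF p(2)] G.op_zero[OF p(1)] additive_map_zero[OF G(1) G'(1) f(1)] by simp
      then show "\<zero>\<^bsub>G\<^esub> \<in> ?K" by simp
    next
      fix x y assume *: "x \<in> ?K" "y \<in> ?K"
      then have c: "x \<in> carrier G" "y \<in> carrier G" by auto
      have "ds_proj G' H' i (f (x \<oplus>\<^bsub>G\<^esub> y)) = f (ds_proj G H i (x \<oplus>\<^bsub>G\<^esub> y))"
        unfolding additive_map_add[OF f(1) c] additive_map_add[OF p(1) c]
          additive_map_add[OF p(2) fc[OF c(1)] fc[OF c(2)]]
          additive_map_add[OF f(1) additive_map_closed[OF p(1) c(1)] additive_map_closed[OF p(1) c(2)]]
        using * by simp
      then show "x \<oplus>\<^bsub>G\<^esub> y \<in> ?K" using c by simp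
    next
      fix x assume *: "x \<in> ?K"
      then have c: "x \<in> carrier G" by auto
      have "ds_proj G' H' i (f (\<ominus>\<^bsub>G\<^esub> x)) = f (ds_proj G H i (\<ominus>\<^bsub>G\<^esub> x))"
        unfolding additive_map_neg[OF G(1) G'(1) f(1) c] G.op_neg[OF p(1) c] G'.op_neg[OF p(2) fc[OF c]]
          additive_map_neg[OF G(1) G'(1) f(1) additive_map_closed[OF p(1) c]]
        using * by simp
      then show "\<ominus>\<^bsub>G\<^esub> x \<in> ?K" using c by simp
    qed blast
    fix j show "H j \<subseteq> ?K"
    proof
      fix x assume x: "x \<in> H j"
      have "ds_proj G' H' i (f x) = f (ds_proj G H i x)"
        unfolding G.ds_proj_component[OF G(2) x] G'.ds_proj_component[OF G'(2) f(2)[OF x]]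
        using additive_map_zero[OF G(1) G'(1) f(1)] by simp
      then show "x \<in> ?K" using additive_subgroup.a_Hcarr[OF G.ds_subgroup[OF G(2)] x] by simp
    qed
  qed
  then show ?thesis using x by blast
qed

section \<open>The Koszul homotopy\<close>

text \<open>Contraction against the basis vector of the first occurrence of \<open>x\<close> in the
  list: the shifted copy belonging to \<open>x\<close> is moved to the unshifted one. Passing the
  shifted copy of an earlier variable costs a sign.\<close>

primrec koszul_homotopy ::
    "('a, 'c, 'z) module_scheme \<Rightarrow> 'a list \<Rightarrow> 'a \<Rightarrow> (bool list \<Rightarrow> 'c) \<Rightarrow> bool list \<Rightarrow> 'c" where
  "koszul_homotopy M [] x w = w"
| "koszul_homotopy M (y # ys) x w = cone_pair \<zero>\<^bsub>M\<^esub>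
     (if x = y then cone_snd w else koszul_homotopy M ys x (cone_fst w))
     (if x = y then (\<lambda>l. \<zero>\<^bsub>M\<^esub>) else (\<lambda>l. \<ominus>\<^bsub>M\<^esub> koszul_homotopy M ys x (cone_snd w) l))"

context differential_module
begin

lemma koszul_homotopy_carrier:
  "w \<in> carrier (chain_module M) \<Longrightarrow> koszul_homotopy M ys x w \<in> carrier (chain_module M)"
proof (induction ys arbitrary: w)
  case (Cons y ys)
  note c = cone_carrier[OF Cons.prems]
  show ?case
    unfolding koszul_homotopy.simps
    by (rule cone_pair_carrier) (use c Cons.IH[OF c(1)] Cons.IH[OF c(2)] in auto)
qed simp

lemma koszul_homotopy_additive:
  "additive_map (chain_module M) (chain_module M) (koszul_homotopy M ys x)"
  unfolding additive_map_def
proof (intro conjI ballI funcsetI koszul_homotopy_carrier)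
  fix v w assume "v \<in> carrier (chain_module M)" "w \<in> carrier (chain_module M)"
  then show "koszul_homotopy M ys x (v \<oplus>\<^bsub>chain_module M\<^esub> w) =
      koszul_homotopy M ys x v \<oplus>\<^bsub>chain_module M\<^esub> koszul_homotopy M ys x w"
  proof (induction ys arbitrary: v w)
    case (Cons y ys)
    note c = cone_carrier[OF Cons.prems(1)] cone_carrier[OF Cons.prems(2)]
    have e: "cone_fst (v \<oplus>\<^bsub>chain_module M\<^esub> w) = cone_fst v \<oplus>\<^bsub>chain_module M\<^esub> cone_fst w"
      "cone_snd (v \<oplus>\<^bsub>chain_module M\<^esub> w) = cone_snd v \<oplus>\<^bsub>chain_module M\<^esub> cone_snd w"
      by (auto simp: cone_fst_def cone_snd_def)
    have k: "koszul_homotopy M ys x u l \<in> carrier M" if "u \<in> carrier (chain_module M)" for u l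
      using koszul_homotopy_carrier[OF that] by simp
    show ?case
      unfolding koszul_homotopy.simps e Cons.IH[OF c(1) c(3)] Cons.IH[OF c(2) c(4)]
      using k[OF c(2)] k[OF c(4)]
      by (auto simp: cone_pair_def fun_eq_iff M.minus_add split: list.splits)
  qed simp
qed

lemma koszul_homotopy_smult:
  assumes "a \<in> carrier R"
  shows "w \<in> carrier (chain_module M) \<Longrightarrow>
    koszul_homotopy M ys x (a \<odot>\<^bsub>chain_module M\<^esub> w) = a \<odot>\<^bsub>chain_module M\<^esub> koszul_homotopy M ys x w"
proof (induction ys arbitrary: w)
  case (Cons y ys)
  note c = cone_carrier[OF Cons.prems]
  have e: "cone_fst (a \<odot>\<^bsub>chain_module M\<^esub> w) = a \<odot>\<^bsub>chain_module M\<^esub> cone_fst w"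
    "cone_snd (a \<odot>\<^bsub>chain_module M\<^esub> w) = a \<odot>\<^bsub>chain_module M\<^esub> cone_snd w"
    by (auto simp: cone_fst_def cone_snd_def)
  have k: "koszul_homotopy M ys x (cone_snd w) l \<in> carrier M" for l
    using koszul_homotopy_carrier[OF c(2)] by simp
  show ?case
    unfolding koszul_homotopy.simps e Cons.IH[OF c(1)] Cons.IH[OF c(2)]
    using k assms by (auto simp: cone_pair_def fun_eq_iff smult_r_minus split: list.splits)
qed simp

lemma koszul_homotopy_chains:
  assumes C: "subcomplex V C" and x: "x \<in> set ys" and w: "w \<in> koszul_chains M (length ys) C i \<mu>"
  shows "koszul_homotopy M ys x w \<in> koszul_chains M (length ys) C (i - 1) (\<mu> + 1)"
  using x w
proof (induction ys arbitrary: w i \<mu>)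
  case (Cons y ys)
  let ?K = "koszul_chains M (length ys) C"
  have w: "cone_fst w \<in> ?K i \<mu>" "cone_snd w \<in> ?K (i - 1) (\<mu> + 1)"
    using Cons.prems(2) unfolding length_Cons koszul_chains_Suc by blast+
  show ?case
  proof (cases "x = y")
    case True
    have "(\<lambda>l. \<zero>\<^bsub>M\<^esub>) \<in> ?K (i - 1 - 1) (\<mu> + 1 + 1)"
      using additive_subgroup.zero_closed[OF koszul_chains_subgroup[OF C]] unfolding chain_module_simps .
    then show ?thesis unfolding length_Cons koszul_chains_Suc using w True by simp
  next
    case False
    then have x: "x \<in> set ys" using Cons.prems by simp
    have 2: "koszul_homotopy M ys x (cone_snd w) \<in> ?K (i - 1 - 1) (\<mu> + 1 + 1)" by (rule Cons.IH[OF x w(2)])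
    have "\<ominus>\<^bsub>chain_module M\<^esub> koszul_homotopy M ys x (cone_snd w) \<in> ?K (i - 1 - 1) (\<mu> + 1 + 1)"
      by (rule Ch.M.additive_subgroup_neg[OF koszul_chains_subgroup[OF C] 2])
    then have "(\<lambda>l. \<ominus>\<^bsub>M\<^esub> koszul_homotopy M ys x (cone_snd w) l) \<in> ?K (i - 1 - 1) (\<mu> + 1 + 1)"
      unfolding chain_neg[OF koszul_chains_carrier[OF C 2]] .
    then show ?thesis
      unfolding length_Cons koszul_chains_Suc using Cons.IH[OF x w(1)] False by simp
  qed
qed simp

text \<open>The identity \<open>d h + h d = x\<close>. On the cone of \<open>x\<close> itself
  \<open>h (u, v) = (v, 0)\<close> and the terms \<open>d v\<close> cancel. On the cone of another
  variable \<open>y\<close> the map is \<open>(h u, - h v)\<close> and the terms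
  \<open>y (h u)\<close> cancel, which leaves the identity for the shorter list.\<close>

lemma koszul_homotopy:
  "set ys \<subseteq> carrier R \<Longrightarrow> x \<in> set ys \<Longrightarrow> w \<in> carrier (chain_module M) \<Longrightarrow>
    \<forall>l. length l < length ys \<longrightarrow> w l = \<zero>\<^bsub>M\<^esub> \<Longrightarrow>
    koszul_diff M D ys (koszul_homotopy M ys x w) \<oplus>\<^bsub>chain_module M\<^esub>
    koszul_homotopy M ys x (koszul_diff M D ys w) = x \<odot>\<^bsub>chain_module M\<^esub> w"
proof (induction ys arbitrary: w)
  case (Cons y ys)
  let ?C = "chain_module M" and ?d = "koszul_diff M D ys" and ?h = "koszul_homotopy M ys x"
  let ?u = "cone_fst w" and ?v = "cone_snd w"
  from Cons.prems(1) have ysR: "set ys \<subseteq> carrier R" and y: "y \<in> carrier R" by auto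
  have xR: "x \<in> carrier R" using Cons.prems by blast
  note c = cone_carrier[OF Cons.prems(3)]
  note dc = koszul_diff_carrier[OF ysR] note hc = koszul_homotopy_carrier
  note H = koszul_homotopy_carrier[OF Cons.prems(3), of "y # ys" x]
  have cc: "a l \<in> carrier M" if "a \<in> carrier ?C" for a l using that by simp
  \<comment> \<open>The differential and the homotopy put zero at the empty list, so the identity
    needs \<open>w\<close> to vanish there. In deeper cones the empty list is a list shorter than
    \<open>ys\<close>, whence the hypothesis on short lists.\<close>
  have w0: "w [] = \<zero>\<^bsub>M\<^esub>" using Cons.prems(4) by (auto dest: spec[of _ "[]"])
  have yu: "y \<odot>\<^bsub>?C\<^esub> ?u \<in> carrier ?C" "y \<odot>\<^bsub>?C\<^esub> ?h ?u \<in> carrier ?C"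
    using y c hc[OF c(1)] Ch.smult_closed by blast+
  have dw: "koszul_diff M D (y # ys) w = cone_pair \<zero>\<^bsub>M\<^esub> (?d ?u) (y \<odot>\<^bsub>?C\<^esub> ?u \<ominus>\<^bsub>?C\<^esub> ?d ?v)"
    by (rule koszul_diff_Cons[OF ysR Cons.prems(3)])
  note m = Ch.M.minus_closed[OF yu(1) dc[OF c(2)]]
  show ?case
  proof (cases "x = y")
    case True
    have z: "(\<lambda>l. \<zero>\<^bsub>M\<^esub>) \<in> carrier ?C" by simp
    have hw: "koszul_homotopy M (y # ys) x w = cone_pair \<zero>\<^bsub>M\<^esub> ?v (\<lambda>l. \<zero>\<^bsub>M\<^esub>)" using True by simp
    have d0: "?d (\<lambda>l. \<zero>\<^bsub>M\<^esub>) = (\<lambda>l. \<zero>\<^bsub>M\<^esub>)"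
      using Ch.M.op_zero[OF koszul_diff_additive[OF ysR]] unfolding chain_module_simps .
    have yv: "y \<odot>\<^bsub>?C\<^esub> ?v \<in> carrier ?C" using y c(2) Ch.smult_closed by blast
    have "koszul_diff M D (y # ys) (koszul_homotopy M (y # ys) x w) = cone_pair \<zero>\<^bsub>M\<^esub> (?d ?v) (y \<odot>\<^bsub>?C\<^esub> ?v)"
      unfolding koszul_diff_Cons[OF ysR H] unfolding hw cone_simps d0
      using Ch.M.diff_zero[OF yv] unfolding chain_module_simps by simp
    moreover have "koszul_homotopy M (y # ys) x (koszul_diff M D (y # ys) w) =
        cone_pair \<zero>\<^bsub>M\<^esub> (y \<odot>\<^bsub>?C\<^esub> ?u \<ominus>\<^bsub>?C\<^esub> ?d ?v) (\<lambda>l. \<zero>\<^bsub>M\<^esub>)"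
      unfolding koszul_homotopy.simps dw cone_simps using True by simp
    ultimately show ?thesis
      unfolding chain_minus[OF dc[OF c(2)]]
      using w0 True cc[OF c(1)] cc[OF c(2)] cc[OF dc[OF c(2)]] y
      by (auto simp: cone_pair_def cone_fst_def cone_snd_def fun_eq_iff M.add_diff_cancel_left split: list.splits)
  next
    case False
    then have x: "x \<in> set ys" using Cons.prems(2) by simp
    have IH1: "?d (?h ?u) \<oplus>\<^bsub>?C\<^esub> ?h (?d ?u) = x \<odot>\<^bsub>?C\<^esub> ?u"
      by (rule Cons.IH[OF ysR x c(1)]) (use Cons.prems(4) in \<open>auto simp: cone_fst_def\<close>)
    have IH2: "?d (?h ?v) \<oplus>\<^bsub>?C\<^esub> ?h (?d ?v) = x \<odot>\<^bsub>?C\<^esub> ?v"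
      by (rule Cons.IH[OF ysR x c(2)]) (use Cons.prems(4) in \<open>auto simp: cone_snd_def\<close>)
    have hw: "koszul_homotopy M (y # ys) x a = cone_pair \<zero>\<^bsub>M\<^esub> (?h (cone_fst a)) (\<ominus>\<^bsub>?C\<^esub> ?h (cone_snd a))"
      if "a \<in> carrier ?C" for a
      unfolding chain_neg[OF hc[OF cone_carrier(2)[OF that]]] using False by simp
    let ?p = "y \<odot>\<^bsub>?C\<^esub> ?h ?u"
    note dhu = dc[OF hc[OF c(1)]] and dhv = dc[OF hc[OF c(2)]] and hdv = hc[OF dc[OF c(2)]]
    have 1: "koszul_diff M D (y # ys) (koszul_homotopy M (y # ys) x w) =
        cone_pair \<zero>\<^bsub>M\<^esub> (?d (?h ?u)) (?p \<ominus>\<^bsub>?C\<^esub> \<ominus>\<^bsub>?C\<^esub> ?d (?h ?v))"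
      unfolding koszul_diff_Cons[OF ysR H] unfolding hw[OF Cons.prems(3)] cone_simps
        Ch.M.op_neg[OF koszul_diff_additive[OF ysR] hc[OF c(2)]] ..
    have "?h (y \<odot>\<^bsub>?C\<^esub> ?u \<ominus>\<^bsub>?C\<^esub> ?d ?v) = ?p \<ominus>\<^bsub>?C\<^esub> ?h (?d ?v)"
      unfolding Ch.M.op_minus[OF koszul_homotopy_additive yu(1) dc[OF c(2)]] koszul_homotopy_smult[OF y c(1)] ..
    note e2 = this
    have 2: "koszul_homotopy M (y # ys) x (koszul_diff M D (y # ys) w) =
        cone_pair \<zero>\<^bsub>M\<^esub> (?h (?d ?u)) (\<ominus>\<^bsub>?C\<^esub> (?p \<ominus>\<^bsub>?C\<^esub> ?h (?d ?v)))"
      unfolding hw[OF koszul_diff_carrier[OF Cons.prems(1,3)]] unfolding dw cone_simps e2 ..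
    have "(?p \<ominus>\<^bsub>?C\<^esub> \<ominus>\<^bsub>?C\<^esub> ?d (?h ?v)) \<oplus>\<^bsub>?C\<^esub> (\<ominus>\<^bsub>?C\<^esub> (?p \<ominus>\<^bsub>?C\<^esub> ?h (?d ?v))) = ?d (?h ?v) \<oplus>\<^bsub>?C\<^esub> ?h (?d ?v)"
      by (rule Ch.M.diff_add_neg_diff[OF yu(2) dhv hdv])
    with IH2 have s: "(?p \<ominus>\<^bsub>?C\<^esub> \<ominus>\<^bsub>?C\<^esub> ?d (?h ?v)) \<oplus>\<^bsub>?C\<^esub> (\<ominus>\<^bsub>?C\<^esub> (?p \<ominus>\<^bsub>?C\<^esub> ?h (?d ?v))) = x \<odot>\<^bsub>?C\<^esub> ?v" by simp
    have sum: "cone_pair \<zero>\<^bsub>M\<^esub> a b \<oplus>\<^bsub>?C\<^esub> cone_pair \<zero>\<^bsub>M\<^esub> a' b' = cone_pair \<zero>\<^bsub>M\<^esub> (a \<oplus>\<^bsub>?C\<^esub> a') (b \<oplus>\<^bsub>?C\<^esub> b')" for a b a' b'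
      by (auto simp: cone_pair_def fun_eq_iff split: list.splits)
    show ?thesis
      unfolding 1 2 sum s IH1
      using w0 xR by (auto simp: cone_pair_def cone_fst_def cone_snd_def fun_eq_iff split: list.splits)
  qed
qed simp

text \<open>Multiplication by a member of the sequence is null-homotopic, hence zero on Koszul
  cohomology; the homotopy supplies the primitive.\<close>

lemma koszul_homotopy_cocycle:
  assumes C: "subcomplex V C" and ys: "set ys \<subseteq> carrier R" "x \<in> set ys"
    and w: "w \<in> koszul_chains M (length ys) C i \<mu>" "koszul_diff M D ys w = \<zero>\<^bsub>chain_module M\<^esub>"
  shows "koszul_diff M D ys (koszul_homotopy M ys x w) = x \<odot>\<^bsub>chain_module M\<^esub> w"
proof -
  note wc = koszul_chains_carrier[OF C w(1)]
  have short: "w l = \<zero>\<^bsub>M\<^esub>" if "length l \<noteq> length ys" for l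
    using w(1) that unfolding koszul_chains_def by (auto dest: spec[of _ l])
  have "koszul_diff M D ys (koszul_homotopy M ys x w) \<oplus>\<^bsub>chain_module M\<^esub>
      koszul_homotopy M ys x (koszul_diff M D ys w) = x \<odot>\<^bsub>chain_module M\<^esub> w"
    by (rule koszul_homotopy[OF ys wc]) (use short in auto)
  then show ?thesis
    unfolding w(2) Ch.M.op_zero[OF koszul_homotopy_additive]
      Ch.M.r_zero[OF koszul_diff_carrier[OF ys(1) koszul_homotopy_carrier[OF wc]]] .
qed

end

section \<open>Koszul cohomology of the Rees module\<close>

definition at_index :: "'m \<Rightarrow> 'i \<Rightarrow> 'm \<Rightarrow> 'i \<Rightarrow> 'm" where
  "at_index z n y = (\<lambda>n'. if n' = n then y else z)"

text \<open>Multiplication by the element \<open>f T_j\<close> of the Rees algebra, for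
  \<open>jf = (j, f)\<close>: the value at exponent \<open>n\<close> comes from \<open>n\<close>
  minus the unit vector of \<open>j\<close>, if there is such an exponent.\<close>

definition shift_mult ::
    "('a, 'm, 'z) module_scheme \<Rightarrow> 'j \<times> 'a \<Rightarrow> (('j \<Rightarrow> nat) \<Rightarrow> 'm) \<Rightarrow> ('j \<Rightarrow> nat) \<Rightarrow> 'm" where
  "shift_mult M jf g = (\<lambda>n. if n (fst jf) = 0 then \<zero>\<^bsub>M\<^esub>
     else snd jf \<odot>\<^bsub>M\<^esub> g (n(fst jf := n (fst jf) - 1)))"

lemma fun_upd_Suc_iff:
  fixes n n' :: "'j \<Rightarrow> nat"
  shows "n' = n(j := Suc (n j)) \<longleftrightarrow> n' j \<noteq> 0 \<and> n'(j := n' j - 1) = n"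
  by (auto simp: fun_eq_iff)

context graded_module
begin

lemma degree_part_subgroup: "additive_subgroup (degree_part A n) A"
  by (rule abelian_group.ds_subgroup[OF ring.axioms(1)[OF ring_axioms] decomposition])

lemma degree_part_carrier: "a \<in> degree_part A n \<Longrightarrow> a \<in> carrier A"
  using additive_subgroup.a_Hcarr[OF degree_part_subgroup] .

lemma component_subgroup: "additive_subgroup (component M \<mu>) M"
  by (rule M.ds_subgroup[OF module_decomposition])

lemma component_carrier: "x \<in> component M \<mu> \<Longrightarrow> x \<in> carrier M"
  using additive_subgroup.a_Hcarr[OF component_subgroup] .

end

text \<open>\<open>N n\<close> stands for \<open>I\<^sub>1\<^bsup>n\<^sub>1\<^esup> \<cdots> I\<^sub>t\<^bsup>n\<^sub>t\<^esup> M\<close> and \<open>fs\<close> for a finite set of pairs \<open>(j, f)\<close> with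
  \<open>f\<close> a homogeneous generator of \<open>I\<^sub>j\<close> of degree \<open>\<delta> (j, f)\<close>. The Rees module is the submodule of
  the module of all functions \<open>g\<close> with \<open>g n \<in> N n\<close>.\<close>

locale rees_module = graded_module A M
  for A :: "'a graded_ring" and M :: "('a, 'm) graded_module" +
  fixes xs :: "'a list" and Ms :: "'m set" and J :: "'j set" and fs :: "('j \<times> 'a) set"
    and \<delta> :: "'j \<times> 'a \<Rightarrow> nat" and N :: "('j \<Rightarrow> nat) \<Rightarrow> 'm set"
  assumes noetherian: "noetherian_ring A"
    and xs: "set xs \<subseteq> degree_part A 1"
    and generators: "generate_ring A (degree_part A 0 \<union> set xs) = carrier A"
    and Ms: "finite Ms" "Ms \<subseteq> carrier M" "module_span A M Ms = carrier M"
    and J: "finite J"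
    and fs: "finite fs" "\<And>j f. (j, f) \<in> fs \<Longrightarrow> j \<in> J" "\<And>j f. (j, f) \<in> fs \<Longrightarrow> f \<in> degree_part A (\<delta> (j, f))"
    and N_zero: "N (\<lambda>_. 0) = carrier M"
    and N_submodule: "\<And>n. submodule (N n) A M"
    and N_up: "\<And>n j f y. (j, f) \<in> fs \<Longrightarrow> y \<in> N n \<Longrightarrow> f \<odot>\<^bsub>M\<^esub> y \<in> N (n(j := Suc (n j)))"
    and N_gen: "\<And>n j U. j \<in> J \<Longrightarrow> submodule U A M \<Longrightarrow>
      (\<And>f y. (j, f) \<in> fs \<Longrightarrow> y \<in> N n \<Longrightarrow> f \<odot>\<^bsub>M\<^esub> y \<in> U) \<Longrightarrow> N (n(j := Suc (n j))) \<subseteq> U"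
begin

section \<open>Koszul chains of all modules \<open>N n\<close> inside one product\<close>

abbreviation "Rees \<equiv> prod_module (\<lambda>_ :: 'j \<Rightarrow> nat. M)"
abbreviation "Ch \<equiv> chain_module Rees"
abbreviation "D0 \<equiv> (\<lambda>_ :: ('j \<Rightarrow> nat) \<Rightarrow> 'm. \<zero>\<^bsub>Rees\<^esub>)"
abbreviation "kd \<equiv> koszul_diff Rees D0 xs"
abbreviation "spot \<equiv> at_index \<zero>\<^bsub>M\<^esub>"

text \<open>One multidegree of the Rees module, as a complex concentrated in cohomological degree 0.
  All exponents share the ambient product of copies of \<open>M\<close>, so that a single finiteness
  statement covers them together.\<close>

definition rees_part :: "('j \<Rightarrow> nat) \<Rightarrow> int \<Rightarrow> int \<Rightarrow> (('j \<Rightarrow> nat) \<Rightarrow> 'm) set" where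
  "rees_part n i \<mu> = {g. \<forall>n'. g n' \<in> (if n' = n \<and> i = 0 then N n \<inter> component M \<mu> else {\<zero>\<^bsub>M\<^esub>})}"

abbreviation "K n \<equiv> koszul_chains Rees (length xs) (rees_part n)"

text \<open>The index type may be larger than \<open>J\<close>; these are the exponents reached from
  0 by raising coordinates in \<open>J\<close>.\<close>

definition supported :: "('j \<Rightarrow> nat) \<Rightarrow> bool" where
  "supported n \<longleftrightarrow> (\<forall>j. j \<notin> J \<longrightarrow> n j = 0)"

lemma xs_carrier: "set xs \<subseteq> carrier A"
  using xs degree_part_carrier by blast

lemma xs_smult: "x \<in> set xs \<Longrightarrow> y \<in> component M \<mu> \<Longrightarrow> x \<odot>\<^bsub>M\<^esub> y \<in> component M (\<mu> + 1)"
  using smult_degree[of x 1 y \<mu>] xs by (auto simp: add.commute)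

lemma fs_carrier: "(j, f) \<in> fs \<Longrightarrow> f \<in> carrier A"
  using fs(3) degree_part_carrier by blast

lemma N_subgroup: "additive_subgroup (N n) M"
  by (rule additive_subgroupI[OF submodule.axioms(1)[OF N_submodule]])

lemma N_smult: "a \<in> carrier A \<Longrightarrow> y \<in> N n \<Longrightarrow> a \<odot>\<^bsub>M\<^esub> y \<in> N n"
  by (rule submodule.smult_closed[OF N_submodule])

sublocale rees: differential_module A Rees D0
proof (intro differential_module.intro differential_module_axioms.intro)
  show rees: "module A Rees" by (rule prod_module[OF is_cring module_axioms])
  show "additive_map Rees Rees D0" by (auto simp: additive_map_def)
  fix a and x :: "('j \<Rightarrow> nat) \<Rightarrow> 'm"
  assume "a \<in> carrier A"
  then show "\<zero>\<^bsub>Rees\<^esub> = a \<odot>\<^bsub>Rees\<^esub> \<zero>\<^bsub>Rees\<^esub>" by simp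
qed simp

lemma rees_part_subcomplex: "rees.subcomplex (set xs) (rees_part n)"
  unfolding rees.subcomplex_def
proof (intro conjI allI ballI)
  show "set xs \<subseteq> carrier A" by (rule xs_carrier)
  fix i \<mu>
  have inter: "additive_subgroup (N n \<inter> component M \<mu>) M" for \<mu>
    by (rule M.additive_subgroupI2)
      (use additive_subgroup.a_closed[OF N_subgroup] additive_subgroup.a_closed[OF component_subgroup]
        additive_subgroup.zero_closed[OF N_subgroup] additive_subgroup.zero_closed[OF component_subgroup]
        M.additive_subgroup_neg[OF N_subgroup] M.additive_subgroup_neg[OF component_subgroup]
        component_carrier in auto)
  have zero: "additive_subgroup {\<zero>\<^bsub>M\<^esub>} M" by (rule M.additive_subgroupI2) auto
  show sub: "additive_subgroup (rees_part n i \<mu>) Rees"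
    unfolding rees_part_def
  proof (rule prod_module_subgroup[OF M.abelian_group_axioms])
    show "additive_subgroup (if n' = n \<and> i = 0 then N n \<inter> component M \<mu> else {\<zero>\<^bsub>M\<^esub>}) M" for n'
      using inter zero by simp
  qed
  fix c assume c: "c \<in> rees_part n i \<mu>"
  show "\<zero>\<^bsub>Rees\<^esub> \<in> rees_part n (i + 1) \<mu>"
    unfolding rees_part_def
    using additive_subgroup.zero_closed[OF N_subgroup] additive_subgroup.zero_closed[OF component_subgroup] by simp
  fix x assume x: "x \<in> set xs"
  show "x \<odot>\<^bsub>Rees\<^esub> c \<in> rees_part n i (\<mu> + 1)"
    unfolding rees_part_def
  proof (intro CollectI allI)
    fix n'
    have "c n' \<in> (if n' = n \<and> i = 0 then N n \<inter> component M \<mu> else {\<zero>\<^bsub>M\<^esub>})"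
      using c unfolding rees_part_def by blast
    then show "(x \<odot>\<^bsub>Rees\<^esub> c) n' \<in> (if n' = n \<and> i = 0 then N n \<inter> component M (\<mu> + 1) else {\<zero>\<^bsub>M\<^esub>})"
      using xs_carrier x N_smult xs_smult by (auto split: if_splits)
  qed
qed

lemma K_subgroup: "additive_subgroup (K n i \<mu>) Ch"
  by (rule rees.koszul_chains_subgroup[OF rees_part_subcomplex])

lemma K_carrier: "w \<in> K n i \<mu> \<Longrightarrow> w \<in> carrier Ch"
  by (rule rees.koszul_chains_carrier[OF rees_part_subcomplex])

lemma K_iff:
  "w \<in> K n i \<mu> \<longleftrightarrow> (\<forall>l n'. w l n' \<in>
     (if length l = length xs \<and> n' = n \<and> i = twist l then N n \<inter> component M (\<mu> + twist l) else {\<zero>\<^bsub>M\<^esub>}))"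
proof -
  have "w l \<in> (if length l = length xs then rees_part n (i - twist l) (\<mu> + twist l) else {\<zero>\<^bsub>Rees\<^esub>}) \<longleftrightarrow>
    (\<forall>n'. w l n' \<in> (if length l = length xs \<and> n' = n \<and> i = twist l
      then N n \<inter> component M (\<mu> + twist l) else {\<zero>\<^bsub>M\<^esub>}))" for l
    by (cases "length l = length xs") (auto simp: rees_part_def fun_eq_iff)
  then show ?thesis unfolding koszul_chains_def by (simp only: mem_Collect_eq)
qed

lemma shift_mult_additive: "(j, f) \<in> fs \<Longrightarrow> additive_map Rees Rees (shift_mult M (j, f))"
  using fs_carrier unfolding additive_map_def by (auto simp: shift_mult_def smult_r_distr fun_eq_iff)

lemma shift_mult_smult:
  assumes "(j, f) \<in> fs" "a \<in> carrier A" "g \<in> carrier Rees"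
  shows "shift_mult M (j, f) (a \<odot>\<^bsub>Rees\<^esub> g) = a \<odot>\<^bsub>Rees\<^esub> shift_mult M (j, f) g"
proof
  fix n
  note f = fs_carrier[OF assms(1)]
  have "f \<odot>\<^bsub>M\<^esub> (a \<odot>\<^bsub>M\<^esub> g m) = a \<odot>\<^bsub>M\<^esub> (f \<odot>\<^bsub>M\<^esub> g m)" for m
    using f assms m_comm[OF f assms(2)] by (simp add: smult_assoc1[symmetric])
  then show "shift_mult M (j, f) (a \<odot>\<^bsub>Rees\<^esub> g) n = (a \<odot>\<^bsub>Rees\<^esub> shift_mult M (j, f) g) n"
    using assms(2) by (simp add: shift_mult_def)
qed

lemma shift_mult_commute:
  assumes "(j, f) \<in> fs" "(j', f') \<in> fs" "g \<in> carrier Rees"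
  shows "shift_mult M (j, f) (shift_mult M (j', f') g) = shift_mult M (j', f') (shift_mult M (j, f) g)"
proof
  fix n
  have c: "f \<in> carrier A" "f' \<in> carrier A" using assms fs_carrier by blast+
  have e: "f \<odot>\<^bsub>M\<^esub> (f' \<odot>\<^bsub>M\<^esub> g m) = f' \<odot>\<^bsub>M\<^esub> (f \<odot>\<^bsub>M\<^esub> g m)" for m
    using c assms(3) m_comm[of f f'] by (simp add: smult_assoc1[symmetric])
  show "shift_mult M (j, f) (shift_mult M (j', f') g) n = shift_mult M (j', f') (shift_mult M (j, f) g) n"
  proof (cases "j = j'")
    case True then show ?thesis using c by (simp add: shift_mult_def e)
  next
    case False
    then have "n(j := n j - 1, j' := n j' - 1) = n(j' := n j' - 1, j := n j - 1)" by (simp add: fun_upd_twist)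
    then show ?thesis using c False by (simp add: shift_mult_def e)
  qed
qed

definition chain_shift :: "'j \<times> 'a \<Rightarrow> (bool list \<Rightarrow> ('j \<Rightarrow> nat) \<Rightarrow> 'm) \<Rightarrow> bool list \<Rightarrow> ('j \<Rightarrow> nat) \<Rightarrow> 'm" where
  "chain_shift jf w = (\<lambda>l. shift_mult M jf (w l))"

text \<open>The elements of A_0, the variables and the elements \<open>f T_j\<close> generate the
  Rees algebra, and each of them moves chains of one multidegree into one multidegree.\<close>

abbreviation "ops \<equiv> smult_ops Ch (degree_part A 0 \<union> set xs) \<union> chain_shift ` fs"

lemma generators_carrier: "degree_part A 0 \<union> set xs \<subseteq> carrier A"
  using xs_carrier degree_part_carrier by blast

lemma chain_shift_additive:
  assumes "(j, f) \<in> fs" shows "additive_map Ch Ch (chain_shift (j, f))"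
  unfolding additive_map_def
proof (intro conjI ballI funcsetI)
  note p = shift_mult_additive[OF assms]
  fix v assume v: "v \<in> carrier Ch"
  then have vl: "v l \<in> carrier Rees" for l unfolding chain_module_simps by blast
  show "chain_shift (j, f) v \<in> carrier Ch"
    unfolding chain_module_simps chain_shift_def using additive_map_closed[OF p vl] ..
  fix w assume w: "w \<in> carrier Ch"
  then have wl: "w l \<in> carrier Rees" for l unfolding chain_module_simps by blast
  show "chain_shift (j, f) (v \<oplus>\<^bsub>Ch\<^esub> w) = chain_shift (j, f) v \<oplus>\<^bsub>Ch\<^esub> chain_shift (j, f) w"
    unfolding chain_module_simps chain_shift_def additive_map_add[OF p vl wl] ..
qed

lemma ops_cases:
  assumes "\<phi> \<in> ops"
  obtains (scalar) a where "a \<in> degree_part A 0" "\<phi> = (\<lambda>w. a \<odot>\<^bsub>Ch\<^esub> w)"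
    | (variable) x where "x \<in> set xs" "\<phi> = (\<lambda>w. x \<odot>\<^bsub>Ch\<^esub> w)"
    | (shift) j f where "(j, f) \<in> fs" "\<phi> = chain_shift (j, f)"
proof -
  from assms have "\<phi> \<in> (\<lambda>a w. a \<odot>\<^bsub>Ch\<^esub> w) ` degree_part A 0 \<or> \<phi> \<in> (\<lambda>a w. a \<odot>\<^bsub>Ch\<^esub> w) ` set xs \<or> \<phi> \<in> chain_shift ` fs"
    unfolding smult_ops_def image_Un by (simp only: Un_iff disj_assoc)
  then show thesis using that by (elim disjE imageE) (blast, blast, metis prod.exhaust)
qed

lemma operators_shift: "rees.Ch.M.operators (chain_shift ` fs)"
  unfolding rees.Ch.M.operators_def
proof
  fix \<phi> assume "\<phi> \<in> chain_shift ` fs"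
  then obtain j f where "(j, f) \<in> fs" "\<phi> = chain_shift (j, f)" by (metis imageE prod.exhaust)
  then show "additive_map Ch Ch \<phi>" using chain_shift_additive by simp
qed

lemma operators_ops: "rees.Ch.M.operators ops"
  using operators_shift rees.Ch.smult_ops_operators[OF generators_carrier]
  unfolding rees.Ch.M.operators_def ball_Un by (rule conjI[rotated])

abbreviation "single l n y \<equiv> at_index \<zero>\<^bsub>Rees\<^esub> l (spot n y)"

text \<open>Basis vectors of the Koszul complex times generators of \<open>M\<close>, all at
  exponent 0; the operators produce the chains at the other exponents.\<close>

definition gens :: "(bool list \<Rightarrow> ('j \<Rightarrow> nat) \<Rightarrow> 'm) set" where
  "gens = (\<lambda>(l, y). single l (\<lambda>_. 0) y) ` ({l. length l = length xs} \<times> Ms)"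

lemma single_carrier: "y \<in> carrier M \<Longrightarrow> single l n y \<in> carrier Ch"
  by (simp add: at_index_def)

lemma gens_finite: "finite gens" "gens \<subseteq> carrier Ch"
proof -
  show "finite gens"
    unfolding gens_def by (intro finite_imageI finite_cartesian_product rees.finite_bool_lists Ms(1))
  show "gens \<subseteq> carrier Ch"
  proof
    fix w assume "w \<in> gens"
    then obtain l y where "y \<in> Ms" "w = single l (\<lambda>_. 0) y" unfolding gens_def by auto
    then show "w \<in> carrier Ch" using single_carrier Ms(2) by blast
  qed
qed

text \<open>The span of one generator is Noetherian over \<open>A\<close> because \<open>A\<close>
  is; the finitely many shifts commute with everything and are adjoined as polynomial variables by
  the basis theorem.\<close>

lemma ops_noetherian: "op_noetherian Ch ops (op_span Ch ops gens)"
proof (rule rees.Ch.M.op_noetherian_adjoin_finite[OF _ operators_shift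
      rees.Ch.smult_ops_operators[OF generators_carrier] _ gens_finite(2)])
  show "finite (chain_shift ` fs)" using fs(1) by blast
  show "op_noetherian Ch (smult_ops Ch (degree_part A 0 \<union> set xs)) (op_span Ch (smult_ops Ch (degree_part A 0 \<union> set xs)) gens)"
    by (rule rees.Ch.M.op_noetherian_finite[OF rees.Ch.smult_ops_operators[OF generators_carrier] gens_finite])
      (rule rees.Ch.op_noetherian_cyclic[OF noetherian generators generators_carrier], use gens_finite(2) in blast)
  fix \<phi> \<psi> w assume \<phi>: "\<phi> \<in> ops" and \<psi>: "\<psi> \<in> chain_shift ` fs" and w: "w \<in> carrier Ch"
  then have wl: "w l \<in> carrier Rees" for l by simp
  obtain j f where jf: "(j, f) \<in> fs" "\<psi> = chain_shift (j, f)" using \<psi> by force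
  have smult: "\<phi> (\<psi> w) = \<psi> (\<phi> w)" if a: "a \<in> carrier A" and e: "\<phi> = (\<lambda>x. a \<odot>\<^bsub>Ch\<^esub> x)" for a
    unfolding jf(2) e chain_shift_def chain_module_simps(4) shift_mult_smult[OF jf(1) a wl] ..
  from \<phi> show "\<phi> (\<psi> w) = \<psi> (\<phi> w)"
  proof (cases rule: ops_cases)
    case (scalar a)
    then show ?thesis using smult degree_part_carrier by blast
  next
    case (variable x)
    then show ?thesis using smult xs_carrier by blast
  next
    case (shift j' f')
    show ?thesis
      unfolding jf(2) shift(2) chain_shift_def shift_mult_commute[OF jf(1) shift(1) wl] ..
  qed
qed

lemma span_closed: "op_closed Ch ops (op_span Ch ops gens)"
  by (rule rees.Ch.M.op_span_closed[OF operators_ops gens_finite(2)])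

lemma span_smult:
  assumes "a \<in> carrier A" "w \<in> op_span Ch ops gens"
  shows "a \<odot>\<^bsub>Ch\<^esub> w \<in> op_span Ch ops gens"
  by (rule rees.Ch.op_closed_smult[OF generators generators_carrier rees.Ch.M.op_closed_subset[OF span_closed] assms]) simp

lemma supported_induct:
  assumes "supported n" "P (\<lambda>_. 0)" "\<And>n j. P n \<Longrightarrow> j \<in> J \<Longrightarrow> supported n \<Longrightarrow> P (n(j := Suc (n j)))"
  shows "P n"
  using assms(1)
proof (induction "\<Sum>j\<in>J. n j" arbitrary: n rule: less_induct)
  case less
  show ?case
  proof (cases "\<exists>j\<in>J. n j \<noteq> 0")
    case False
    then have "n = (\<lambda>_. 0)" using less.prems unfolding supported_def by (intro ext) blast
    then show ?thesis using assms(2) by simp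
  next
    case True
    then obtain j where j: "j \<in> J" "n j \<noteq> 0" by blast
    let ?m = "n(j := n j - 1)"
    have "(\<Sum>j\<in>J. ?m j) < (\<Sum>j\<in>J. n j)"
      by (rule sum_strict_mono_ex1[OF J]) (use j in auto)
    moreover have s: "supported ?m" using less.prems j unfolding supported_def by auto
    ultimately have "P ?m" by (rule less.hyps)
    then have "P (?m(j := Suc (?m j)))" using assms(3) j(1) s by blast
    moreover have "?m(j := Suc (?m j)) = n" using j(2) by (auto simp: fun_eq_iff)
    ultimately show ?thesis by simp
  qed
qed

text \<open>\<open>N_gen\<close> is a universal property, so the \<open>y\<close> whose one-entry
  chain lies in the span are collected in a submodule \<open>?U n\<close>. At exponent 0 it contains
  the generators of \<open>M\<close>, and multiplication by \<open>f\<close> carries it to the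
  exponent raised at \<open>j\<close>, since there it is a shift of chains.\<close>

lemma single_in_span:
  assumes "supported n" "length l = length xs" "y \<in> N n"
  shows "single l n y \<in> op_span Ch ops gens"
proof -
  let ?W = "op_span Ch ops gens"
  let ?U = "\<lambda>n. {y \<in> carrier M. single l n y \<in> ?W}"
  have U: "submodule (?U n) A M" for n
  proof (rule submoduleI)
    have "single l n \<zero>\<^bsub>M\<^esub> = \<zero>\<^bsub>Ch\<^esub>" by (simp add: at_index_def fun_eq_iff)
    then show "\<zero>\<^bsub>M\<^esub> \<in> ?U n" using rees.Ch.M.op_closed_zero[OF span_closed] by simp
  next
    fix y assume y: "y \<in> ?U n"
    then have e: "(\<ominus>\<^bsub>A\<^esub> \<one>\<^bsub>A\<^esub>) \<odot>\<^bsub>M\<^esub> y = \<ominus>\<^bsub>M\<^esub> y" by (simp add: smult_l_minus)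
    have "single l n (\<ominus>\<^bsub>M\<^esub> y) = (\<ominus>\<^bsub>A\<^esub> \<one>\<^bsub>A\<^esub>) \<odot>\<^bsub>Ch\<^esub> single l n y"
      by (simp add: at_index_def fun_eq_iff e)
    then show "\<ominus>\<^bsub>M\<^esub> y \<in> ?U n" using y span_smult[of "\<ominus>\<^bsub>A\<^esub> \<one>\<^bsub>A\<^esub>"] by simp
  next
    fix y z assume y: "y \<in> ?U n" and z: "z \<in> ?U n"
    have "single l n (y \<oplus>\<^bsub>M\<^esub> z) = single l n y \<oplus>\<^bsub>Ch\<^esub> single l n z"
      by (simp add: at_index_def fun_eq_iff)
    then show "y \<oplus>\<^bsub>M\<^esub> z \<in> ?U n" using y z rees.Ch.M.op_closed_add[OF span_closed] by simp
  next
    fix a y assume a: "a \<in> carrier A" and y: "y \<in> ?U n"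
    have "single l n (a \<odot>\<^bsub>M\<^esub> y) = a \<odot>\<^bsub>Ch\<^esub> single l n y"
      using a by (simp add: at_index_def fun_eq_iff)
    then show "a \<odot>\<^bsub>M\<^esub> y \<in> ?U n" using a y span_smult[OF a] by simp
  qed blast
  have "N n \<subseteq> ?U n"
    using assms(1)
  proof (rule supported_induct)
    have "single l (\<lambda>_. 0) y \<in> ?W" if "y \<in> Ms" for y
      using that assms(2) by (intro subsetD[OF op_span_incl]) (auto simp: gens_def)
    then have "Ms \<subseteq> ?U (\<lambda>_. 0)" using Ms(2) by blast
    then have "module_span A M Ms \<subseteq> ?U (\<lambda>_. 0)" using U unfolding module_span_def by blast
    then show "N (\<lambda>_. 0) \<subseteq> ?U (\<lambda>_. 0)" unfolding Ms(3) N_zero .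
  next
    fix n j assume IH: "N n \<subseteq> ?U n" and j: "j \<in> J"
    show "N (n(j := Suc (n j))) \<subseteq> ?U (n(j := Suc (n j)))"
    proof (rule N_gen[OF j U])
      fix f y assume jf: "(j, f) \<in> fs" and y: "y \<in> N n"
      then have yU: "y \<in> carrier M" "single l n y \<in> ?W" using IH by blast+
      note f = fs_carrier[OF jf]
      have "single l (n(j := Suc (n j))) (f \<odot>\<^bsub>M\<^esub> y) = chain_shift (j, f) (single l n y)"
      proof (intro ext)
        fix k m
        show "single l (n(j := Suc (n j))) (f \<odot>\<^bsub>M\<^esub> y) k m = chain_shift (j, f) (single l n y) k m"
        proof (cases "m = n(j := Suc (n j))")
          case True
          then have "m j \<noteq> 0" "m(j := m j - 1) = n" using fun_upd_Suc_iff[of m n j] by blast+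
          with True show ?thesis
            unfolding at_index_def chain_shift_def shift_mult_def using smult_r_null[OF f] by simp
        next
          case False
          then have "m j = 0 \<or> m(j := m j - 1) \<noteq> n" using fun_upd_Suc_iff[of m n j] by blast
          with False show ?thesis
            unfolding at_index_def chain_shift_def shift_mult_def using smult_r_null[OF f] by auto
        qed
      qed
      also have "\<dots> \<in> ?W" using rees.Ch.M.op_closed_op[OF span_closed _ yU(2)] jf by blast
      finally show "f \<odot>\<^bsub>M\<^esub> y \<in> ?U (n(j := Suc (n j)))" using f yU(1) by simp
    qed
  qed
  then show ?thesis using assms(3) by blast
qed

text \<open>Places all Koszul chains, at all supported exponents, in one Noetherian span; a chain is
  the sum of its entries over finitely many lists.\<close>

lemma K_in_span:
  assumes "supported n" "w \<in> K n i \<mu>"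
  shows "w \<in> op_span Ch ops gens"
proof -
  have *: "w \<in> op_span Ch ops gens"
    if "finite L" "L \<subseteq> {l. length l = length xs}" "\<And>l. w l \<in> spot n ` N n" "\<And>l. l \<notin> L \<Longrightarrow> w l = \<zero>\<^bsub>Rees\<^esub>" for L w
    using that
  proof (induction L arbitrary: w)
    case empty
    then have "w = \<zero>\<^bsub>Ch\<^esub>" by (simp add: fun_eq_iff)
    then show ?case using rees.Ch.M.op_closed_zero[OF span_closed] by simp
  next
    case (insert k L)
    obtain y where y: "y \<in> N n" "w k = spot n y" using insert.prems(2)[of k] by blast
    have z: "\<zero>\<^bsub>Rees\<^esub> \<in> spot n ` N n"
      using additive_subgroup.zero_closed[OF N_subgroup]
      by (intro image_eqI[of _ _ "\<zero>\<^bsub>M\<^esub>"]) (auto simp: at_index_def fun_eq_iff)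
    have c: "w l m \<in> carrier M" for l m
      using insert.prems(2)[of l] additive_subgroup.a_Hcarr[OF N_subgroup] by (auto simp: at_index_def)
    have "w(k := \<zero>\<^bsub>Rees\<^esub>) \<in> op_span Ch ops gens"
      by (rule insert.IH) (use insert.prems z in auto)
    moreover have "single k n y \<in> op_span Ch ops gens"
      using insert.prems(1) by (intro single_in_span[OF assms(1) _ y(1)]) blast
    moreover have "w = w(k := \<zero>\<^bsub>Rees\<^esub>) \<oplus>\<^bsub>Ch\<^esub> single k n y"
      using y(2) c additive_subgroup.a_Hcarr[OF N_subgroup y(1)] by (auto simp: fun_eq_iff at_index_def)
    ultimately show ?case using rees.Ch.M.op_closed_add[OF span_closed] by metis
  qed
  show ?thesis
  proof (rule *[of "{l. length l = length xs}"])
    have wl: "w l n' \<in> (if length l = length xs \<and> n' = n \<and> i = twist l then N n \<inter> component M (\<mu> + twist l) else {\<zero>\<^bsub>M\<^esub>})" for l n'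
      using assms(2) unfolding K_iff by blast
    show "w l \<in> spot n ` N n" for l
    proof (rule image_eqI)
      show "w l n \<in> N n" using wl[of l n] additive_subgroup.zero_closed[OF N_subgroup] by (auto split: if_splits)
      show "w l = spot n (w l n)"
      proof
        fix m show "w l m = spot n (w l n) m"
          using wl[of l m] by (cases "m = n") (simp_all add: at_index_def)
      qed
    qed
    show "w l = \<zero>\<^bsub>Rees\<^esub>" if "l \<notin> {l. length l = length xs}" for l
      using wl[of l] that by (auto simp: fun_eq_iff)
  qed (use rees.finite_bool_lists in blast)+
qed

section \<open>Degrees along words of operators\<close>

definition total :: "('j \<Rightarrow> nat) \<Rightarrow> int" where
  "total n = (\<Sum>j\<in>J. int (n j))"

lemma total_Suc: "j \<in> J \<Longrightarrow> total (n(j := Suc (n j))) = total n + 1"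
proof -
  assume j: "j \<in> J"
  have "total (n(j := Suc (n j))) = (\<Sum>i\<in>J. int (n i) + (if i = j then 1 else 0))"
    unfolding total_def by (rule sum.cong) auto
  also have "\<dots> = total n + 1" using j J by (simp add: sum.distrib total_def)
  finally show ?thesis .
qed

text \<open>The invariant of words: a homogeneous cocycle that respects the linear bound or is a
  coboundary. The second alternative persists under further operators, since they commute with
  \<open>kd\<close>.\<close>

definition good :: "int \<Rightarrow> int \<Rightarrow> (bool list \<Rightarrow> ('j \<Rightarrow> nat) \<Rightarrow> 'm) \<Rightarrow> ('j \<Rightarrow> nat) \<Rightarrow> int \<Rightarrow> int \<Rightarrow> bool" where
  "good k k' w n i \<mu> \<longleftrightarrow> w \<in> K n i \<mu> \<and> kd w = \<zero>\<^bsub>Ch\<^esub> \<and> (\<mu> \<le> total n * k + k' \<or> w \<in> kd ` K n (i - 1) \<mu>)"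

lemma kd_zero: "kd \<zero>\<^bsub>Ch\<^esub> = \<zero>\<^bsub>Ch\<^esub>"
  by (rule rees.Ch.M.op_zero[OF rees.koszul_diff_additive[OF xs_carrier]])

lemma good_op:
  assumes g: "good k k' w n i \<mu>"
    and f: "additive_map Ch Ch f" "\<And>w. w \<in> carrier Ch \<Longrightarrow> kd (f w) = f (kd w)"
      "\<And>i \<mu> w. w \<in> K n i \<mu> \<Longrightarrow> f w \<in> K n' i (\<mu> + s)"
    and le: "\<mu> \<le> total n * k + k' \<Longrightarrow> \<mu> + s \<le> total n' * k + k'"
  shows "good k k' (f w) n' i (\<mu> + s)"
proof -
  have w: "w \<in> K n i \<mu>" "kd w = \<zero>\<^bsub>Ch\<^esub>" using g unfolding good_def by blast+
  have "kd (f w) = \<zero>\<^bsub>Ch\<^esub>" using f(2)[OF K_carrier[OF w(1)]] w(2) rees.Ch.M.op_zero[OF f(1)] by simp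
  moreover have "f w \<in> kd ` K n' (i - 1) (\<mu> + s)" if wB: "w \<in> kd ` K n (i - 1) \<mu>"
  proof -
    obtain b where b: "b \<in> K n (i - 1) \<mu>" "w = kd b" using wB by blast
    then have "f w = kd (f b)" using f(2)[OF K_carrier[OF b(1)]] by simp
    then show ?thesis using f(3)[OF b(1)] by blast
  qed
  ultimately show ?thesis unfolding good_def using f(3)[OF w(1)] le g[unfolded good_def] by blast
qed

lemma K_smult_zero:
  assumes "a \<in> degree_part A 0" "w \<in> K n i \<mu>" shows "a \<odot>\<^bsub>Ch\<^esub> w \<in> K n i (\<mu> + 0)"
  unfolding K_iff
proof (intro allI)
  fix l n'
  note a = degree_part_carrier[OF assms(1)]
  have "w l n' \<in> (if length l = length xs \<and> n' = n \<and> i = twist l then N n \<inter> component M (\<mu> + twist l) else {\<zero>\<^bsub>M\<^esub>})"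
    using assms(2) unfolding K_iff by blast
  then show "(a \<odot>\<^bsub>Ch\<^esub> w) l n' \<in> (if length l = length xs \<and> n' = n \<and> i = twist l then N n \<inter> component M (\<mu> + 0 + twist l) else {\<zero>\<^bsub>M\<^esub>})"
    using N_smult[OF a] smult_degree[OF assms(1)] a by (auto split: if_splits)
qed

lemma K_shift:
  assumes jf: "(j, f) \<in> fs" and w: "w \<in> K n i \<mu>"
  shows "chain_shift (j, f) w \<in> K (n(j := Suc (n j))) i (\<mu> + int (\<delta> (j, f)))"
  unfolding K_iff
proof (intro allI)
  fix l n'
  note f = fs_carrier[OF jf]
  have wl: "w l m \<in> (if length l = length xs \<and> m = n \<and> i = twist l then N n \<inter> component M (\<mu> + twist l) else {\<zero>\<^bsub>M\<^esub>})" for m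
    using w unfolding K_iff by blast
  show "chain_shift (j, f) w l n' \<in> (if length l = length xs \<and> n' = n(j := Suc (n j)) \<and> i = twist l
      then N (n(j := Suc (n j))) \<inter> component M (\<mu> + int (\<delta> (j, f)) + twist l) else {\<zero>\<^bsub>M\<^esub>})"
  proof (cases "length l = length xs \<and> n' = n(j := Suc (n j)) \<and> i = twist l")
    case True
    then have n': "n' j \<noteq> 0" "n'(j := n' j - 1) = n" using fun_upd_Suc_iff[of n' n j] by blast+
    have wn: "w l n \<in> N n" "w l n \<in> component M (\<mu> + twist l)" using wl[of n] True by auto
    have "f \<odot>\<^bsub>M\<^esub> w l n \<in> component M (int (\<delta> (j, f)) + (\<mu> + twist l))"
      by (rule smult_degree[OF fs(3)[OF jf] wn(2)])
    moreover have "int (\<delta> (j, f)) + (\<mu> + twist l) = \<mu> + int (\<delta> (j, f)) + twist l" by simp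
    ultimately show ?thesis
      unfolding if_P[OF True] chain_shift_def shift_mult_def using n' N_up[OF jf wn(1)] by simp
  next
    case False
    have "chain_shift (j, f) w l n' = \<zero>\<^bsub>M\<^esub>"
    proof (cases "n' j = 0")
      case nz: False
      then have "\<not> (length l = length xs \<and> n'(j := n' j - 1) = n \<and> i = twist l)"
        using False fun_upd_Suc_iff[of n' n j] by blast
      then have "w l (n'(j := n' j - 1)) = \<zero>\<^bsub>M\<^esub>" using wl[of "n'(j := n' j - 1)"] by (simp split: if_splits)
      then show ?thesis using nz f by (simp add: chain_shift_def shift_mult_def)
    qed (simp add: chain_shift_def shift_mult_def)
    then show ?thesis unfolding if_not_P[OF False] by simp
  qed
qed

text \<open>A scalar from A_0 keeps exponent and degree. A shift raises \<open>total n\<close> by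
  one and the degree by at most \<open>k\<close>, in step with the bound. A variable raises the
  degree at the same exponent, but its result is a coboundary, so the bound is not at stake.\<close>

lemma words_good:
  assumes k: "0 \<le> k" "\<And>j f. (j, f) \<in> fs \<Longrightarrow> int (\<delta> (j, f)) \<le> k"
    and S: "\<And>w. w \<in> S \<Longrightarrow> \<exists>n i \<mu>. good k k' w n i \<mu>"
    and w: "w \<in> words ops S"
  shows "\<exists>n i \<mu>. good k k' w n i \<mu>"
  using w
proof induction
  case (base s) then show ?case by (rule S)
next
  case (step w \<phi>)
  then obtain n i \<mu> where g: "good k k' w n i \<mu>" by blast
  then have wK: "w \<in> K n i \<mu>" "kd w = \<zero>\<^bsub>Ch\<^esub>" unfolding good_def by blast+
  from step.hyps(2) show ?case
  proof (cases rule: ops_cases)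
    case 1: (scalar a)
    note a = degree_part_carrier[OF 1(1)]
    have "good k k' (\<phi> w) n i (\<mu> + 0)"
      unfolding 1(2)
      by (rule good_op[OF g rees.chain_smult_additive[OF a] rees.koszul_diff_smult[OF xs_carrier a] K_smult_zero[OF 1(1)]]) auto
    then show ?thesis by blast
  next
    case 2: (variable x)
    note C = rees_part_subcomplex
    have "\<phi> w \<in> K n i (\<mu> + 1)" unfolding 2(2) by (rule rees.koszul_chains_smult[OF C 2(1) wK(1)])
    moreover have x: "x \<in> carrier A" using 2(1) xs_carrier by blast
    have "kd (\<phi> w) = \<zero>\<^bsub>Ch\<^esub>"
      unfolding 2(2) rees.koszul_diff_smult[OF xs_carrier x K_carrier[OF wK(1)]] wK(2) by (rule rees.Ch.smult_r_null[OF x])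
    \<comment> \<open>As \<open>w\<close> is a cocycle, the homotopy exhibits \<open>x w\<close> as
      the boundary of a chain of bidegree \<open>(i - 1, \<mu> + 1)\<close>, which is the second
      alternative of \<open>good\<close>.\<close>
    moreover have "\<phi> w = kd (koszul_homotopy Rees xs x w)"
      unfolding 2(2) using rees.koszul_homotopy_cocycle[OF C xs_carrier 2(1) wK] by simp
    moreover have "koszul_homotopy Rees xs x w \<in> K n (i - 1) (\<mu> + 1)"
      by (rule rees.koszul_homotopy_chains[OF C 2(1) wK(1)])
    ultimately have "good k k' (\<phi> w) n i (\<mu> + 1)" unfolding good_def by blast
    then show ?thesis by blast
  next
    case 3: (shift j f)
    have "good k k' (\<phi> w) (n(j := Suc (n j))) i (\<mu> + int (\<delta> (j, f)))"
      unfolding 3(2)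
    proof (rule good_op[OF g chain_shift_additive[OF 3(1)] _ K_shift[OF 3(1)]])
      fix w assume "w \<in> carrier Ch"
      then show "kd (chain_shift (j, f) w) = chain_shift (j, f) (kd w)"
        unfolding chain_shift_def
        by (intro rees.koszul_diff_map[OF xs_carrier shift_mult_additive[OF 3(1)]] shift_mult_smult[OF 3(1)])
          (use xs_carrier fs_carrier[OF 3(1)] in \<open>auto simp: shift_mult_def fun_eq_iff\<close>)
    next
      assume "\<mu> \<le> total n * k + k'"
      moreover have "total (n(j := Suc (n j))) = total n + 1" by (rule total_Suc[OF fs(2)[OF 3(1)]])
      ultimately show "\<mu> + int (\<delta> (j, f)) \<le> total (n(j := Suc (n j))) * k + k'"
        using k(2)[OF 3(1)] by (simp add: algebra_simps)
    qed
    then show ?thesis by blast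
  qed
qed

text \<open>Picks out of an arbitrary chain the part at exponent \<open>n\<close> and bidegree
  \<open>(i, \<mu>)\<close>. Additivity is enough to evaluate it on a sum of words term by
  term.\<close>

definition chain_proj ::
    "('j \<Rightarrow> nat) \<Rightarrow> int \<Rightarrow> int \<Rightarrow> (bool list \<Rightarrow> ('j \<Rightarrow> nat) \<Rightarrow> 'm) \<Rightarrow> bool list \<Rightarrow> ('j \<Rightarrow> nat) \<Rightarrow> 'm" where
  "chain_proj n i \<mu> w = (\<lambda>l n'. if length l = length xs \<and> n' = n \<and> i = twist l
     then ds_proj M (component M) (\<mu> + twist l) (w l n) else \<zero>\<^bsub>M\<^esub>)"

lemma chain_proj_additive: "additive_map Ch Ch (chain_proj n i \<mu>)"
  using M.ds_proj_additive[OF module_decomposition]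
  unfolding additive_map_def chain_proj_def by (auto simp: Pi_iff fun_eq_iff)

lemma chain_proj_K:
  assumes "w \<in> K n' i' \<mu>'"
  shows "chain_proj n i \<mu> w = (if n' = n \<and> i' = i \<and> \<mu>' = \<mu> then w else \<zero>\<^bsub>Ch\<^esub>)"
proof (intro ext)
  fix l m
  have wl: "w l m \<in> (if length l = length xs \<and> m = n' \<and> i' = twist l then N n' \<inter> component M (\<mu>' + twist l) else {\<zero>\<^bsub>M\<^esub>})" for m
    using assms unfolding K_iff by blast
  note p = M.ds_proj_component[OF module_decomposition]
  have p0: "ds_proj M (component M) \<nu> \<zero>\<^bsub>M\<^esub> = \<zero>\<^bsub>M\<^esub>" for \<nu>
    by (rule M.op_zero[OF M.ds_proj_additive[OF module_decomposition]])
  show "chain_proj n i \<mu> w l m = (if n' = n \<and> i' = i \<and> \<mu>' = \<mu> then w else \<zero>\<^bsub>Ch\<^esub>) l m"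
  proof (cases "length l = length xs \<and> m = n \<and> i = twist l")
    case True
    show ?thesis
    proof (cases "n' = n \<and> i' = i")
      case T2: True
      then have "w l n \<in> component M (\<mu>' + twist l)" using wl[of n] True by auto
      from p[OF this, of "\<mu> + twist l"] show ?thesis using True T2 by (simp add: chain_proj_def)
    next
      case False
      then have "w l n = \<zero>\<^bsub>M\<^esub>" using wl[of n] True by (auto split: if_splits)
      then show ?thesis using True False by (auto simp: chain_proj_def p0)
    qed
  next
    case False
    then have "w l m = \<zero>\<^bsub>M\<^esub>" if "n' = n" "i' = i" using wl[of m] that by (auto split: if_splits)
    then show ?thesis using False by (auto simp: chain_proj_def)
  qed
qed

text \<open>A homogeneous cocycle is a sum of words applied to finitely many homogeneous cocycles,
  and each word is \<open>good\<close>. In a multidegree beyond the bound all words that survive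
  projection are coboundaries, and so is their sum.\<close>

theorem koszul_vanishing:
  "\<exists>k k'. \<forall>n. supported n \<longrightarrow> (\<forall>i \<mu>. total n * k + k' < \<mu> \<longrightarrow> acyclic_at Ch kd (K n) i \<mu>)"
proof -
  \<comment> \<open>The homogeneous cocycles for all supported exponents and all bidegrees at once:
    one finite generating set for all of them makes the bound uniform in \<open>n\<close>.\<close>
  define S where "S = {w. \<exists>n i \<mu>. supported n \<and> w \<in> K n i \<mu> \<and> kd w = \<zero>\<^bsub>Ch\<^esub>}"
  have "S \<subseteq> op_span Ch ops gens" unfolding S_def using K_in_span by blast
  then obtain T where T: "T \<subseteq> S" "finite T" "S \<subseteq> op_span Ch ops T"
    using ops_noetherian unfolding op_noetherian_def by blast
  have "\<forall>w\<in>T. \<exists>\<mu>. \<exists>n i. w \<in> K n i \<mu> \<and> kd w = \<zero>\<^bsub>Ch\<^esub>" using T(1) unfolding S_def by blast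
  from bchoice[OF this] obtain d where d: "\<And>w. w \<in> T \<Longrightarrow> \<exists>n i. w \<in> K n i (d w) \<and> kd w = \<zero>\<^bsub>Ch\<^esub>" by blast
  \<comment> \<open>\<open>k\<close> is the largest degree of a generator in \<open>fs\<close>, and
    \<open>k'\<close> the largest degree of a chosen cocycle. Inserting 0 covers empty sets and
    makes \<open>k\<close> nonnegative, so that each chosen cocycle meets the bound at whatever
    exponent it sits.\<close>
  define k where "k = Max (insert 0 ((\<lambda>jf. int (\<delta> jf)) ` fs))"
  define k' where "k' = Max (insert 0 (d ` T))"
  have k: "0 \<le> k" "int (\<delta> jf) \<le> k" if "jf \<in> fs" for jf
    unfolding k_def using fs(1) that by (auto intro: Max_ge)
  have k0: "0 \<le> k" unfolding k_def using fs(1) by (auto intro: Max_ge)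
  have k': "d w \<le> k'" if "w \<in> T" for w unfolding k'_def using T(2) that by (auto intro: Max_ge)
  have tot: "0 \<le> total n * k" for n unfolding total_def using k0 by (simp add: sum_nonneg)
  have good: "\<exists>n i \<mu>. good k k' w n i \<mu>" if wT: "w \<in> T" for w
  proof -
    obtain n i where "w \<in> K n i (d w)" "kd w = \<zero>\<^bsub>Ch\<^esub>" using d[OF wT] by blast
    moreover have "d w \<le> total n * k + k'" using k'[OF wT] tot[of n] by linarith
    ultimately have "good k k' w n i (d w)" unfolding good_def by blast
    then show ?thesis by blast
  qed
  have Tc: "T \<subseteq> carrier Ch" using T(1) K_carrier unfolding S_def by blast
  have "acyclic_at Ch kd (K n) i \<mu>" if n: "supported n" and \<mu>: "total n * k + k' < \<mu>" for n i \<mu>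
    unfolding acyclic_at_def
  proof (intro ballI impI)
    fix e assume e: "e \<in> K n i \<mu>" "kd e = \<zero>\<^bsub>Ch\<^esub>"
    then have "e \<in> S" unfolding S_def using n by blast
    then have span: "e \<in> add_span Ch (words ops T)" using T(3) unfolding op_span_def by blast
    let ?B = "kd ` K n (i - 1) \<mu>"
    have zK: "\<zero>\<^bsub>Ch\<^esub> \<in> K n (i - 1) \<mu>" by (rule additive_subgroup.zero_closed[OF K_subgroup])
    note kda = rees.koszul_diff_additive[OF xs_carrier]
    have zB: "\<zero>\<^bsub>Ch\<^esub> \<in> ?B" using image_eqI[of "\<zero>\<^bsub>Ch\<^esub>" kd, OF kd_zero[symmetric] zK] .
    have B: "additive_subgroup ?B Ch"
    proof (rule rees.Ch.M.additive_subgroupI2[OF _ zB])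
      show "?B \<subseteq> carrier Ch" using additive_map_closed[OF kda] K_carrier by blast
    next
      fix x y assume "x \<in> ?B" "y \<in> ?B"
      then obtain a b where ab: "a \<in> K n (i - 1) \<mu>" "b \<in> K n (i - 1) \<mu>" "x = kd a" "y = kd b" by blast
      have "x \<oplus>\<^bsub>Ch\<^esub> y = kd (a \<oplus>\<^bsub>Ch\<^esub> b)"
        unfolding ab(3,4) by (rule additive_map_add[OF kda K_carrier[OF ab(1)] K_carrier[OF ab(2)], symmetric])
      then show "x \<oplus>\<^bsub>Ch\<^esub> y \<in> ?B" using additive_subgroup.a_closed[OF K_subgroup ab(1,2)] by blast
    next
      fix x assume "x \<in> ?B"
      then obtain a where a: "a \<in> K n (i - 1) \<mu>" "x = kd a" by blast
      have "\<ominus>\<^bsub>Ch\<^esub> x = kd (\<ominus>\<^bsub>Ch\<^esub> a)"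
        unfolding a(2) by (rule rees.Ch.M.op_neg[OF kda K_carrier[OF a(1)], symmetric])
      then show "\<ominus>\<^bsub>Ch\<^esub> x \<in> ?B" using rees.Ch.M.additive_subgroup_neg[OF K_subgroup a(1)] by blast
    qed
    \<comment> \<open>The words that make up \<open>e\<close> may have any exponent and bidegree.
      The projection fixes \<open>e\<close>, kills the words of another multidegree and fixes the
      rest, which are coboundaries because \<open>\<mu>\<close> exceeds the bound.\<close>
    have "chain_proj n i \<mu> e \<in> ?B"
    proof (rule rees.Ch.M.add_span_image[OF rees.Ch.M.words_carrier[OF operators_ops Tc] chain_proj_additive _ B span])
      fix w assume "w \<in> words ops T"
      then obtain n' i' \<mu>' where g: "good k k' w n' i' \<mu>'"
        using words_good[OF k0 k(2) good] by blast
      then have w: "w \<in> K n' i' \<mu>'" unfolding good_def by blast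
      show "chain_proj n i \<mu> w \<in> ?B"
      proof (cases "n' = n \<and> i' = i \<and> \<mu>' = \<mu>")
        case True
        then have "w \<in> ?B" using g \<mu> unfolding good_def by auto
        then show ?thesis unfolding chain_proj_K[OF w] if_P[OF True] .
      next
        case False
        then show ?thesis unfolding chain_proj_K[OF w] if_not_P[OF False] using zB by simp
      qed
    qed
    then have "e \<in> ?B" unfolding chain_proj_K[OF e(1)] by simp
    then show "\<exists>b\<in>K n (i - 1) \<mu>. kd b = e" by blast
  qed
  then show ?thesis by blast
qed

end

section \<open>Graded injective modules\<close>

lemma (in group) self_factor_trivial: "trivial_group (G Mod carrier G)"
proof -
  have "group (G Mod carrier G)" by (rule normal.factorgroup_is_group[OF normal_self])
  moreover have "carrier G #> x = carrier G" if "x \<in> carrier G" for x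
    by (rule coset_join2[OF that subgroup_self that])
  then have "carrier (G Mod carrier G) = {\<one>\<^bsub>G Mod carrier G\<^esub>}"
    unfolding FactGroup_def RCOSETS_def using one_closed by auto
  ultimately show ?thesis unfolding trivial_group_def by blast
qed

context cring
begin

lemma genideal_mono: "S \<subseteq> T \<Longrightarrow> T \<subseteq> carrier R \<Longrightarrow> Idl S \<subseteq> Idl T"
  using genideal_minimal[OF genideal_ideal] genideal_self by blast

text \<open>A Noetherian ring supplies some finite generating set \<open>T\<close>, but generators
  inside \<open>S\<close> are wanted, since these can be homogeneous. The union \<open>U\<close> of
  the ideals generated by finite subsets of \<open>S\<close> is an ideal containing
  \<open>S\<close>, so finitely many members of \<open>S\<close> generate all of
  \<open>T\<close>.\<close>

lemma finite_ideal_generators: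
  assumes noeth: "noetherian_ring R" and S: "S \<subseteq> carrier R"
  shows "\<exists>F\<subseteq>S. finite F \<and> Idl F = Idl S"
proof -
  define U where "U = {a. \<exists>F\<subseteq>S. finite F \<and> a \<in> Idl F}"
  have sub: "additive_subgroup (Idl F) R" if "F \<subseteq> S" for F
    using ideal.axioms(1)[OF genideal_ideal] that S by blast
  have "ideal U R"
  proof (rule idealI2)
    show "additive_subgroup U R"
    proof (rule additive_subgroupI2)
      show "U \<subseteq> carrier R" unfolding U_def using additive_subgroup.a_Hcarr[OF sub] by blast
      have "\<zero> \<in> Idl {}" by (rule additive_subgroup.zero_closed[OF sub]) simp
      then show "\<zero> \<in> U" unfolding U_def by blast
    next
      fix a b assume "a \<in> U" "b \<in> U"
      then obtain F F' where F: "F \<subseteq> S" "finite F" "a \<in> Idl F" "F' \<subseteq> S" "finite F'" "b \<in> Idl F'"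
        unfolding U_def by blast
      have "a \<in> Idl (F \<union> F')" "b \<in> Idl (F \<union> F')"
        using genideal_mono[of F "F \<union> F'"] genideal_mono[of F' "F \<union> F'"] F S by blast+
      then have "a \<oplus> b \<in> Idl (F \<union> F')" using additive_subgroup.a_closed[OF sub] F by blast
      then show "a \<oplus> b \<in> U" unfolding U_def using F by blast
    next
      fix a assume "a \<in> U"
      then show "\<ominus> a \<in> U" unfolding U_def using additive_subgroup_neg[OF sub] by blast
    qed
  next
    fix a x assume "a \<in> U" "x \<in> carrier R"
    then show "x \<otimes> a \<in> U" unfolding U_def using ideal.I_l_closed[OF genideal_ideal] S by blast
  qed
  moreover have "S \<subseteq> U"
  proof
    fix s assume s: "s \<in> S"
    then have "s \<in> Idl {s}" using genideal_self' S by blast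
    then show "s \<in> U" unfolding U_def using s by blast
  qed
  ultimately have SU: "Idl S \<subseteq> U" by (rule genideal_minimal)
  obtain T where T: "T \<subseteq> carrier R" "finite T" "Idl S = Idl T"
    using noetherian_ring.finetely_gen[OF noeth genideal_ideal[OF S]] by blast
  have "T \<subseteq> U" using genideal_self[OF T(1)] SU T(3) by blast
  with T(2) have "\<exists>F\<subseteq>S. finite F \<and> T \<subseteq> Idl F"
  proof (induction T)
    case empty then show ?case by blast
  next
    case (insert t T)
    then obtain F where F: "F \<subseteq> S" "finite F" "T \<subseteq> Idl F" by blast
    from insert.prems obtain F' where F': "F' \<subseteq> S" "finite F'" "t \<in> Idl F'"
      unfolding U_def by blast
    have "F \<union> F' \<subseteq> carrier R" using F F' S by blast
    then have "Idl F \<subseteq> Idl (F \<union> F')" "Idl F' \<subseteq> Idl (F \<union> F')" by (simp_all add: genideal_mono)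
    then have "insert t T \<subseteq> Idl (F \<union> F')" using F F' by blast
    then show ?case using F F' by (intro exI[of _ "F \<union> F'"]) simp
  qed
  then obtain F where F: "F \<subseteq> S" "finite F" "T \<subseteq> Idl F" by blast
  have "Idl S \<subseteq> Idl F" unfolding T(3) using genideal_minimal[OF genideal_ideal F(3)] F(1) S by blast
  with genideal_mono[OF F(1) S] F show ?thesis by blast
qed

text \<open>In a Noetherian ring the union of a nonempty chain of ideals belongs to the
  chain.\<close>

lemma ideal_sequence_stable:
  fixes I :: "nat \<Rightarrow> 'a set"
  assumes noeth: "noetherian_ring R" and I: "\<And>n. ideal (I n) R" "\<And>n. I n \<subseteq> I (Suc n)"
  shows "\<exists>N. \<forall>n. I n \<subseteq> I N"
proof -
  have mono: "I m \<subseteq> I n" if "m \<le> n" for m n by (rule lift_Suc_mono_le[of I, OF I(2) that])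
  have "\<Union>(range I) \<in> range I"
  proof (rule noetherian_ring.ideal_chain_is_trivial[OF noeth])
    have "I m \<subseteq> I n \<or> I n \<subseteq> I m" for m n
      using mono[of m n] mono[of n m] linear[of m n] by blast
    then show "subset.chain {I. ideal I R} (range I)"
      unfolding subset_chain_def using I(1) by blast
  qed simp
  then show ?thesis by blast
qed

end

section \<open>Shifts and graded submodules\<close>

lemma module_component_update:
  assumes "module A M" shows "module A (M\<lparr>component := c\<rparr>)"
  using assms
  by (simp add: module_def abelian_group_def abelian_group_axioms_def abelian_monoid_def module_axioms_def)

lemma internal_direct_sum_component_update:
  "internal_direct_sum (M\<lparr>component := c\<rparr>) H = internal_direct_sum M H"
  by (simp add: internal_direct_sum_def finsum_def)

text \<open>The definition of \<open>finsum\<close> refers to the carrier, so restricting the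
  carrier calls for a comparison of the two sums.\<close>

lemma finsum_subgroup:
  assumes G: "abelian_group G" and G': "abelian_group (G\<lparr>carrier := P\<rparr>)" and P: "P \<subseteq> carrier G"
    and f: "\<And>i. f i \<in> P"
  shows "finsum (G\<lparr>carrier := P\<rparr>) f S = finsum G f S"
proof -
  note m = abelian_group.axioms(1)[OF G] and m' = abelian_group.axioms(1)[OF G']
  have zero: "\<zero>\<^bsub>G\<lparr>carrier := P\<rparr>\<^esub> = \<zero>\<^bsub>G\<^esub>" and add: "x \<oplus>\<^bsub>G\<lparr>carrier := P\<rparr>\<^esub> y = x \<oplus>\<^bsub>G\<^esub> y" for x y
    by simp_all
  have fG: "f \<in> S \<rightarrow> carrier G" "f s \<in> carrier G" for S s using f P by auto
  have fG': "f \<in> S \<rightarrow> carrier (G\<lparr>carrier := P\<rparr>)" "f s \<in> carrier (G\<lparr>carrier := P\<rparr>)" for S s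
    using f by auto
  show ?thesis
  proof (induction S rule: infinite_finite_induct)
    case (infinite S)
    show ?case
      unfolding abelian_monoid.finsum_infinite[OF m infinite] abelian_monoid.finsum_infinite[OF m' infinite] zero ..
  next
    case empty
    show ?case unfolding abelian_monoid.finsum_empty[OF m] abelian_monoid.finsum_empty[OF m'] zero ..
  next
    case (insert s S)
    show ?case
      unfolding abelian_monoid.finsum_insert[OF m insert.hyps fG] abelian_monoid.finsum_insert[OF m' insert.hyps fG']
        insert.IH add ..
  qed
qed

context graded_module
begin

lemma graded_ring_self: "graded_ring A" ..

text \<open>The regrading makes multiplication by an element of degree 1 a degree-preserving map
  into the shift, so that graded injectivity can be applied to it.\<close>

lemma shifted_graded_module: "graded_module A (M\<lparr>component := (\<lambda>\<nu>. component M (\<nu> + 1))\<rparr>)"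
proof -
  let ?H = "component M" and ?H' = "\<lambda>\<nu>. component M (\<nu> + 1)"
  have shift: "ds_decomp M ?H' x (\<lambda>\<nu>. c (\<nu> + 1))" if c: "ds_decomp M ?H x c" for x c
  proof -
    let ?S = "{\<nu>. c (\<nu> + 1) \<noteq> \<zero>\<^bsub>M\<^esub>}"
    have H: "\<And>i. c i \<in> ?H i" "finite {i. c i \<noteq> \<zero>\<^bsub>M\<^esub>}" "x = (\<Oplus>\<^bsub>M\<^esub>i\<in>{i. c i \<noteq> \<zero>\<^bsub>M\<^esub>}. c i)"
      using c unfolding ds_decomp_def by blast+
    have im: "{i. c i \<noteq> \<zero>\<^bsub>M\<^esub>} = (\<lambda>\<nu>. \<nu> + 1) ` ?S"
      by (auto intro!: image_eqI[where x = "_ - 1"])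
    have inj: "inj_on (\<lambda>\<nu> :: int. \<nu> + 1) ?S" by simp
    have cM: "c \<in> (\<lambda>\<nu>. \<nu> + 1) ` ?S \<rightarrow> carrier M" using H(1) component_carrier by blast
    have "finite ?S" using H(2) unfolding im by (rule finite_imageD[OF _ inj])
    moreover have "x = (\<Oplus>\<^bsub>M\<^esub>\<nu>\<in>?S. c (\<nu> + 1))"
      using H(3) M.finsum_reindex[OF cM inj] unfolding im by simp
    ultimately show ?thesis unfolding ds_decomp_def using H(1) by blast
  qed
  have unshift: "ds_decomp M ?H x (\<lambda>\<nu>. c (\<nu> - 1))" if c: "ds_decomp M ?H' x c" for x c
  proof -
    let ?S = "{\<nu>. c \<nu> \<noteq> \<zero>\<^bsub>M\<^esub>}"
    have H: "\<And>i. c i \<in> ?H (i + 1)" "finite ?S" "x = (\<Oplus>\<^bsub>M\<^esub>i\<in>?S. c i)"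
      using c unfolding ds_decomp_def by blast+
    have im: "{\<nu>. c (\<nu> - 1) \<noteq> \<zero>\<^bsub>M\<^esub>} = (\<lambda>\<nu>. \<nu> + 1) ` ?S"
      by (auto intro!: image_eqI[where x = "_ - 1"])
    have inj: "inj_on (\<lambda>\<nu> :: int. \<nu> + 1) ?S" by simp
    have cM: "(\<lambda>\<nu>. c (\<nu> - 1)) \<in> (\<lambda>\<nu>. \<nu> + 1) ` ?S \<rightarrow> carrier M" using H(1) component_carrier by auto
    have "c (\<nu> - 1) \<in> ?H \<nu>" for \<nu> using H(1)[of "\<nu> - 1"] by simp
    moreover have "x = (\<Oplus>\<^bsub>M\<^esub>\<nu>\<in>{\<nu>. c (\<nu> - 1) \<noteq> \<zero>\<^bsub>M\<^esub>}. c (\<nu> - 1))"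
      using H(3) M.finsum_reindex[OF cM inj] unfolding im by simp
    moreover have "finite {\<nu>. c (\<nu> - 1) \<noteq> \<zero>\<^bsub>M\<^esub>}" unfolding im using H(2) by blast
    ultimately show ?thesis unfolding ds_decomp_def by blast
  qed
  have "internal_direct_sum M ?H'"
    unfolding internal_direct_sum_iff
  proof (intro conjI allI ballI)
    show "additive_subgroup (?H' i) M" for i by (rule component_subgroup)
    fix x assume x: "x \<in> carrier M"
    show "\<exists>!c. ds_decomp M ?H' x c"
    proof (rule ex1I)
      show "ds_decomp M ?H' x (\<lambda>\<nu>. ds_proj M ?H (\<nu> + 1) x)"
        by (rule shift[OF M.ds_decomp_proj[OF module_decomposition x]])
      fix c assume "ds_decomp M ?H' x c"
      then have "ds_proj M ?H i x = c (i - 1)" for i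
        using M.ds_proj_eq[OF module_decomposition x unshift] by simp
      then show "c = (\<lambda>\<nu>. ds_proj M ?H (\<nu> + 1) x)" by simp
    qed
  qed
  then have "graded_module_axioms A (M\<lparr>component := ?H'\<rparr>)"
    unfolding graded_module_axioms_def internal_direct_sum_component_update
    using smult_degree by (auto simp: add.assoc)
  then show ?thesis
    by (intro graded_module.intro graded_ring_self module_component_update[OF module_axioms])
qed

lemma graded_submodule_graded_module:
  assumes P: "submodule P A M" and proj: "\<And>x \<nu>. x \<in> P \<Longrightarrow> ds_proj M (component M) \<nu> x \<in> P"
  shows "graded_module A (graded_submodule M P)"
proof -
  let ?H' = "\<lambda>\<nu>. P \<inter> component M \<nu>" and ?N = "M\<lparr>carrier := P\<rparr>"
  have mod: "module A ?N" by (rule submodule.submodule_is_module[OF P module_axioms])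
  then have gN: "abelian_group ?N" by (rule module.axioms(2))
  have PM: "P \<subseteq> carrier M" using submoduleE(1)[OF P] .
  have Pg: "additive_subgroup P M" by (rule additive_subgroupI[OF submodule.axioms(1)[OF P]])
  interpret N: abelian_group ?N by (rule gN)
  have "internal_direct_sum ?N ?H'"
    unfolding internal_direct_sum_iff
  proof (intro conjI allI ballI)
    have neg: "\<ominus>\<^bsub>?N\<^esub> x = \<ominus>\<^bsub>M\<^esub> x" if x: "x \<in> P" for x
      by (rule N.minus_equality)
        (use x PM M.additive_subgroup_neg[OF Pg x] M.l_neg in auto)
    show "additive_subgroup (?H' i) ?N" for i
    proof (rule N.additive_subgroupI2)
      fix x assume "x \<in> ?H' i"
      then show "\<ominus>\<^bsub>?N\<^esub> x \<in> ?H' i"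
        using neg M.additive_subgroup_neg[OF Pg] M.additive_subgroup_neg[OF component_subgroup] by auto
    qed (use additive_subgroup.zero_closed[OF Pg] additive_subgroup.zero_closed[OF component_subgroup]
        additive_subgroup.a_closed[OF Pg] additive_subgroup.a_closed[OF component_subgroup] in auto)
    fix x assume "x \<in> carrier ?N"
    then have x: "x \<in> P" "x \<in> carrier M" using PM by auto
    note d = M.ds_decomp_proj[OF module_decomposition x(2)]
    have zero: "\<zero>\<^bsub>?N\<^esub> = \<zero>\<^bsub>M\<^esub>" by simp
    note sum = finsum_subgroup[OF M.abelian_group_axioms gN PM]
    show "\<exists>!c. ds_decomp ?N ?H' x c"
    proof (rule ex1I)
      show "ds_decomp ?N ?H' x (\<lambda>\<nu>. ds_proj M (component M) \<nu> x)"
        unfolding ds_decomp_def zero sum[where f = "\<lambda>\<nu>. ds_proj M (component M) \<nu> x", OF proj[OF x(1)]]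
        using d[unfolded ds_decomp_def] proj[OF x(1)] by blast
      fix c assume c: "ds_decomp ?N ?H' x c"
      then have cP: "c i \<in> P" for i unfolding ds_decomp_def by blast
      have "ds_decomp M (component M) x c"
        using c unfolding ds_decomp_def zero sum[where f = c, OF cP] by blast
      then show "c = (\<lambda>\<nu>. ds_proj M (component M) \<nu> x)"
        using M.ds_proj_eq[OF module_decomposition x(2)] by simp
    qed
  qed
  then have "graded_module_axioms A (?N\<lparr>component := ?H'\<rparr>)"
    unfolding graded_module_axioms_def internal_direct_sum_component_update
    using smult_degree submoduleE(4)[OF P] degree_part_carrier by auto
  moreover have "graded_submodule M P = ?N\<lparr>component := ?H'\<rparr>" unfolding graded_submodule_def by simp
  ultimately show ?thesis
    using graded_module.intro[OF graded_ring_self module_component_update[OF mod]] by simp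
qed

definition cyclic :: "'m \<Rightarrow> 'm set" where
  "cyclic p = {a \<odot>\<^bsub>M\<^esub> p | a. a \<in> carrier A}"

lemma cyclicI: "a \<in> carrier A \<Longrightarrow> a \<odot>\<^bsub>M\<^esub> p \<in> cyclic p"
  unfolding cyclic_def by blast

lemma cyclic_submodule:
  assumes p: "p \<in> carrier M" shows "submodule (cyclic p) A M"
proof (rule submoduleI)
  show "cyclic p \<subseteq> carrier M" unfolding cyclic_def using p by blast
  show "\<zero>\<^bsub>M\<^esub> \<in> cyclic p" using cyclicI[of "\<zero>\<^bsub>A\<^esub>" p] p by simp
next
  fix x assume "x \<in> cyclic p"
  then obtain a where a: "a \<in> carrier A" "x = a \<odot>\<^bsub>M\<^esub> p" unfolding cyclic_def by blast
  then have "\<ominus>\<^bsub>M\<^esub> x = (\<ominus>\<^bsub>A\<^esub> a) \<odot>\<^bsub>M\<^esub> p" using p by (simp add: smult_l_minus)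
  then show "\<ominus>\<^bsub>M\<^esub> x \<in> cyclic p" using cyclicI[of "\<ominus>\<^bsub>A\<^esub> a" p] a(1) by simp
next
  fix x y assume "x \<in> cyclic p" "y \<in> cyclic p"
  then obtain a b where a: "a \<in> carrier A" "x = a \<odot>\<^bsub>M\<^esub> p" and b: "b \<in> carrier A" "y = b \<odot>\<^bsub>M\<^esub> p"
    unfolding cyclic_def by blast
  then have "x \<oplus>\<^bsub>M\<^esub> y = (a \<oplus>\<^bsub>A\<^esub> b) \<odot>\<^bsub>M\<^esub> p" using p by (simp add: smult_l_distr)
  then show "x \<oplus>\<^bsub>M\<^esub> y \<in> cyclic p" using cyclicI[of "a \<oplus>\<^bsub>A\<^esub> b" p] a(1) b(1) by simp
next
  fix b x assume b: "b \<in> carrier A" and "x \<in> cyclic p"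
  then obtain a where a: "a \<in> carrier A" "x = a \<odot>\<^bsub>M\<^esub> p" unfolding cyclic_def by blast
  then have "b \<odot>\<^bsub>M\<^esub> x = (b \<otimes>\<^bsub>A\<^esub> a) \<odot>\<^bsub>M\<^esub> p" using p b by (simp add: smult_assoc1)
  then show "b \<odot>\<^bsub>M\<^esub> x \<in> cyclic p" using cyclicI[OF m_closed[OF b a(1)]] by simp
qed

text \<open>As \<open>p\<close> is homogeneous, the components of \<open>a p\<close> are the
  components of \<open>a\<close> times \<open>p\<close>, so \<open>A p\<close> contains the
  components of its elements.\<close>

lemma cyclic_graded_module:
  assumes p: "p \<in> component M \<mu>"
  shows "graded_module A (graded_submodule M (cyclic p))"
proof (rule graded_submodule_graded_module)
  note pc = component_carrier[OF p]
  show sub: "submodule (cyclic p) A M" by (rule cyclic_submodule[OF pc])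
  have cg: "additive_subgroup (cyclic p) M" by (rule additive_subgroupI[OF submodule.axioms(1)[OF sub]])
  note pr = M.ds_proj_additive[OF module_decomposition]
  let ?K = "{a \<in> carrier A. \<forall>\<nu>. ds_proj M (component M) \<nu> (a \<odot>\<^bsub>M\<^esub> p) \<in> cyclic p}"
  have ag: "abelian_group A" by (rule ring.axioms(1)[OF ring_axioms])
  have "carrier A \<subseteq> ?K"
  proof (rule abelian_group.ds_induct[OF ag decomposition])
    show "additive_subgroup ?K A"
    proof (rule abelian_group.additive_subgroupI2[OF ag])
      show "\<zero>\<^bsub>A\<^esub> \<in> ?K"
        using additive_subgroup.zero_closed[OF cg] M.op_zero[OF pr] pc by simp
    next
      fix a b assume "a \<in> ?K" "b \<in> ?K"
      then show "a \<oplus>\<^bsub>A\<^esub> b \<in> ?K"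
        using additive_subgroup.a_closed[OF cg] additive_map_add[OF pr] pc by (simp add: smult_l_distr)
    next
      fix a assume "a \<in> ?K"
      then show "\<ominus>\<^bsub>A\<^esub> a \<in> ?K"
        using M.additive_subgroup_neg[OF cg] M.op_neg[OF pr] pc by (simp add: smult_l_minus)
    qed blast
    fix n show "degree_part A n \<subseteq> ?K"
    proof
      fix a assume a: "a \<in> degree_part A n"
      note ac = degree_part_carrier[OF a]
      have "ds_proj M (component M) \<nu> (a \<odot>\<^bsub>M\<^esub> p) \<in> cyclic p" for \<nu>
        using M.ds_proj_component[OF module_decomposition smult_degree[OF a p]]
          additive_subgroup.zero_closed[OF cg] cyclicI[OF ac] by simp
      then show "a \<in> ?K" using ac by blast
    qed
  qed
  then show "ds_proj M (component M) \<nu> x \<in> cyclic p" if "x \<in> cyclic p" for x \<nu>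
    using that unfolding cyclic_def[of p] by blast
qed

end

lemma graded_hom_additive: "f \<in> graded_hom A M N \<Longrightarrow> additive_map M N f"
  unfolding graded_hom_def additive_map_def by blast

lemma graded_hom_smult: "f \<in> graded_hom A M N \<Longrightarrow> a \<in> carrier A \<Longrightarrow> x \<in> carrier M \<Longrightarrow> f (a \<odot>\<^bsub>M\<^esub> x) = a \<odot>\<^bsub>N\<^esub> f x"
  unfolding graded_hom_def by blast

lemma graded_hom_component: "f \<in> graded_hom A M N \<Longrightarrow> x \<in> component M \<mu> \<Longrightarrow> f x \<in> component N \<mu>"
  unfolding graded_hom_def by blast

text \<open>Let \<open>l\<close> be so large that multiplication by \<open>x\<close> is injective on \<open>P = A x\<^sup>l q\<close>. The inclusion
  of \<open>P\<close> extends along \<open>x : P \<rightarrow> Q(1)\<close> to a map \<open>h : Q(1) \<rightarrow> Q\<close>, and \<open>c = h q\<close> works.\<close>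

lemma graded_injective_divisible:
  fixes Q :: "('a, 'u) graded_module"
  assumes inj: "graded_injective A Q" and noeth: "noetherian_ring A"
    and x: "x \<in> degree_part A 1" and q: "q \<in> component Q (\<mu> + 1)"
  shows "\<exists>c\<in>component Q \<mu>. (\<exists>l. ((\<lambda>q. x \<odot>\<^bsub>Q\<^esub> q) ^^ Suc l) c = ((\<lambda>q. x \<odot>\<^bsub>Q\<^esub> q) ^^ l) q) \<and>
    (\<forall>a\<in>carrier A. a \<odot>\<^bsub>Q\<^esub> q = \<zero>\<^bsub>Q\<^esub> \<longrightarrow> a \<odot>\<^bsub>Q\<^esub> c = \<zero>\<^bsub>Q\<^esub>)"
proof -
  interpret graded_module A Q using inj unfolding graded_injective_def by blast
  let ?x = "\<lambda>q. x \<odot>\<^bsub>Q\<^esub> q"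
  note qc = component_carrier[OF q] and xc = degree_part_carrier[OF x]
  note xa = smult_additive_map[OF xc]
  note xp = M.additive_map_power[OF xa]
  have com: "(?x ^^ n) (a \<odot>\<^bsub>Q\<^esub> z) = a \<odot>\<^bsub>Q\<^esub> ((?x ^^ n) z)" if "a \<in> carrier A" "z \<in> carrier Q" for a n z
    unfolding smult_power[OF xc smult_closed[OF that]] smult_power[OF xc that(2)]
    using that xc nat_pow_closed[OF xc] m_comm[OF nat_pow_closed[OF xc] that(1)] by (simp add: smult_assoc1[symmetric])
  \<comment> \<open>The annihilators of \<open>x^n q\<close> increase with \<open>n\<close> and
    become stationary; the stage \<open>l\<close> where this happens is the exponent in the
    conclusion.\<close>
  define I where "I n = {a \<in> carrier A. (?x ^^ n) (a \<odot>\<^bsub>Q\<^esub> q) = \<zero>\<^bsub>Q\<^esub>}" for n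
  have "ideal (I n) A" for n
  proof (rule idealI2)
    show "additive_subgroup (I n) A"
      unfolding I_def
      by (rule abelian_group.additive_subgroupI2[OF ring.axioms(1)[OF ring_axioms]])
        (use qc M.op_zero[OF xp] M.op_neg[OF xp] additive_map_add[OF xp] in \<open>simp_all add: smult_l_distr smult_l_minus subset_iff\<close>)
    fix a b assume "a \<in> I n" "b \<in> carrier A"
    then show "b \<otimes>\<^bsub>A\<^esub> a \<in> I n" unfolding I_def using qc com by (simp add: smult_assoc1)
  qed
  moreover have "I n \<subseteq> I (Suc n)" for n unfolding I_def using smult_r_null[OF xc] by auto
  ultimately obtain l where l: "\<And>n. I n \<subseteq> I l"
    using ideal_sequence_stable[OF noeth, of I] by blast
  define p where "p = (?x ^^ l) q"
  have pw: "(?x ^^ n) q \<in> component Q (\<mu> + 1 + int n)" for n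
  proof (induction n)
    case (Suc n)
    have "?x ((?x ^^ n) q) \<in> component Q (int 1 + (\<mu> + 1 + int n))" by (rule smult_degree[OF x Suc])
    then show ?case by (simp add: ac_simps)
  qed (use q in simp)
  have p: "p \<in> component Q (\<mu> + 1 + int l)" unfolding p_def by (rule pw)
  note pc = component_carrier[OF p]
  let ?P = "graded_submodule Q (cyclic p)"
  let ?Q1 = "Q\<lparr>component := (\<lambda>\<nu>. component Q (\<nu> + 1))\<rparr>"
  have Pc: "cyclic p \<subseteq> carrier Q" using submoduleE(1)[OF cyclic_submodule[OF pc]] .
  have xhom: "?x \<in> graded_hom A ?P ?Q1"
    unfolding graded_hom_def graded_submodule_def
  proof (simp, intro conjI ballI allI)
    show "?x \<in> cyclic p \<rightarrow> carrier Q" using Pc xc by blast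
    fix z assume z: "z \<in> cyclic p"
    show "x \<odot>\<^bsub>Q\<^esub> (z \<oplus>\<^bsub>Q\<^esub> w) = x \<odot>\<^bsub>Q\<^esub> z \<oplus>\<^bsub>Q\<^esub> x \<odot>\<^bsub>Q\<^esub> w" if "w \<in> cyclic p" for w
      using Pc z that xc by (intro smult_r_distr) auto
  next
    fix a z assume a: "a \<in> carrier A" and z: "z \<in> cyclic p"
    show "x \<odot>\<^bsub>Q\<^esub> (a \<odot>\<^bsub>Q\<^esub> z) = a \<odot>\<^bsub>Q\<^esub> (x \<odot>\<^bsub>Q\<^esub> z)"
      using com[OF a, of z 1] z Pc by auto
  next
    fix \<nu>
    have "x \<odot>\<^bsub>Q\<^esub> z \<in> component Q (\<nu> + 1)" if "z \<in> component Q \<nu>" for z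
      using smult_degree[OF x that] by (simp add: add.commute)
    then show "?x ` (cyclic p \<inter> component Q \<nu>) \<subseteq> component Q (\<nu> + 1)" by blast
  qed
  have incl: "(\<lambda>z. z) \<in> graded_hom A ?P Q"
    unfolding graded_hom_def graded_submodule_def using Pc by auto
  \<comment> \<open>If \<open>x\<close> kills \<open>z = a x^l q\<close>, then \<open>a\<close>
    annihilates \<open>x^(l+1) q\<close>, hence already \<open>x^l q\<close>, and
    \<open>z = 0\<close>.\<close>
  have "inj_on ?x (carrier ?P)"
  proof -
    have "?x z = \<zero>\<^bsub>Q\<^esub> \<Longrightarrow> z = \<zero>\<^bsub>Q\<^esub>" if z: "z \<in> cyclic p" for z
    proof -
      assume xz: "?x z = \<zero>\<^bsub>Q\<^esub>"
      obtain a where a: "a \<in> carrier A" "z = a \<odot>\<^bsub>Q\<^esub> p" using z unfolding cyclic_def by blast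
      have zl: "z = (?x ^^ l) (a \<odot>\<^bsub>Q\<^esub> q)" unfolding a(2) p_def com[OF a(1) qc] ..
      then have "a \<in> I (Suc l)" unfolding I_def using a(1) xz by simp
      then have "a \<in> I l" using l by blast
      then show "z = \<zero>\<^bsub>Q\<^esub>" unfolding zl I_def by blast
    qed
    moreover have "z = w" if "z \<in> cyclic p" "w \<in> cyclic p" "?x z = ?x w"
      "z \<ominus>\<^bsub>Q\<^esub> w \<in> cyclic p \<Longrightarrow> ?x (z \<ominus>\<^bsub>Q\<^esub> w) = \<zero>\<^bsub>Q\<^esub> \<Longrightarrow> z \<ominus>\<^bsub>Q\<^esub> w = \<zero>\<^bsub>Q\<^esub>" for z w
    proof -
      have c: "z \<in> carrier Q" "w \<in> carrier Q" using that Pc by blast+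
      have "z \<ominus>\<^bsub>Q\<^esub> w \<in> cyclic p"
        by (rule M.additive_subgroup_minus[OF additive_subgroupI[OF submodule.axioms(1)[OF cyclic_submodule[OF pc]]] that(1,2)])
      moreover have "?x (z \<ominus>\<^bsub>Q\<^esub> w) = \<zero>\<^bsub>Q\<^esub>"
        using M.op_minus[OF xa c] that(3) M.diff_self[OF smult_closed[OF xc c(2)]] by simp
      ultimately show "z = w" using that(4) M.diff_eq_zero_iff[OF c] by blast
    qed
    ultimately show ?thesis unfolding inj_on_def graded_submodule_def by simp
  qed
  then obtain h where h: "h \<in> graded_hom A ?Q1 Q" "\<And>z. z \<in> carrier ?P \<Longrightarrow> h (?x z) = z"
    using inj[unfolded graded_injective_def, THEN conjunct2, rule_format, of ?P ?Q1 ?x "\<lambda>z. z"]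
      cyclic_graded_module[OF p] shifted_graded_module xhom incl by blast
  have hs: "h (a \<odot>\<^bsub>Q\<^esub> z) = a \<odot>\<^bsub>Q\<^esub> h z" if "a \<in> carrier A" "z \<in> carrier Q" for a z
    using graded_hom_smult[OF h(1) that(1)] that(2) by simp
  have hc: "h z \<in> carrier Q" if "z \<in> carrier Q" for z
    using additive_map_closed[OF graded_hom_additive[OF h(1)]] that by simp
  \<comment> \<open>As \<open>h\<close> is linear and \<open>h (x p) = p\<close>, this gives
    \<open>x^(l+1) (h q) = p = x^l q\<close>. Linearity also shows that whatever annihilates
    \<open>q\<close> annihilates \<open>h q\<close>.\<close>
  have hx: "h ((?x ^^ n) q) = (?x ^^ n) (h q)" for n
    unfolding smult_power[OF xc qc] smult_power[OF xc hc[OF qc]] by (rule hs[OF nat_pow_closed[OF xc] qc])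
  have "p \<in> carrier ?P"
    using cyclicI[OF one_closed, of p] pc unfolding graded_submodule_def by simp
  then have "h (?x p) = p" by (rule h(2))
  then have "(?x ^^ Suc l) (h q) = (?x ^^ l) q" using hx[of "Suc l"] unfolding p_def by simp
  moreover have "h q \<in> component Q \<mu>" using graded_hom_component[OF h(1), of q \<mu>] q by simp
  moreover have "a \<odot>\<^bsub>Q\<^esub> h q = \<zero>\<^bsub>Q\<^esub>" if "a \<in> carrier A" "a \<odot>\<^bsub>Q\<^esub> q = \<zero>\<^bsub>Q\<^esub>" for a
  proof -
    have "h \<zero>\<^bsub>Q\<^esub> = \<zero>\<^bsub>A\<^esub> \<odot>\<^bsub>Q\<^esub> h q" using hs[of "\<zero>\<^bsub>A\<^esub>" q] qc by simp
    then have "h \<zero>\<^bsub>Q\<^esub> = \<zero>\<^bsub>Q\<^esub>" using hc[OF qc] by simp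
    then show ?thesis using hs[OF that(1) qc] that(2) by simp
  qed
  ultimately show ?thesis by blast
qed

section \<open>Torsion with respect to the irrelevant ideal\<close>

context graded_module
begin

text \<open>An element of \<open>A\<close> is a polynomial in \<open>X1\<close> over A_0, and its
  components of positive degree only involve monomials with a factor from \<open>X1\<close>. Hence
  A_+ may be tested on the variables of the Koszul complex.\<close>

lemma irrelevant_ideal_subset:
  assumes xs: "X1 \<subseteq> degree_part A 1" and gen: "generate_ring A (degree_part A 0 \<union> X1) = carrier A"
  shows "irrelevant_ideal A \<subseteq> Idl\<^bsub>A\<^esub> X1"
proof -
  have ag: "abelian_group A" by (rule ring.axioms(1)[OF ring_axioms])
  have X1c: "X1 \<subseteq> carrier A" using xs degree_part_carrier by blast
  let ?K = "Idl\<^bsub>A\<^esub> X1" and ?p = "ds_proj A (degree_part A)"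
  have K: "ideal ?K A" by (rule genideal_ideal[OF X1c])
  have Kg: "additive_subgroup ?K A" by (rule ideal.axioms(1)[OF K])
  note pr = abelian_group.ds_proj_additive[OF ag decomposition]
  note pm = abelian_group.ds_proj_mem[OF ag decomposition]
  note pc = abelian_group.ds_proj_component[OF ag decomposition]
  note p0 = additive_map_zero[OF ag ag pr] and pn = additive_map_neg[OF ag ag pr] and pa = additive_map_add[OF pr]
  define Y where "Y = {a \<in> carrier A. \<forall>n\<ge>1. ?p n a \<in> ?K}"
  have Yx: "x \<otimes>\<^bsub>A\<^esub> a \<in> Y" if x: "x \<in> X1" and a: "a \<in> carrier A" for x a
  proof -
    have xc: "x \<in> carrier A" using x X1c by blast
    have xK: "x \<otimes>\<^bsub>A\<^esub> b \<in> ?K" if "b \<in> carrier A" for b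
      using ideal.I_r_closed[OF K _ that] genideal_self[OF X1c] x by blast
    let ?L = "{a \<in> carrier A. \<forall>n. ?p n (x \<otimes>\<^bsub>A\<^esub> a) \<in> ?K}"
    have "carrier A \<subseteq> ?L"
    proof (rule abelian_group.ds_induct[OF ag decomposition])
      show "additive_subgroup ?L A"
      proof (rule abelian_group.additive_subgroupI2[OF ag])
        show "\<zero>\<^bsub>A\<^esub> \<in> ?L" using additive_subgroup.zero_closed[OF Kg] p0 xc by simp
      next
        fix a b assume "a \<in> ?L" "b \<in> ?L"
        then show "a \<oplus>\<^bsub>A\<^esub> b \<in> ?L" using additive_subgroup.a_closed[OF Kg] pa xc by (simp add: r_distr)
      next
        fix a assume "a \<in> ?L"
        then show "\<ominus>\<^bsub>A\<^esub> a \<in> ?L" using abelian_group.additive_subgroup_neg[OF ag Kg] pn xc by (simp add: r_minus)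
      qed blast
      fix m show "degree_part A m \<subseteq> ?L"
      proof
        fix b assume b: "b \<in> degree_part A m"
        note bc = degree_part_carrier[OF b]
        have "x \<otimes>\<^bsub>A\<^esub> b \<in> degree_part A (1 + m)" using mult_degree[OF _ b] x xs by blast
        then have "?p n (x \<otimes>\<^bsub>A\<^esub> b) \<in> ?K" for n
          using pc xK[OF bc] additive_subgroup.zero_closed[OF Kg] by simp
        then show "b \<in> ?L" using bc by blast
      qed
    qed
    then show ?thesis unfolding Y_def using a xc by blast
  qed
  have Y0: "b \<otimes>\<^bsub>A\<^esub> a \<in> Y" if b: "b \<in> degree_part A 0" and a: "a \<in> Y" for b a
  proof -
    note bc = degree_part_carrier[OF b]
    have ac: "a \<in> carrier A" using a unfolding Y_def by blast
    have "additive_map A A (\<lambda>a. b \<otimes>\<^bsub>A\<^esub> a)" unfolding additive_map_def using bc by (auto simp: r_distr)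
    from ds_proj_natural[OF ag decomposition ag decomposition this _ ac]
    have "?p n (b \<otimes>\<^bsub>A\<^esub> a) = b \<otimes>\<^bsub>A\<^esub> ?p n a" for n using mult_degree[OF b] by auto
    then show ?thesis using a bc ac ideal.I_l_closed[OF K] unfolding Y_def by auto
  qed
  \<comment> \<open>\<open>Y\<close> is not visibly closed under products, so the induction over the
    generated ring shows that \<open>h\<close> multiplies \<open>Y\<close> into \<open>Y\<close>;
    applied to 1 this gives \<open>h\<close> in \<open>Y\<close>.\<close>
  have "\<forall>a\<in>Y. h \<otimes>\<^bsub>A\<^esub> a \<in> Y" if "h \<in> generate_ring A (degree_part A 0 \<union> X1)" for h
    using that
  proof induction
    case one then show ?case unfolding Y_def by auto
  next
    case (incl h) then show ?case using Y0 Yx unfolding Y_def by blast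
  next
    case (a_inv h)
    then have h: "h \<in> carrier A" using gen by simp
    show ?case
    proof
      fix a assume a: "a \<in> Y"
      then have ac: "a \<in> carrier A" unfolding Y_def by blast
      have "h \<otimes>\<^bsub>A\<^esub> a \<in> Y" using a_inv a by blast
      then show "(\<ominus>\<^bsub>A\<^esub> h) \<otimes>\<^bsub>A\<^esub> a \<in> Y"
        unfolding Y_def l_minus[OF h ac] using pn abelian_group.additive_subgroup_neg[OF ag Kg] by auto
    qed
  next
    case (eng_add h1 h2)
    then have h: "h1 \<in> carrier A" "h2 \<in> carrier A" using gen by auto
    show ?case
    proof
      fix a assume a: "a \<in> Y"
      then have ac: "a \<in> carrier A" unfolding Y_def by blast
      have "h1 \<otimes>\<^bsub>A\<^esub> a \<in> Y" "h2 \<otimes>\<^bsub>A\<^esub> a \<in> Y" using eng_add a by blast+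
      then show "(h1 \<oplus>\<^bsub>A\<^esub> h2) \<otimes>\<^bsub>A\<^esub> a \<in> Y"
        unfolding Y_def l_distr[OF h ac] using pa additive_subgroup.a_closed[OF Kg] by auto
    qed
  next
    case (eng_mult h1 h2)
    then have h: "h1 \<in> carrier A" "h2 \<in> carrier A" using gen by auto
    show ?case
    proof
      fix a assume a: "a \<in> Y"
      then have ac: "a \<in> carrier A" unfolding Y_def by blast
      show "(h1 \<otimes>\<^bsub>A\<^esub> h2) \<otimes>\<^bsub>A\<^esub> a \<in> Y" unfolding m_assoc[OF h ac] using eng_mult a by blast
    qed
  qed
  moreover have "\<one>\<^bsub>A\<^esub> \<in> Y"
    unfolding Y_def using pc[OF one_degree] additive_subgroup.zero_closed[OF Kg] by auto
  ultimately have AY: "h \<in> Y" if "h \<in> carrier A" for h using that gen r_one[OF that] by metis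
  show ?thesis
    unfolding irrelevant_ideal_def
  proof (rule genideal_minimal[OF K])
    show "(\<Union>n\<in>{0<..}. degree_part A n) \<subseteq> ?K"
    proof
      fix a assume "a \<in> (\<Union>n\<in>{0<..}. degree_part A n)"
      then obtain n where "0 < n" and n2: "a \<in> degree_part A n" by blast
      then have n: "1 \<le> n" "a \<in> degree_part A n" by simp_all
      have "?p n a \<in> ?K" using AY[OF degree_part_carrier[OF n(2)]] n(1) unfolding Y_def by blast
      then show "a \<in> ?K" using pc[OF n(2)] by simp
    qed
  qed
qed

lemma irrelevant_ideal_ideal: "ideal (irrelevant_ideal A) A"
  unfolding irrelevant_ideal_def by (rule genideal_ideal) (use degree_part_carrier in blast)

lemma ideal_power: "ideal I A \<Longrightarrow> ideal (I [^]\<^bsub>ideals_set A\<^esub> (n :: nat)) A"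
  using monoid.nat_pow_closed[OF comm_monoid.axioms(1)[OF ideals_set_is_comm_monoid], of I n]
  by (simp add: ideals_set_def)

lemma ideal_power_Suc: "I [^]\<^bsub>ideals_set A\<^esub> Suc n = (I [^]\<^bsub>ideals_set A\<^esub> n) \<cdot>\<^bsub>A\<^esub> I"
  by (simp add: ideals_set_def nat_pow_def)

text \<open>Pigeonhole on exponents as an induction on \<open>k\<close>: the last factor of a
  product in the power \<open>k + 1\<close> of A_+ is reduced to some \<open>x\<close> in
  \<open>X1\<close>, and \<open>x q\<close> satisfies the hypotheses with the exponent of
  \<open>x\<close> lowered by one.\<close>

lemma power_torsion_irrelevant:
  assumes X1: "finite X1" "X1 \<subseteq> degree_part A 1" and gen: "generate_ring A (degree_part A 0 \<union> X1) = carrier A"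
    and q: "q \<in> carrier M" "\<And>x. x \<in> X1 \<Longrightarrow> ((\<lambda>q. x \<odot>\<^bsub>M\<^esub> q) ^^ m x) q = \<zero>\<^bsub>M\<^esub>" "(\<Sum>x\<in>X1. m x) \<le> k"
    and a: "a \<in> irrelevant_ideal A [^]\<^bsub>ideals_set A\<^esub> Suc k"
  shows "a \<odot>\<^bsub>M\<^esub> q = \<zero>\<^bsub>M\<^esub>"
  using q a
proof (induction k arbitrary: q m a rule: less_induct)
  case (less k q m a)
  let ?I = "irrelevant_ideal A"
  let ?P = "?I [^]\<^bsub>ideals_set A\<^esub> k"
  note P = ideal_power[OF irrelevant_ideal_ideal, of k]
  have Pc: "u \<in> carrier A" if "u \<in> ?P" for u using ideal.Icarr[OF P that] .
  have X1c: "X1 \<subseteq> carrier A" using X1(2) degree_part_carrier by blast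
  note qc = less.prems(1)
  define V where "V = {v \<in> carrier A. \<forall>u\<in>?P. u \<odot>\<^bsub>M\<^esub> (v \<odot>\<^bsub>M\<^esub> q) = \<zero>\<^bsub>M\<^esub>}"
  have V: "ideal V A"
  proof (rule idealI2)
    show "additive_subgroup V A"
    proof (rule abelian_group.additive_subgroupI2[OF ring.axioms(1)[OF ring_axioms]])
      show "V \<subseteq> carrier A" unfolding V_def by blast
      show "\<zero>\<^bsub>A\<^esub> \<in> V" unfolding V_def using qc Pc by simp
    next
      fix v w assume "v \<in> V" "w \<in> V"
      then show "v \<oplus>\<^bsub>A\<^esub> w \<in> V" unfolding V_def using qc Pc by (simp add: smult_l_distr smult_r_distr)
    next
      fix v assume "v \<in> V"
      then show "\<ominus>\<^bsub>A\<^esub> v \<in> V"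
        unfolding V_def using qc Pc M.op_neg[OF smult_additive_map] M.op_zero[OF smult_additive_map[OF one_closed]]
        by (simp add: smult_l_minus smult_r_minus)
    qed
  next
    fix v b assume v: "v \<in> V" and b: "b \<in> carrier A"
    have "u \<odot>\<^bsub>M\<^esub> ((b \<otimes>\<^bsub>A\<^esub> v) \<odot>\<^bsub>M\<^esub> q) = \<zero>\<^bsub>M\<^esub>" if u: "u \<in> ?P" for u
    proof -
      have vc: "v \<in> carrier A" using v unfolding V_def by blast
      have "u \<odot>\<^bsub>M\<^esub> ((b \<otimes>\<^bsub>A\<^esub> v) \<odot>\<^bsub>M\<^esub> q) = (u \<otimes>\<^bsub>A\<^esub> b) \<odot>\<^bsub>M\<^esub> (v \<odot>\<^bsub>M\<^esub> q)"
        using vc b Pc[OF u] qc by (simp add: smult_assoc1)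
      then show ?thesis using v ideal.I_r_closed[OF P u b] unfolding V_def by simp
    qed
    then show "b \<otimes>\<^bsub>A\<^esub> v \<in> V" using v b unfolding V_def by simp
  qed
  have "X1 \<subseteq> V"
  proof
    fix x assume x: "x \<in> X1"
    then have xc: "x \<in> carrier A" using X1c by blast
    have "u \<odot>\<^bsub>M\<^esub> (x \<odot>\<^bsub>M\<^esub> q) = \<zero>\<^bsub>M\<^esub>" if u: "u \<in> ?P" for u
    \<comment> \<open>Exponent 0 means \<open>q = 0\<close>. Otherwise the sum of the exponents is
      positive, so \<open>k\<close> is too, and the induction hypothesis for \<open>k - 1\<close>
      applies to \<open>x q\<close>.\<close>
    proof (cases "m x = 0")
      case True
      then have "q = \<zero>\<^bsub>M\<^esub>" using less.prems(2)[OF x] by simp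
      then show ?thesis using xc Pc[OF u] by simp
    next
      case False
      have mx: "m x \<le> (\<Sum>x\<in>X1. m x)" by (rule member_le_sum[OF x _ X1(1)]) simp
      then obtain k' where k': "k = Suc k'" using False less.prems(3) by (cases k) auto
      let ?m = "m(x := m x - 1)"
      have sum: "(\<Sum>y\<in>X1. ?m y) + 1 = (\<Sum>y\<in>X1. m y)"
        using False x X1(1) by (simp add: sum.remove[OF X1(1) x])
      show ?thesis
      proof (rule less.IH[of k'])
        show "k' < k" using k' by simp
        show "x \<odot>\<^bsub>M\<^esub> q \<in> carrier M" using xc qc by simp
        show "(\<Sum>y\<in>X1. ?m y) \<le> k'" using sum less.prems(3) k' by simp
        show "u \<in> ?I [^]\<^bsub>ideals_set A\<^esub> Suc k'" using u unfolding k' .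
        fix y assume y: "y \<in> X1"
        then have yc: "y \<in> carrier A" using X1c by blast
        show "((\<lambda>q. y \<odot>\<^bsub>M\<^esub> q) ^^ ?m y) (x \<odot>\<^bsub>M\<^esub> q) = \<zero>\<^bsub>M\<^esub>"
        proof (cases "y = x")
          case True
          have "((\<lambda>q. x \<odot>\<^bsub>M\<^esub> q) ^^ Suc (m x - 1)) q = \<zero>\<^bsub>M\<^esub>" using less.prems(2)[OF x] False by simp
          then show ?thesis using True by (simp add: funpow_swap1)
        next
          case ne: False
          then show ?thesis
            using smult_power_commute[OF xc yc qc, of "m y"] less.prems(2)[OF y] smult_r_null[OF xc] by simp
        qed
      qed
    qed
    then show "x \<in> V" unfolding V_def using xc by blast
  qed
  then have IV: "?I \<subseteq> V"
    using irrelevant_ideal_subset[OF X1(2) gen] genideal_minimal[OF V] by blast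
  have "a \<in> ?P \<cdot>\<^bsub>A\<^esub> ?I" using less.prems(4) unfolding ideal_power_Suc .
  then have "a \<in> carrier A \<and> a \<odot>\<^bsub>M\<^esub> q = \<zero>\<^bsub>M\<^esub>"
  proof induction
    case (prod u v)
    then have "v \<in> V" "u \<in> carrier A" using IV Pc by blast+
    then show ?case using prod(1) qc unfolding V_def by (simp add: smult_assoc1)
  next
    case (sum s1 s2)
    then show ?case using qc by (simp add: smult_l_distr)
  qed
  then show ?case by blast
qed

text \<open>Replaces torsion for powers of A_+, as in the definition of local cohomology, by torsion
  for each variable separately, as in \<open>torsion_part\<close>.\<close>

lemma torsion_functor_carrier:
  assumes X1: "finite X1" "X1 \<subseteq> degree_part A 1" and gen: "generate_ring A (degree_part A 0 \<union> X1) = carrier A"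
  shows "carrier (torsion_functor A (irrelevant_ideal A) M) =
    {q \<in> carrier M. \<forall>x\<in>X1. \<exists>m. ((\<lambda>q. x \<odot>\<^bsub>M\<^esub> q) ^^ m) q = \<zero>\<^bsub>M\<^esub>}"
proof -
  let ?I = "irrelevant_ideal A"
  have pow: "x [^]\<^bsub>A\<^esub> n \<in> ?I [^]\<^bsub>ideals_set A\<^esub> n" if x: "x \<in> X1" for x and n :: nat
  proof (induction n)
    case 0 show ?case by (simp add: ideals_set_def)
  next
    case (Suc n)
    have "x \<in> (\<Union>n\<in>{0<..}. degree_part A n)" using x X1(2) by auto
    then have "x \<in> ?I" unfolding irrelevant_ideal_def
      by (rule subsetD[OF genideal_self, rotated]) (use degree_part_carrier in blast)
    with Suc have "x [^]\<^bsub>A\<^esub> n \<otimes>\<^bsub>A\<^esub> x \<in> (?I [^]\<^bsub>ideals_set A\<^esub> n) \<cdot>\<^bsub>A\<^esub> ?I" by (rule ideal_prod.prod)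
    then show ?case unfolding ideal_power_Suc by simp
  qed
  have "(\<exists>n::nat. \<forall>a\<in>?I [^]\<^bsub>ideals_set A\<^esub> n. a \<odot>\<^bsub>M\<^esub> q = \<zero>\<^bsub>M\<^esub>) \<longleftrightarrow>
      (\<forall>x\<in>X1. \<exists>m. ((\<lambda>q. x \<odot>\<^bsub>M\<^esub> q) ^^ m) q = \<zero>\<^bsub>M\<^esub>)" (is "?L \<longleftrightarrow> ?R") if q: "q \<in> carrier M" for q
  proof
    assume ?L
    then obtain n :: nat where n: "\<forall>a\<in>?I [^]\<^bsub>ideals_set A\<^esub> n. a \<odot>\<^bsub>M\<^esub> q = \<zero>\<^bsub>M\<^esub>" by blast
    show ?R
    proof
      fix x assume x: "x \<in> X1"
      then have xc: "x \<in> carrier A" using X1(2) degree_part_carrier by blast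
      have "((\<lambda>q. x \<odot>\<^bsub>M\<^esub> q) ^^ n) q = \<zero>\<^bsub>M\<^esub>" unfolding smult_power[OF xc q] using n pow[OF x] by blast
      then show "\<exists>m. ((\<lambda>q. x \<odot>\<^bsub>M\<^esub> q) ^^ m) q = \<zero>\<^bsub>M\<^esub>" by blast
    qed
  next
    assume ?R
    from bchoice[OF this] obtain m where "\<And>x. x \<in> X1 \<Longrightarrow> ((\<lambda>q. x \<odot>\<^bsub>M\<^esub> q) ^^ m x) q = \<zero>\<^bsub>M\<^esub>" by blast
    from power_torsion_irrelevant[where m = m, OF X1 gen q this order_refl] show ?L by blast
  qed
  then show ?thesis unfolding torsion_functor_def graded_submodule_def by auto
qed

end

section \<open>Local cohomology and the Koszul complex\<close>

definition resolution_single :: "(nat \<Rightarrow> ('a, 'u, 'z) module_scheme) \<Rightarrow> nat \<Rightarrow> 'u \<Rightarrow> nat \<Rightarrow> 'u" where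
  "resolution_single Q j y = (\<lambda>k. if k = j then y else \<zero>\<^bsub>Q k\<^esub>)"

text \<open>The whole resolution as one differential on the product of its terms; nothing maps into
  term 0, whence the zero there.\<close>

definition resolution_diff ::
    "(nat \<Rightarrow> ('a, 'u, 'z) module_scheme) \<Rightarrow> (nat \<Rightarrow> 'u \<Rightarrow> 'u) \<Rightarrow> (nat \<Rightarrow> 'u) \<Rightarrow> nat \<Rightarrow> 'u" where
  "resolution_diff Q d g = (\<lambda>k. case k of 0 \<Rightarrow> \<zero>\<^bsub>Q 0\<^esub> | Suc j \<Rightarrow> d j (g j))"

definition resolution_part :: "(nat \<Rightarrow> ('a, 'u) graded_module) \<Rightarrow> int \<Rightarrow> int \<Rightarrow> (nat \<Rightarrow> 'u) set" where
  "resolution_part Q i \<mu> = {g. \<forall>k. g k \<in> (if i = int k then component (Q k) \<mu> else {\<zero>\<^bsub>Q k\<^esub>})}"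

text \<open>The image of \<open>E\<close> as a complex concentrated in degree 0. As a subcomplex of
  \<open>Q\<close> it allows exactness of the augmented resolution to be read as relative
  acyclicity.\<close>

definition augmentation_part ::
    "('a, 'm) graded_module \<Rightarrow> (nat \<Rightarrow> ('a, 'u) graded_module) \<Rightarrow> ('m \<Rightarrow> 'u) \<Rightarrow> int \<Rightarrow> int \<Rightarrow> (nat \<Rightarrow> 'u) set" where
  "augmentation_part E Q \<epsilon> i \<mu> =
     {g. \<forall>k. g k \<in> (if i = 0 \<and> k = 0 then \<epsilon> ` component E \<mu> else {\<zero>\<^bsub>Q k\<^esub>})}"

text \<open>Exactness of a resolution is stated for whole modules. Replacing a preimage by its
  component of degree \<open>\<mu>\<close> gives exactness degree by degree.\<close>

lemma graded_hom_proj: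
  assumes "graded_module A M" "graded_module A N" "f \<in> graded_hom A M N" "y \<in> carrier M" "f y \<in> component N \<mu>"
  shows "\<exists>y'\<in>component M \<mu>. f y' = f y"
proof -
  interpret M: graded_module A M by fact
  interpret N: graded_module A N by fact
  have "ds_proj N (component N) \<mu> (f y) = f (ds_proj M (component M) \<mu> y)"
    by (rule ds_proj_natural[OF M.M.abelian_group_axioms M.module_decomposition N.M.abelian_group_axioms
          N.module_decomposition graded_hom_additive[OF assms(3)] graded_hom_component[OF assms(3)] assms(4)])
  moreover have "ds_proj N (component N) \<mu> (f y) = f y"
    using N.M.ds_proj_component[OF N.module_decomposition assms(5)] by simp
  ultimately show ?thesis
    using M.M.ds_proj_mem[OF M.module_decomposition assms(4)] by metis
qed

lemma image_additive_subgroup: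
  assumes "abelian_group G" "abelian_group H" "additive_map G H f" "additive_subgroup S G"
  shows "additive_subgroup (f ` S) H"
proof (rule abelian_group.additive_subgroupI2[OF assms(2)])
  note c = additive_subgroup.a_Hcarr[OF assms(4)]
  show "f ` S \<subseteq> carrier H" using additive_map_closed[OF assms(3)] c by blast
  show "\<zero>\<^bsub>H\<^esub> \<in> f ` S"
    using image_eqI[of _ f, OF additive_map_zero[OF assms(1-3), symmetric] additive_subgroup.zero_closed[OF assms(4)]] .
next
  note c = additive_subgroup.a_Hcarr[OF assms(4)]
  fix x y assume "x \<in> f ` S" "y \<in> f ` S"
  then obtain a b where ab: "a \<in> S" "b \<in> S" "x = f a" "y = f b" by blast
  have "x \<oplus>\<^bsub>H\<^esub> y = f (a \<oplus>\<^bsub>G\<^esub> b)" unfolding ab using additive_map_add[OF assms(3) c[OF ab(1)] c[OF ab(2)]] by simp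
  then show "x \<oplus>\<^bsub>H\<^esub> y \<in> f ` S" using additive_subgroup.a_closed[OF assms(4) ab(1,2)] by blast
next
  note c = additive_subgroup.a_Hcarr[OF assms(4)]
  fix x assume "x \<in> f ` S"
  then obtain a where a: "a \<in> S" "x = f a" by blast
  have "\<ominus>\<^bsub>H\<^esub> x = f (\<ominus>\<^bsub>G\<^esub> a)" unfolding a using additive_map_neg[OF assms(1-3) c[OF a(1)]] by simp
  then show "\<ominus>\<^bsub>H\<^esub> x \<in> f ` S" using abelian_group.additive_subgroup_neg[OF assms(1,4) a(1)] by blast
qed

locale injective_resolution =
  fixes A :: "'a graded_ring" and E :: "('a, 'm) graded_module" and Q :: "nat \<Rightarrow> ('a, 'u) graded_module"
    and \<epsilon> :: "'m \<Rightarrow> 'u" and d :: "nat \<Rightarrow> 'u \<Rightarrow> 'u" and xs :: "'a list"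
  assumes resolution: "graded_injective_resolution A E Q \<epsilon> d"
    and noetherian: "noetherian_ring A"
    and xs: "set xs \<subseteq> degree_part A 1"
    and generators: "generate_ring A (degree_part A 0 \<union> set xs) = carrier A"
begin

lemma E_graded: "graded_module A E"
  and Q_injective: "graded_injective A (Q j)"
  and eps_hom: "\<epsilon> \<in> graded_hom A E (Q 0)"
  and eps_inj: "inj_on \<epsilon> (carrier E)"
  and d_hom: "d j \<in> graded_hom A (Q j) (Q (Suc j))"
  and eps_exact: "\<epsilon> ` carrier E = {x \<in> carrier (Q 0). d 0 x = \<zero>\<^bsub>Q 1\<^esub>}"
  and d_exact: "d j ` carrier (Q j) = {x \<in> carrier (Q (Suc j)). d (Suc j) x = \<zero>\<^bsub>Q (Suc (Suc j))\<^esub>}"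
proof -
  note r = resolution[unfolded graded_injective_resolution_def]
  show "graded_module A E" by (rule conjunct1[OF r])
  note r = conjunct2[OF r]
  show "graded_injective A (Q j)" by (rule spec[OF conjunct1[OF r]])
  note r = conjunct2[OF r]
  show "\<epsilon> \<in> graded_hom A E (Q 0)" by (rule conjunct1[OF r])
  note r = conjunct2[OF r]
  show "inj_on \<epsilon> (carrier E)" by (rule conjunct1[OF r])
  note r = conjunct2[OF r]
  show "d j \<in> graded_hom A (Q j) (Q (Suc j))" by (rule spec[OF conjunct1[OF r]])
  note r = conjunct2[OF r]
  show "\<epsilon> ` carrier E = {x \<in> carrier (Q 0). d 0 x = \<zero>\<^bsub>Q 1\<^esub>}" by (rule conjunct1[OF r])
  note r = conjunct2[OF r]
  show "d j ` carrier (Q j) = {x \<in> carrier (Q (Suc j)). d (Suc j) x = \<zero>\<^bsub>Q (Suc (Suc j))\<^esub>}"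
    by (rule spec[OF r])
qed

lemma Q_graded: "graded_module A (Q j)"
  by (rule conjunct1[OF Q_injective[unfolded graded_injective_def]])

sublocale E: graded_module A E by (rule E_graded)
sublocale Q: graded_module A "Q j" for j by (rule Q_graded)

lemma d_additive: "additive_map (Q j) (Q (Suc j)) (d j)"
  by (rule graded_hom_additive[OF d_hom])

lemma d_zero: "d j \<zero>\<^bsub>Q j\<^esub> = \<zero>\<^bsub>Q (Suc j)\<^esub>"
  by (rule additive_map_zero[OF Q.M.abelian_group_axioms Q.M.abelian_group_axioms d_additive])

lemma d_d: "x \<in> carrier (Q j) \<Longrightarrow> d (Suc j) (d j x) = \<zero>\<^bsub>Q (Suc (Suc j))\<^esub>"
  using d_exact[of j] by blast

lemma d_eps: "x \<in> carrier E \<Longrightarrow> d 0 (\<epsilon> x) = \<zero>\<^bsub>Q (Suc 0)\<^esub>"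
  using eps_exact by auto

lemma eps_additive: "additive_map E (Q 0) \<epsilon>"
  by (rule graded_hom_additive[OF eps_hom])

lemma eps_zero: "\<epsilon> \<zero>\<^bsub>E\<^esub> = \<zero>\<^bsub>Q 0\<^esub>"
  by (rule additive_map_zero[OF E.M.abelian_group_axioms Q.M.abelian_group_axioms eps_additive])

lemma eps_exact_component:
  assumes "z \<in> component (Q 0) \<mu>" "d 0 z = \<zero>\<^bsub>Q (Suc 0)\<^esub>"
  shows "z \<in> \<epsilon> ` component E \<mu>"
proof -
  have "z \<in> \<epsilon> ` carrier E" unfolding eps_exact using assms Q.component_carrier by simp
  then obtain e where e: "e \<in> carrier E" "z = \<epsilon> e" by (rule imageE)
  obtain e' where "e' \<in> component E \<mu>" "\<epsilon> e' = \<epsilon> e"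
    using graded_hom_proj[OF E_graded Q_graded eps_hom e(1)] assms(1) unfolding e(2) by metis
  then show ?thesis unfolding e(2) by (metis imageI)
qed

lemma d_exact_component:
  assumes "z \<in> component (Q (Suc j)) \<mu>" "d (Suc j) z = \<zero>\<^bsub>Q (Suc (Suc j))\<^esub>"
  shows "z \<in> d j ` component (Q j) \<mu>"
proof -
  have "z \<in> d j ` carrier (Q j)" unfolding d_exact using assms Q.component_carrier by simp
  then obtain y where y: "z = d j y" "y \<in> carrier (Q j)" by (rule imageE)
  obtain y' where "y' \<in> component (Q j) \<mu>" "d j y' = d j y"
    using graded_hom_proj[OF Q_graded Q_graded d_hom y(2)] assms(1) unfolding y(1) by metis
  then show ?thesis unfolding y(1) by (metis imageI)
qed

abbreviation "PQ \<equiv> prod_module Q"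
abbreviation "dQ \<equiv> resolution_diff Q d"

lemma dQ_simps [simp]: "dQ g 0 = \<zero>\<^bsub>Q 0\<^esub>" "dQ g (Suc j) = d j (g j)"
  by (simp_all add: resolution_diff_def)

lemma A_cring: "cring A" by (rule E.is_cring)

lemma Q_group: "abelian_group (Q j)" by (rule Q.M.abelian_group_axioms)

lemma Q_zero: "\<zero>\<^bsub>Q j\<^esub> \<in> carrier (Q j)" by (rule abelian_monoid.zero_closed[OF abelian_group.axioms(1)[OF Q_group]])

lemma smult_Q_zero: "a \<in> carrier A \<Longrightarrow> a \<odot>\<^bsub>Q j\<^esub> \<zero>\<^bsub>Q j\<^esub> = \<zero>\<^bsub>Q j\<^esub>" by (rule Q.smult_r_null)

lemma Q_zero_add: "\<zero>\<^bsub>Q j\<^esub> \<oplus>\<^bsub>Q j\<^esub> \<zero>\<^bsub>Q j\<^esub> = \<zero>\<^bsub>Q j\<^esub>"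
  by (rule abelian_monoid.l_zero[OF abelian_group.axioms(1)[OF Q_group] Q_zero])

lemma PQ_carrier: "g \<in> carrier PQ \<Longrightarrow> g j \<in> carrier (Q j)"
  unfolding prod_module_simps by (rule spec)

sublocale PQ: differential_module A PQ dQ
proof (intro differential_module.intro differential_module_axioms.intro)
  show "module A PQ" by (rule prod_module[OF A_cring Q.module_axioms])
  show "additive_map PQ PQ dQ"
    unfolding additive_map_def
  proof (intro conjI ballI funcsetI)
    fix g assume g: "g \<in> carrier PQ"
    show "dQ g \<in> carrier PQ"
      unfolding prod_module_simps
    proof
      fix k show "dQ g k \<in> carrier (Q k)"
      proof (cases k)
        case 0 show ?thesis unfolding 0 dQ_simps by (rule Q_zero)
      next
        case (Suc j) show ?thesis unfolding Suc dQ_simps by (rule additive_map_closed[OF d_additive PQ_carrier[OF g]])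
      qed
    qed
    fix h assume h: "h \<in> carrier PQ"
    show "dQ (g \<oplus>\<^bsub>PQ\<^esub> h) = dQ g \<oplus>\<^bsub>PQ\<^esub> dQ h"
    proof
      fix k show "dQ (g \<oplus>\<^bsub>PQ\<^esub> h) k = (dQ g \<oplus>\<^bsub>PQ\<^esub> dQ h) k"
      proof (cases k)
        case 0 show ?thesis unfolding 0 dQ_simps prod_module_simps Q_zero_add ..
      next
        case (Suc j)
        show ?thesis
          unfolding Suc dQ_simps prod_module_simps
          by (rule additive_map_add[OF d_additive PQ_carrier[OF g] PQ_carrier[OF h]])
      qed
    qed
  qed
  fix a g assume a: "a \<in> carrier A" and g: "g \<in> carrier PQ"
  show "dQ (a \<odot>\<^bsub>PQ\<^esub> g) = a \<odot>\<^bsub>PQ\<^esub> dQ g"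
  proof
    fix k show "dQ (a \<odot>\<^bsub>PQ\<^esub> g) k = (a \<odot>\<^bsub>PQ\<^esub> dQ g) k"
    proof (cases k)
      case 0 show ?thesis unfolding 0 dQ_simps prod_module_simps smult_Q_zero[OF a] ..
    next
      case (Suc j)
      show ?thesis
        unfolding Suc dQ_simps prod_module_simps by (rule graded_hom_smult[OF d_hom a PQ_carrier[OF g]])
    qed
  qed
next
  fix g assume g: "g \<in> carrier PQ"
  show "dQ (dQ g) = \<zero>\<^bsub>PQ\<^esub>"
  proof
    fix k show "dQ (dQ g) k = \<zero>\<^bsub>PQ\<^esub> k"
    proof (cases k)
      case 0 show ?thesis unfolding 0 dQ_simps prod_module_simps ..
    next
      case k: (Suc j)
      show ?thesis
      proof (cases j)
        case 0 show ?thesis unfolding k 0 dQ_simps prod_module_simps by (rule d_zero)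
      next
        case (Suc j')
        show ?thesis unfolding k Suc dQ_simps prod_module_simps by (rule d_d[OF PQ_carrier[OF g]])
      qed
    qed
  qed
qed

lemma Q_smult_xs: "x \<in> set xs \<Longrightarrow> y \<in> component (Q j) \<mu> \<Longrightarrow> x \<odot>\<^bsub>Q j\<^esub> y \<in> component (Q j) (\<mu> + 1)"
  using Q.smult_degree[of x 1 y j \<mu>] xs by (auto simp: add.commute)

lemma xs_carrier: "set xs \<subseteq> carrier A"
  using xs E.degree_part_carrier by blast

lemma resolution_part_subcomplex: "PQ.subcomplex (set xs) (resolution_part Q)"
  unfolding PQ.subcomplex_def
proof (intro conjI allI ballI)
  show "set xs \<subseteq> carrier A" by (rule xs_carrier)
  fix i \<mu>
  show "additive_subgroup (resolution_part Q i \<mu>) PQ"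
    unfolding resolution_part_def
  proof (rule prod_module_subgroup[OF Q_group])
    fix k
    have "additive_subgroup {\<zero>\<^bsub>Q k\<^esub>} (Q k)"
      by (rule abelian_group.additive_subgroupI2[OF Q_group]) auto
    then show "additive_subgroup (if i = int k then component (Q k) \<mu> else {\<zero>\<^bsub>Q k\<^esub>}) (Q k)"
      using Q.component_subgroup by simp
  qed
  fix c assume "c \<in> resolution_part Q i \<mu>"
  then have c: "c k \<in> (if i = int k then component (Q k) \<mu> else {\<zero>\<^bsub>Q k\<^esub>})" for k
    unfolding resolution_part_def by blast
  show "dQ c \<in> resolution_part Q (i + 1) \<mu>"
    unfolding resolution_part_def
  proof (intro CollectI allI)
    fix k show "dQ c k \<in> (if i + 1 = int k then component (Q k) \<mu> else {\<zero>\<^bsub>Q k\<^esub>})"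
    proof (cases k)
      case 0
      then show ?thesis using additive_subgroup.zero_closed[OF Q.component_subgroup] by simp
    next
      case (Suc j)
      then show ?thesis using c[of j] graded_hom_component[OF d_hom] d_zero by (auto split: if_splits)
    qed
  qed
  fix x assume x: "x \<in> set xs"
  then have xc: "x \<in> carrier A" using xs_carrier by blast
  show "x \<odot>\<^bsub>PQ\<^esub> c \<in> resolution_part Q i (\<mu> + 1)"
    unfolding resolution_part_def
  proof (intro CollectI allI)
    fix k show "(x \<odot>\<^bsub>PQ\<^esub> c) k \<in> (if i = int k then component (Q k) (\<mu> + 1) else {\<zero>\<^bsub>Q k\<^esub>})"
      using c[of k] Q_smult_xs[OF x] smult_Q_zero[OF xc] by (simp split: if_splits)
  qed
qed

lemma augmentation_part_subcomplex: "PQ.subcomplex (set xs) (augmentation_part E Q \<epsilon>)"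
  unfolding PQ.subcomplex_def
proof (intro conjI allI ballI)
  show "set xs \<subseteq> carrier A" by (rule xs_carrier)
  fix i \<mu>
  have im: "additive_subgroup (\<epsilon> ` component E \<mu>) (Q 0)" for \<mu>
    by (rule image_additive_subgroup[OF E.M.abelian_group_axioms Q_group eps_additive E.component_subgroup])
  have z: "additive_subgroup {\<zero>\<^bsub>Q k\<^esub>} (Q k)" for k
    by (rule abelian_group.additive_subgroupI2[OF Q_group]) auto
  show "additive_subgroup (augmentation_part E Q \<epsilon> i \<mu>) PQ"
    unfolding augmentation_part_def
  proof (rule prod_module_subgroup[OF Q_group])
    fix k
    show "additive_subgroup (if i = 0 \<and> k = 0 then \<epsilon> ` component E \<mu> else {\<zero>\<^bsub>Q k\<^esub>}) (Q k)"
      using im z by simp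
  qed
  fix c assume "c \<in> augmentation_part E Q \<epsilon> i \<mu>"
  then have c: "c k \<in> (if i = 0 \<and> k = 0 then \<epsilon> ` component E \<mu> else {\<zero>\<^bsub>Q k\<^esub>})" for k
    unfolding augmentation_part_def by blast
  have dc: "dQ c k = \<zero>\<^bsub>Q k\<^esub>" for k
  proof (cases k)
    case (Suc j)
    then show ?thesis using c[of j] d_zero d_eps E.component_carrier by (auto split: if_splits)
  qed simp
  show "dQ c \<in> augmentation_part E Q \<epsilon> (i + 1) \<mu>"
    unfolding augmentation_part_def using dc additive_subgroup.zero_closed[OF im] by auto
  fix x assume x: "x \<in> set xs"
  then have xc: "x \<in> carrier A" using xs_carrier by blast
  show "x \<odot>\<^bsub>PQ\<^esub> c \<in> augmentation_part E Q \<epsilon> i (\<mu> + 1)"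
    unfolding augmentation_part_def
  proof (intro CollectI allI)
    fix k show "(x \<odot>\<^bsub>PQ\<^esub> c) k \<in> (if i = 0 \<and> k = 0 then \<epsilon> ` component E (\<mu> + 1) else {\<zero>\<^bsub>Q k\<^esub>})"
    proof (cases "i = 0 \<and> k = 0")
      case True
      then obtain e where e: "e \<in> component E \<mu>" "c k = \<epsilon> e" using c[of k] by auto
      have "x \<odot>\<^bsub>E\<^esub> e \<in> component E (\<mu> + 1)"
        using E.smult_degree[OF _ e(1), of x 1] x xs by (auto simp: add.commute)
      moreover have "x \<odot>\<^bsub>Q k\<^esub> c k = \<epsilon> (x \<odot>\<^bsub>E\<^esub> e)"
        using graded_hom_smult[OF eps_hom xc E.component_carrier[OF e(1)]] e(2) True by simp
      ultimately show ?thesis using True by simp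
    next
      case False
      then show ?thesis using c[of k] smult_Q_zero[OF xc] by auto
    qed
  qed
qed

lemma augmentation_part_sub: "augmentation_part E Q \<epsilon> i \<mu> \<subseteq> resolution_part Q i \<mu>"
proof
  fix g assume g: "g \<in> augmentation_part E Q \<epsilon> i \<mu>"
  show "g \<in> resolution_part Q i \<mu>"
    unfolding resolution_part_def
  proof (intro CollectI allI)
    fix k
    have "g k \<in> (if i = 0 \<and> k = 0 then \<epsilon> ` component E \<mu> else {\<zero>\<^bsub>Q k\<^esub>})"
      using g unfolding augmentation_part_def by blast
    then show "g k \<in> (if i = int k then component (Q k) \<mu> else {\<zero>\<^bsub>Q k\<^esub>})"
      using graded_hom_component[OF eps_hom] additive_subgroup.zero_closed[OF Q.component_subgroup]
      by (auto split: if_splits)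
  qed
qed

abbreviation "single \<equiv> resolution_single Q"

lemma resolution_part_nat: "g \<in> resolution_part Q (int j) \<mu> \<longleftrightarrow> (\<exists>y\<in>component (Q j) \<mu>. g = single j y)"
proof
  assume g: "g \<in> resolution_part Q (int j) \<mu>"
  then have gk: "g k \<in> (if int j = int k then component (Q k) \<mu> else {\<zero>\<^bsub>Q k\<^esub>})" for k
    unfolding resolution_part_def by blast
  have "g = single j (g j)"
  proof
    fix k show "g k = single j (g j) k" using gk[of k] by (cases "k = j") (simp_all add: resolution_single_def)
  qed
  then show "\<exists>y\<in>component (Q j) \<mu>. g = single j y" using gk[of j] by auto
next
  assume "\<exists>y\<in>component (Q j) \<mu>. g = single j y"
  then obtain y where y: "y \<in> component (Q j) \<mu>" "g = single j y" by blast
  show "g \<in> resolution_part Q (int j) \<mu>"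
    unfolding resolution_part_def y(2) resolution_single_def using y(1) by simp
qed

lemma resolution_part_neg: "i < 0 \<Longrightarrow> g \<in> resolution_part Q i \<mu> \<Longrightarrow> g = \<zero>\<^bsub>PQ\<^esub>"
  unfolding resolution_part_def by (auto simp: fun_eq_iff)

lemma dQ_single: "dQ (single j y) = single (Suc j) (d j y)"
proof
  fix k show "dQ (single j y) k = single (Suc j) (d j y) k"
    using d_zero by (cases k) (simp_all add: resolution_single_def)
qed

lemma single_carrier: "y \<in> carrier (Q j) \<Longrightarrow> single j y \<in> carrier PQ"
  using Q_zero by (simp add: resolution_single_def)

lemma single_eq_zero: "single j y = \<zero>\<^bsub>PQ\<^esub> \<longleftrightarrow> y = \<zero>\<^bsub>Q j\<^esub>"
  by (auto simp: resolution_single_def fun_eq_iff)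

lemma single_inj: "single j y = single j z \<Longrightarrow> y = z"
  by (auto simp: resolution_single_def dest: fun_cong[of _ _ j])

lemma smult_single: "a \<in> carrier A \<Longrightarrow> a \<odot>\<^bsub>PQ\<^esub> single j y = single j (a \<odot>\<^bsub>Q j\<^esub> y)"
  using smult_Q_zero by (auto simp: resolution_single_def fun_eq_iff)

lemma smult_power_single:
  "a \<in> carrier A \<Longrightarrow> ((\<lambda>q. a \<odot>\<^bsub>PQ\<^esub> q) ^^ m) (single j y) = single j (((\<lambda>q. a \<odot>\<^bsub>Q j\<^esub> q) ^^ m) y)"
  by (induction m) (simp_all add: smult_single del: prod_module_simps)

text \<open>Exactness of the augmented resolution: in positive degree a cocycle is a boundary; in
  degree 0 it lies in the image of \<open>\<epsilon>\<close> and the correction is zero; in negative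
  degree there is nothing to correct.\<close>

lemma resolution_relatively_acyclic:
  "relatively_acyclic PQ dQ (resolution_part Q) (augmentation_part E Q \<epsilon>)"
  unfolding relatively_acyclic_def
proof (intro allI ballI impI)
  fix i \<mu> z assume z: "z \<in> resolution_part Q i \<mu>" and dz: "dQ z \<in> augmentation_part E Q \<epsilon> (i + 1) \<mu>"
  note C = PQ.subcomplexD(2)[OF resolution_part_subcomplex] and C' = PQ.subcomplexD(2)[OF augmentation_part_subcomplex]
  have zc: "z \<in> carrier PQ" by (rule additive_subgroup.a_Hcarr[OF C z])
  have in_part: "\<exists>q\<in>resolution_part Q (i - 1) \<mu>. z \<ominus>\<^bsub>PQ\<^esub> dQ q \<in> augmentation_part E Q \<epsilon> i \<mu>"
    if "z \<in> augmentation_part E Q \<epsilon> i \<mu>"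
  proof -
    have "z \<ominus>\<^bsub>PQ\<^esub> dQ \<zero>\<^bsub>PQ\<^esub> = z" unfolding PQ.D_zero by (rule PQ.M.diff_zero[OF zc])
    then show ?thesis using that additive_subgroup.zero_closed[OF C] by metis
  qed
  show "\<exists>q\<in>resolution_part Q (i - 1) \<mu>. z \<ominus>\<^bsub>PQ\<^esub> dQ q \<in> augmentation_part E Q \<epsilon> i \<mu>"
  proof (cases i rule: int_cases)
    case (neg n)
    then have "z = \<zero>\<^bsub>PQ\<^esub>" using resolution_part_neg[OF _ z] by simp
    then show ?thesis using in_part additive_subgroup.zero_closed[OF C'] by blast
  next
    case (nonneg j)
    obtain y where y: "y \<in> component (Q j) \<mu>" "z = single j y" using z unfolding nonneg resolution_part_nat by blast
    have "dQ z (Suc j) = \<zero>\<^bsub>Q (Suc j)\<^esub>"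
      using dz unfolding augmentation_part_def by (auto dest: spec[of _ "Suc j"])
    then have dy: "d j y = \<zero>\<^bsub>Q (Suc j)\<^esub>" unfolding y(2) by (simp add: resolution_single_def)
    show ?thesis
    proof (cases j)
      case 0
      then have "y \<in> \<epsilon> ` component E \<mu>" using eps_exact_component[of y \<mu>] y(1) dy by simp
      then have "z \<in> augmentation_part E Q \<epsilon> i \<mu>"
        unfolding augmentation_part_def y(2) resolution_single_def using 0 nonneg by simp
      then show ?thesis by (rule in_part)
    next
      case (Suc j')
      then obtain y' where y': "y' \<in> component (Q j') \<mu>" "y = d j' y'"
        using d_exact_component[of y j' \<mu>] y(1) dy by blast
      have "dQ (single j' y') = z" unfolding dQ_single y(2) Suc y'(2) ..
      then have "z \<ominus>\<^bsub>PQ\<^esub> dQ (single j' y') = \<zero>\<^bsub>PQ\<^esub>" using PQ.M.diff_self[OF zc] by simp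
      moreover have "single j' y' \<in> resolution_part Q (int j') \<mu>" unfolding resolution_part_nat using y'(1) by blast
      moreover have "i - 1 = int j'" using nonneg Suc by simp
      ultimately show ?thesis using additive_subgroup.zero_closed[OF C'] by metis
    qed
  qed
qed

lemma resolution_divisible: "PQ.divisible (set xs) (resolution_part Q)"
  unfolding PQ.divisible_def
proof (intro ballI allI)
  fix x i \<mu> b assume x: "x \<in> set xs" and b: "b \<in> resolution_part Q i (\<mu> + 1)"
  then have xc: "x \<in> carrier A" using xs_carrier by blast
  let ?p = "\<lambda>m. (\<lambda>q. x \<odot>\<^bsub>PQ\<^esub> q) ^^ m"
  show "\<exists>c\<in>resolution_part Q i \<mu>. (\<exists>l. ?p (Suc l) c = ?p l b) \<and>
      (\<forall>a\<in>carrier A. a \<odot>\<^bsub>PQ\<^esub> b = \<zero>\<^bsub>PQ\<^esub> \<longrightarrow> a \<odot>\<^bsub>PQ\<^esub> c = \<zero>\<^bsub>PQ\<^esub>)"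
  proof (cases i rule: int_cases)
    case (neg n)
    then have b0: "b = \<zero>\<^bsub>PQ\<^esub>" using resolution_part_neg[OF _ b] by simp
    have "?p (Suc 0) \<zero>\<^bsub>PQ\<^esub> = ?p 0 b" unfolding b0 using PQ.smult_r_null[OF xc] by (simp del: prod_module_simps)
    then show ?thesis
      unfolding b0 using additive_subgroup.zero_closed[OF PQ.subcomplexD(2)[OF resolution_part_subcomplex]] by blast
  next
    case (nonneg j)
    obtain y where y: "y \<in> component (Q j) (\<mu> + 1)" "b = single j y"
      using b unfolding nonneg resolution_part_nat by blast
    obtain c l where c: "c \<in> component (Q j) \<mu>"
      "((\<lambda>q. x \<odot>\<^bsub>Q j\<^esub> q) ^^ Suc l) c = ((\<lambda>q. x \<odot>\<^bsub>Q j\<^esub> q) ^^ l) y"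
      "\<forall>a\<in>carrier A. a \<odot>\<^bsub>Q j\<^esub> y = \<zero>\<^bsub>Q j\<^esub> \<longrightarrow> a \<odot>\<^bsub>Q j\<^esub> c = \<zero>\<^bsub>Q j\<^esub>"
      using graded_injective_divisible[OF Q_injective noetherian _ y(1), of x] x xs by blast
    have "?p (Suc l) (single j c) = ?p l b"
      unfolding y(2) smult_power_single[OF xc] c(2) ..
    moreover have "a \<odot>\<^bsub>PQ\<^esub> single j c = \<zero>\<^bsub>PQ\<^esub>" if "a \<in> carrier A" "a \<odot>\<^bsub>PQ\<^esub> b = \<zero>\<^bsub>PQ\<^esub>" for a
      using c(3) that unfolding y(2) smult_single[OF that(1)] single_eq_zero by blast
    moreover have "single j c \<in> resolution_part Q i \<mu>" unfolding nonneg resolution_part_nat using c(1) by blast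
    ultimately show ?thesis by blast
  qed
qed

section \<open>Torsion of the resolution and its cohomology\<close>

definition torsion_component :: "nat \<Rightarrow> int \<Rightarrow> 'u set" where
  "torsion_component j \<mu> =
     {y \<in> component (Q j) \<mu>. \<forall>x\<in>set xs. \<exists>m. ((\<lambda>q. x \<odot>\<^bsub>Q j\<^esub> q) ^^ m) y = \<zero>\<^bsub>Q j\<^esub>}"

lemma torsion_functor_component: "component (torsion_functor A (irrelevant_ideal A) (Q j)) \<mu> = torsion_component j \<mu>"
proof -
  have "component (torsion_functor A (irrelevant_ideal A) (Q j)) \<mu> =
      carrier (torsion_functor A (irrelevant_ideal A) (Q j)) \<inter> component (Q j) \<mu>"
    by (simp add: torsion_functor_def graded_submodule_def)
  then show ?thesis
    unfolding Q.torsion_functor_carrier[OF finite_set xs generators] torsion_component_def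
    using Q.component_carrier by blast
qed

lemma torsion_component_subgroup: "additive_subgroup (torsion_component j \<mu>) (Q j)"
proof -
  \<comment> \<open>With the zero differential a single term of the resolution is a differential
    module, so that its torsion is a subgroup by \<open>torsion_part_subcomplex\<close>.\<close>
  interpret Qj: differential_module A "Q j" "\<lambda>_. \<zero>\<^bsub>Q j\<^esub>"
    by (intro differential_module.intro differential_module_axioms.intro Q.module_axioms)
      (auto simp: additive_map_def smult_Q_zero)
  have "Qj.subcomplex (set xs) (\<lambda>_. component (Q j))"
    unfolding Qj.subcomplex_def using xs_carrier Q.component_subgroup Q_smult_xs
      additive_subgroup.zero_closed[OF Q.component_subgroup] by blast
  from Qj.subcomplexD(2)[OF Qj.torsion_part_subcomplex[OF this subset_refl]]
  show ?thesis unfolding torsion_part_def torsion_component_def .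
qed

lemma single_torsion_part:
  "single j y \<in> torsion_part PQ xs (resolution_part Q) (int j) \<mu> \<longleftrightarrow> y \<in> torsion_component j \<mu>"
proof -
  have "single j y \<in> resolution_part Q (int j) \<mu> \<longleftrightarrow> y \<in> component (Q j) \<mu>"
    unfolding resolution_part_nat using single_inj by blast
  moreover have "((\<lambda>q. x \<odot>\<^bsub>PQ\<^esub> q) ^^ m) (single j y) = \<zero>\<^bsub>PQ\<^esub> \<longleftrightarrow> ((\<lambda>q. x \<odot>\<^bsub>Q j\<^esub> q) ^^ m) y = \<zero>\<^bsub>Q j\<^esub>"
    if "x \<in> set xs" for x m
  proof -
    have xc: "x \<in> carrier A" using that xs_carrier by blast
    show ?thesis unfolding smult_power_single[OF xc] by (rule single_eq_zero)
  qed
  ultimately show ?thesis unfolding torsion_part_def torsion_component_def by blast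
qed

lemma d_torsion_component:
  assumes "y \<in> torsion_component j \<mu>" shows "d j y \<in> torsion_component (Suc j) \<mu>"
proof -
  have "dQ (single j y) \<in> torsion_part PQ xs (resolution_part Q) (int j + 1) \<mu>"
    by (rule PQ.subcomplexD(3)[OF PQ.torsion_part_subcomplex[OF resolution_part_subcomplex subset_refl]])
      (use assms single_torsion_part in blast)
  then have "single (Suc j) (d j y) \<in> torsion_part PQ xs (resolution_part Q) (int (Suc j)) \<mu>"
    unfolding dQ_single by (simp add: add.commute)
  then show ?thesis unfolding single_torsion_part .
qed

text \<open>Koszul vanishing passes from the image of \<open>E\<close> to \<open>Q\<close> by
  relative acyclicity, and from there to exactness of the torsion of \<open>Q\<close> by
  divisibility. The cohomology component is then a group modulo itself.\<close>

theorem cohomology_trivial: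
  assumes ac: "\<And>\<nu>. \<mu> \<le> \<nu> \<Longrightarrow> acyclic_at (chain_module PQ) (koszul_diff PQ dQ xs)
    (koszul_chains PQ (length xs) (augmentation_part E Q \<epsilon>)) (int i) \<nu>"
  shows "trivial_group (cohomology_component (\<lambda>j. torsion_functor A (irrelevant_ideal A) (Q j)) d i \<mu>)"
proof -
  let ?T = "\<lambda>j. torsion_functor A (irrelevant_ideal A) (Q j)"
  have "acyclic_at (chain_module PQ) (koszul_diff PQ dQ xs)
      (koszul_chains PQ (length xs) (torsion_part PQ [] (resolution_part Q))) (int i) \<nu>" if "\<mu> \<le> \<nu>" for \<nu>
  proof -
    have "torsion_part PQ [] (resolution_part Q) = resolution_part Q"
      unfolding torsion_part_def by (simp add: fun_eq_iff)
    then show ?thesis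
      using PQ.koszul_acyclic_transfer[OF resolution_part_subcomplex augmentation_part_subcomplex subset_refl
          resolution_relatively_acyclic augmentation_part_sub ac[OF that]] by simp
  qed
  from PQ.torsion_part_acyclic[OF resolution_part_subcomplex resolution_divisible subset_refl _ this]
  have acT: "acyclic_at PQ dQ (torsion_part PQ (rev xs @ []) (resolution_part Q)) (int i) \<mu>" by simp
  have "torsion_part PQ (rev xs @ []) (resolution_part Q) = torsion_part PQ xs (resolution_part Q)"
    unfolding torsion_part_def by (simp add: fun_eq_iff)
  with acT have acT: "acyclic_at PQ dQ (torsion_part PQ xs (resolution_part Q)) (int i) \<mu>" by simp
  define Z where "Z = {x \<in> torsion_component i \<mu>. d i x = \<zero>\<^bsub>Q (Suc i)\<^esub>}"
  define B where "B = (if i = 0 then {\<zero>\<^bsub>Q 0\<^esub>} else d (i - 1) ` torsion_component (i - 1) \<mu>)"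
  have Tzero: "\<zero>\<^bsub>Q j\<^esub> \<in> torsion_component j \<mu>" for j
    by (rule additive_subgroup.zero_closed[OF torsion_component_subgroup])
  have Tc: "x \<in> carrier (Q j)" if "x \<in> torsion_component j \<mu>" for x j
    by (rule additive_subgroup.a_Hcarr[OF torsion_component_subgroup that])
  have "Z \<subseteq> B"
  proof
    fix z assume z: "z \<in> Z"
    then have "single i z \<in> torsion_part PQ xs (resolution_part Q) (int i) \<mu>"
      unfolding single_torsion_part Z_def by blast
    moreover have "dQ (single i z) = \<zero>\<^bsub>PQ\<^esub>"
      unfolding dQ_single single_eq_zero using z unfolding Z_def by blast
    ultimately obtain b where b: "b \<in> torsion_part PQ xs (resolution_part Q) (int i - 1) \<mu>" "dQ b = single i z"
      using acyclic_atD[OF acT] by blast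
    then have bR: "b \<in> resolution_part Q (int i - 1) \<mu>" unfolding torsion_part_def by blast
    show "z \<in> B"
    \<comment> \<open>For \<open>i = 0\<close> the primitive sits in degree -1, where the complex is
      zero, so the cocycle itself vanishes. This matches the zero subgroup in
      \<open>cohomology_component\<close>.\<close>
    proof (cases i)
      case 0
      then have "b = \<zero>\<^bsub>PQ\<^esub>" using resolution_part_neg[OF _ bR] by simp
      then have "single i z = \<zero>\<^bsub>PQ\<^esub>" using b(2) PQ.D_zero by simp
      then show ?thesis unfolding single_eq_zero B_def using 0 by simp
    next
      case (Suc j)
      then have ij: "int i - 1 = int j" by simp
      obtain y where y: "b = single j y" using bR unfolding ij resolution_part_nat by blast
      have "y \<in> torsion_component j \<mu>" using b(1) unfolding ij y single_torsion_part .
      moreover have "z = d j y" using b(2) single_inj unfolding y dQ_single Suc by metis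
      ultimately show ?thesis unfolding B_def using Suc by simp
    qed
  qed
  moreover have "B \<subseteq> Z"
  proof (cases i)
    case 0
    then show ?thesis unfolding B_def Z_def using Tzero[of 0] d_zero[of 0] by simp
  next
    case (Suc j)
    then show ?thesis unfolding B_def Z_def using d_torsion_component d_d Tc by auto
  qed
  ultimately have ZB: "B = Z" by blast
  have sub: "additive_subgroup Z (Q i)"
  proof (rule abelian_group.additive_subgroupI2[OF Q_group])
    show "Z \<subseteq> carrier (Q i)" unfolding Z_def using Tc by blast
    show "\<zero>\<^bsub>Q i\<^esub> \<in> Z" unfolding Z_def using Tzero d_zero by blast
  next
    fix x y assume "x \<in> Z" "y \<in> Z"
    then show "x \<oplus>\<^bsub>Q i\<^esub> y \<in> Z"
      unfolding Z_def using additive_subgroup.a_closed[OF torsion_component_subgroup] additive_map_add[OF d_additive] Tc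
        abelian_monoid.l_zero[OF abelian_group.axioms(1)[OF Q_group] Q_zero] by simp
  next
    fix x assume x: "x \<in> Z"
    have "\<ominus>\<^bsub>Q (Suc i)\<^esub> \<zero>\<^bsub>Q (Suc i)\<^esub> = \<zero>\<^bsub>Q (Suc i)\<^esub>"
      by (rule abelian_group.neg_zero[OF Q_group])
    then show "\<ominus>\<^bsub>Q i\<^esub> x \<in> Z"
      using x unfolding Z_def using abelian_group.additive_subgroup_neg[OF Q_group torsion_component_subgroup]
        additive_map_neg[OF Q_group Q_group d_additive] Tc by simp
  qed
  let ?G = "add_monoid ((?T i)\<lparr>carrier := Z\<rparr>)"
  have "group ((add_monoid (Q i))\<lparr>carrier := Z\<rparr>)"
    by (rule subgroup.subgroup_is_group[OF additive_subgroup.a_subgroup[OF sub] abelian_group.a_group[OF Q_group]])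
  then have "group ?G" by (simp add: torsion_functor_def graded_submodule_def)
  then have "trivial_group (?G Mod carrier ?G)" by (rule group.self_factor_trivial)
  moreover have "cohomology_component ?T d i \<mu> = ?G Mod carrier ?G"
  proof -
    have z: "\<zero>\<^bsub>?T j\<^esub> = \<zero>\<^bsub>Q j\<^esub>" for j by (simp add: torsion_functor_def graded_submodule_def)
    show ?thesis
      unfolding cohomology_component_def torsion_functor_component z Z_def[symmetric] B_def[symmetric] A_FactGroup_def ZB
      by simp
  qed
  ultimately show ?thesis by simp
qed

end

section \<open>The regularity bound\<close>

context rees_module
begin

text \<open>The vanishing was obtained in the product over all exponents, while
  \<open>cohomology_trivial\<close> needs it inside a resolution of \<open>N n\<close>. The map
  \<open>\<theta>\<close> takes the value at \<open>n\<close> and applies \<open>\<epsilon>\<close>;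
  being injective on \<open>H\<close> it identifies the two complexes, so a cocycle is lifted,
  bounded and mapped back.\<close>

lemma koszul_transfer:
  assumes res: "injective_resolution A (graded_submodule M (N n)) Q \<epsilon> d xs"
    and ac: "acyclic_at Ch kd (K n) i \<mu>"
  shows "acyclic_at (chain_module (prod_module Q)) (koszul_diff (prod_module Q) (resolution_diff Q d) xs)
    (koszul_chains (prod_module Q) (length xs) (augmentation_part (graded_submodule M (N n)) Q \<epsilon>)) i \<mu>"
proof -
  let ?E = "graded_submodule M (N n)"
  interpret R: injective_resolution A ?E Q \<epsilon> d xs by (rule res)
  have E: "carrier ?E = N n" "\<And>\<mu>. component ?E \<mu> = N n \<inter> component M \<mu>" "\<zero>\<^bsub>?E\<^esub> = \<zero>\<^bsub>M\<^esub>"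
    "\<And>x y. x \<oplus>\<^bsub>?E\<^esub> y = x \<oplus>\<^bsub>M\<^esub> y" "\<And>a x. a \<odot>\<^bsub>?E\<^esub> x = a \<odot>\<^bsub>M\<^esub> x"
    unfolding graded_submodule_def by simp_all
  \<comment> \<open>\<open>\<epsilon>\<close> is known to be linear on \<open>N n\<close> only, and
    injectivity of \<open>\<theta>\<close> requires zero at the other exponents; \<open>H\<close>
    imposes both.\<close>
  define H where "H = {g :: ('j \<Rightarrow> nat) \<Rightarrow> 'm. \<forall>n'. g n' \<in> (if n' = n then N n else {\<zero>\<^bsub>M\<^esub>})}"
  define \<theta> where "\<theta> g = R.single 0 (\<epsilon> (g n))" for g :: "('j \<Rightarrow> nat) \<Rightarrow> 'm"
  have Hn: "g n \<in> N n" "n' \<noteq> n \<Longrightarrow> g n' = \<zero>\<^bsub>M\<^esub>" if "g \<in> H" for g n'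
    using that unfolding H_def by (auto dest: spec[of _ n] spec[of _ n'])
  have epsc: "\<epsilon> y \<in> carrier (Q 0)" if "y \<in> N n" for y
    using additive_map_closed[OF R.eps_additive] that unfolding E by blast
  have zero: "additive_subgroup {\<zero>\<^bsub>M\<^esub>} M" by (rule M.additive_subgroupI2) auto
  have Hsub: "additive_subgroup H Rees"
    unfolding H_def
  proof (rule prod_module_subgroup[OF M.abelian_group_axioms])
    show "additive_subgroup (if n' = n then N n else {\<zero>\<^bsub>M\<^esub>}) M" for n'
      using zero N_subgroup by simp
  qed
  have H0: "\<zero>\<^bsub>Rees\<^esub> \<in> H" by (rule additive_subgroup.zero_closed[OF Hsub])
  have \<theta>0: "\<theta> \<zero>\<^bsub>Rees\<^esub> = \<zero>\<^bsub>prod_module Q\<^esub>"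
    unfolding \<theta>_def R.single_eq_zero using R.eps_zero unfolding E by simp
  have natural: "koszul_diff (prod_module Q) (resolution_diff Q d) xs (\<lambda>l. \<theta> (w l)) = (\<lambda>l. \<theta> (kd w l)) \<and> (\<forall>l. kd w l \<in> H)"
    if w: "\<And>l. w l \<in> H" for w
  proof (rule koszul_diff_natural[OF rees.differential_module_axioms R.PQ.M.abelian_group_axioms Hsub H0 _ _ _ _ _ w])
    fix a g assume a: "a \<in> set xs" and g: "g \<in> H"
    have ac: "a \<in> carrier A" using a xs_carrier by blast
    show "a \<odot>\<^bsub>Rees\<^esub> g \<in> H"
      unfolding H_def
    proof (intro CollectI allI)
      fix n' show "(a \<odot>\<^bsub>Rees\<^esub> g) n' \<in> (if n' = n then N n else {\<zero>\<^bsub>M\<^esub>})"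
        using Hn[OF g] N_smult[OF ac] smult_r_null[OF ac] by (cases "n' = n") simp_all
    qed
    have "\<epsilon> (a \<odot>\<^bsub>M\<^esub> g n) = a \<odot>\<^bsub>Q 0\<^esub> \<epsilon> (g n)"
      using graded_hom_smult[OF R.eps_hom ac, of "g n"] Hn(1)[OF g] unfolding E by blast
    then show "\<theta> (a \<odot>\<^bsub>Rees\<^esub> g) = a \<odot>\<^bsub>prod_module Q\<^esub> \<theta> g"
      unfolding \<theta>_def R.smult_single[OF ac] by simp
  next
    fix g assume g: "g \<in> H"
    show "\<theta> g \<in> carrier (prod_module Q)" unfolding \<theta>_def by (rule R.single_carrier[OF epsc[OF Hn(1)[OF g]]])
    have "resolution_diff Q d (\<theta> g) = \<zero>\<^bsub>prod_module Q\<^esub>"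
      unfolding \<theta>_def R.dQ_single R.single_eq_zero using R.d_eps[of "g n"] Hn(1)[OF g] unfolding E by blast
    then show "\<theta> \<zero>\<^bsub>Rees\<^esub> = resolution_diff Q d (\<theta> g)" using \<theta>0 by simp
    fix h assume h: "h \<in> H"
    have "\<epsilon> (g n \<oplus>\<^bsub>M\<^esub> h n) = \<epsilon> (g n) \<oplus>\<^bsub>Q 0\<^esub> \<epsilon> (h n)"
      using additive_map_add[OF R.eps_additive, of "g n" "h n"] Hn(1)[OF g] Hn(1)[OF h] unfolding E by blast
    moreover have "\<zero>\<^bsub>Q k\<^esub> = \<zero>\<^bsub>Q k\<^esub> \<oplus>\<^bsub>Q k\<^esub> \<zero>\<^bsub>Q k\<^esub>" for k
      using abelian_monoid.l_zero[OF abelian_group.axioms(1)[OF R.Q_group] R.Q_zero] by simp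
    ultimately show "\<theta> (g \<oplus>\<^bsub>Rees\<^esub> h) = \<theta> g \<oplus>\<^bsub>prod_module Q\<^esub> \<theta> h"
      unfolding \<theta>_def resolution_single_def by (simp add: fun_eq_iff)
  qed
  have \<theta>inj: "g = \<zero>\<^bsub>Rees\<^esub>" if g: "g \<in> H" "\<theta> g = \<zero>\<^bsub>prod_module Q\<^esub>" for g
  proof
    fix n'
    have "\<epsilon> (g n) = \<epsilon> \<zero>\<^bsub>M\<^esub>" using g(2) R.eps_zero unfolding \<theta>_def R.single_eq_zero E by simp
    then have "g n = \<zero>\<^bsub>M\<^esub>"
      using inj_onD[OF R.eps_inj] Hn(1)[OF g(1)] additive_subgroup.zero_closed[OF N_subgroup] unfolding E by blast
    then show "g n' = \<zero>\<^bsub>Rees\<^esub> n'" using Hn(2)[OF g(1), of n'] by (cases "n' = n") simp_all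
  qed
  have partH: "rees_part n j \<nu> \<subseteq> H" for j \<nu>
  proof
    fix g assume "g \<in> rees_part n j \<nu>"
    then have "g n' \<in> (if n' = n \<and> j = 0 then N n \<inter> component M \<nu> else {\<zero>\<^bsub>M\<^esub>})" for n'
      unfolding rees_part_def by blast
    then have "g n' \<in> (if n' = n then N n else {\<zero>\<^bsub>M\<^esub>})" for n'
      using additive_subgroup.zero_closed[OF N_subgroup] by (smt (verit) IntD1 singletonD)
    then show "g \<in> H" unfolding H_def by blast
  qed
  have KH: "w l \<in> H" if "w \<in> K n j \<nu>" for w l j \<nu>
  proof -
    have "w l \<in> (if length l = length xs then rees_part n (j - twist l) (\<nu> + twist l) else {\<zero>\<^bsub>Rees\<^esub>})"
      using that unfolding koszul_chains_def by blast
    then show ?thesis using partH H0 by (auto split: if_splits)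
  qed
  have part\<theta>: "\<theta> g \<in> augmentation_part ?E Q \<epsilon> j \<nu>" if g: "g \<in> rees_part n j \<nu>" for g j \<nu>
  proof -
    have gn: "g n \<in> (if j = 0 then N n \<inter> component M \<nu> else {\<zero>\<^bsub>M\<^esub>})"
      using g unfolding rees_part_def by (auto dest: spec[of _ n])
    show ?thesis
      unfolding augmentation_part_def \<theta>_def resolution_single_def
      using gn R.eps_zero unfolding E by auto
  qed
  have lift: "\<exists>g\<in>rees_part n j \<nu>. \<theta> g = z" if z: "z \<in> augmentation_part ?E Q \<epsilon> j \<nu>" for z j \<nu>
  proof -
    have zk: "z k \<in> (if j = 0 \<and> k = 0 then \<epsilon> ` component ?E \<nu> else {\<zero>\<^bsub>Q k\<^esub>})" for k
      using z unfolding augmentation_part_def by blast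
    show ?thesis
    proof (cases "j = 0")
      case True
      then obtain e where e: "e \<in> N n \<inter> component M \<nu>" "z 0 = \<epsilon> e" using zk[of 0] unfolding E by auto
      have "spot n e \<in> rees_part n j \<nu>" unfolding rees_part_def at_index_def using e(1) True by simp
      moreover have "\<theta> (spot n e) = z"
      proof
        fix k show "\<theta> (spot n e) k = z k"
          using zk[of k] e(2) by (cases "k = 0") (simp_all add: \<theta>_def at_index_def resolution_single_def)
      qed
      ultimately show ?thesis by blast
    next
      case False
      then have "z = \<zero>\<^bsub>prod_module Q\<^esub>" using zk by (auto simp: fun_eq_iff)
      moreover have "\<zero>\<^bsub>Rees\<^esub> \<in> rees_part n j \<nu>"
        by (rule additive_subgroup.zero_closed[OF rees.subcomplexD(2)[OF rees_part_subcomplex]])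
      ultimately show ?thesis using \<theta>0 by blast
    qed
  qed
  show ?thesis
    unfolding acyclic_at_def
  proof (intro ballI impI)
    let ?KQ = "koszul_chains (prod_module Q) (length xs) (augmentation_part ?E Q \<epsilon>)"
    let ?dQ = "koszul_diff (prod_module Q) (resolution_diff Q d) xs"
    fix z assume z: "z \<in> ?KQ i \<mu>" "?dQ z = \<zero>\<^bsub>chain_module (prod_module Q)\<^esub>"
    have "\<forall>l. \<exists>g. g \<in> (if length l = length xs then rees_part n (i - twist l) (\<mu> + twist l) else {\<zero>\<^bsub>Rees\<^esub>}) \<and> \<theta> g = z l"
    proof
      fix l
      have zl: "z l \<in> (if length l = length xs then augmentation_part ?E Q \<epsilon> (i - twist l) (\<mu> + twist l) else {\<zero>\<^bsub>prod_module Q\<^esub>})"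
        using z(1) unfolding koszul_chains_def by blast
      show "\<exists>g. g \<in> (if length l = length xs then rees_part n (i - twist l) (\<mu> + twist l) else {\<zero>\<^bsub>Rees\<^esub>}) \<and> \<theta> g = z l"
      proof (cases "length l = length xs")
        case True
        then show ?thesis using lift[of "z l"] zl by auto
      next
        case False
        then have "z l = \<zero>\<^bsub>prod_module Q\<^esub>" using zl by simp
        then show ?thesis unfolding if_not_P[OF False] by (intro exI[of _ "\<zero>\<^bsub>Rees\<^esub>"] conjI singletonI) (simp only: \<theta>0)
      qed
    qed
    from choice[OF this] obtain e where e0: "\<forall>l. e l \<in> (if length l = length xs then rees_part n (i - twist l) (\<mu> + twist l) else {\<zero>\<^bsub>Rees\<^esub>}) \<and> \<theta> (e l) = z l" ..
    have e: "\<theta> (e l) = z l" for l by (rule conjunct2[OF spec[OF e0]])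
    have eK: "e \<in> K n i \<mu>" unfolding koszul_chains_def by (intro CollectI allI) (rule conjunct1[OF spec[OF e0]])
    note en = natural[of e, OF KH[OF eK]]
    \<comment> \<open>The lift \<open>e\<close> was chosen entry by entry; that it is a cocycle
      follows from naturality and from injectivity of \<open>\<theta>\<close> on
      \<open>H\<close>.\<close>
    have "kd e l = \<zero>\<^bsub>Rees\<^esub>" for l
    proof (rule \<theta>inj)
      have "\<theta> (kd e l) = ?dQ (\<lambda>l. \<theta> (e l)) l" by (rule fun_cong[OF conjunct1[OF en], symmetric])
      also have "\<dots> = \<zero>\<^bsub>prod_module Q\<^esub>" unfolding e z(2) chain_module_simps by (rule refl)
      finally show "\<theta> (kd e l) = \<zero>\<^bsub>prod_module Q\<^esub>" .
    qed (rule spec[OF conjunct2[OF en]])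
    then have "kd e = \<zero>\<^bsub>Ch\<^esub>" unfolding chain_module_simps by (rule ext)
    then obtain b where b: "b \<in> K n (i - 1) \<mu>" "kd b = e" by (rule bexE[OF acyclic_atD[OF ac eK]])
    have "?dQ (\<lambda>l. \<theta> (b l)) = (\<lambda>l. \<theta> (kd b l))" by (rule conjunct1[OF natural[of b, OF KH[OF b(1)]]])
    also have "\<dots> = z" unfolding b(2) e by (rule refl)
    finally have "?dQ (\<lambda>l. \<theta> (b l)) = z" .
    moreover have "(\<lambda>l. \<theta> (b l)) \<in> ?KQ (i - 1) \<mu>"
      unfolding koszul_chains_def
    proof (intro CollectI allI)
      fix l
      have "b l \<in> (if length l = length xs then rees_part n (i - 1 - twist l) (\<mu> + twist l) else {\<zero>\<^bsub>Rees\<^esub>})"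
        using b(1) unfolding koszul_chains_def by blast
      then show "\<theta> (b l) \<in> (if length l = length xs then augmentation_part ?E Q \<epsilon> (i - 1 - twist l) (\<mu> + twist l)
          else {\<zero>\<^bsub>prod_module Q\<^esub>})"
        using part\<theta> \<theta>0 by (cases "length l = length xs") (simp_all only: if_True if_False singleton_iff simp_thms)
    qed
    ultimately show "\<exists>b\<in>?KQ (i - 1) \<mu>. ?dQ b = z" by (rule bexI)
  qed
qed

text \<open>A list of length \<open>length xs\<close> has at most that many entries
  \<open>True\<close>, so there are no nonzero chains. This leaves finitely many \<open>i\<close> in
  the regularity, where the summand \<open>i\<close> would otherwise be unbounded.\<close>

lemma koszul_vanishing_above:
  assumes "int (length xs) < i" shows "acyclic_at Ch kd (K n) i \<mu>"
  unfolding acyclic_at_def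
proof (intro ballI impI)
  fix z assume z: "z \<in> K n i \<mu>"
  have "z l n' = \<zero>\<^bsub>M\<^esub>" for l n'
  proof -
    have "twist l \<le> int (length l)" unfolding twist_def using count_le_length[of l True] by simp
    then have "\<not> (length l = length xs \<and> n' = n \<and> i = twist l)" using assms by auto
    moreover have "z l n' \<in> (if length l = length xs \<and> n' = n \<and> i = twist l then N n \<inter> component M (\<mu> + twist l) else {\<zero>\<^bsub>M\<^esub>})"
      using z unfolding K_iff by blast
    ultimately show ?thesis by (simp only: if_False singleton_iff)
  qed
  then have "z = \<zero>\<^bsub>Ch\<^esub>" by (simp add: fun_eq_iff)
  then have "kd \<zero>\<^bsub>Ch\<^esub> = z" using kd_zero by simp
  then show "\<exists>b\<in>K n (i - 1) \<mu>. kd b = z" using additive_subgroup.zero_closed[OF K_subgroup] by blast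
qed

theorem regularity_bound:
  "\<exists>k k'. \<forall>n. supported n \<longrightarrow> regularity A (graded_submodule M (N n)) \<le> ereal (of_int (total n * k + k'))"
proof -
  obtain k k' where kk: "\<And>n i \<mu>. supported n \<Longrightarrow> total n * k + k' < \<mu> \<Longrightarrow> acyclic_at Ch kd (K n) i \<mu>"
    using koszul_vanishing by blast
  \<comment> \<open>\<open>length xs\<close> is added to the constant because it bounds the summand
    \<open>i\<close> of the regularity wherever cohomology is nonzero.\<close>
  have "regularity A (graded_submodule M (N n)) \<le> ereal (of_int (total n * k + (k' + int (length xs))))"
    if n: "supported n" for n
    unfolding regularity_def
  proof (rule SUP_least)
    let ?E = "graded_submodule M (N n)" and ?b = "total n * k + k'"
    fix i :: nat
    \<comment> \<open>Nonvanishing provides some resolution, and the transfer applies to any of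
      them, so resolutions need not be compared with each other.\<close>
    have bound: "i \<le> length xs \<and> \<mu> \<le> ?b" if nz: "local_cohomology_nonzero A (irrelevant_ideal A) i ?E \<mu>" for \<mu>
    proof (rule ccontr)
      assume neg: "\<not> (i \<le> length xs \<and> \<mu> \<le> ?b)"
      obtain Q :: "nat \<Rightarrow> ('a, ('a, 'm) universe) graded_module" and \<epsilon> d where
        r: "graded_injective_resolution A ?E Q \<epsilon> d"
          "\<not> trivial_group (cohomology_component (\<lambda>j. torsion_functor A (irrelevant_ideal A) (Q j)) d i \<mu>)"
        using nz unfolding local_cohomology_nonzero_def by blast
      have res: "injective_resolution A ?E Q \<epsilon> d xs"
        by (rule injective_resolution.intro[OF r(1) noetherian xs generators])
      have "acyclic_at Ch kd (K n) (int i) \<nu>" if "\<mu> \<le> \<nu>" for \<nu>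
      proof (cases "i \<le> length xs")
        case True
        then show ?thesis using neg that by (intro kk[OF n]) simp
      next
        case False
        then show ?thesis by (intro koszul_vanishing_above) simp
      qed
      then have "acyclic_at (chain_module (prod_module Q)) (koszul_diff (prod_module Q) (resolution_diff Q d) xs)
          (koszul_chains (prod_module Q) (length xs) (augmentation_part ?E Q \<epsilon>)) (int i) \<nu>" if "\<mu> \<le> \<nu>" for \<nu>
        using koszul_transfer[OF res] that by blast
      from injective_resolution.cohomology_trivial[OF res this] show False using r(2) by blast
    qed
    show "a_invariant A i ?E + ereal (of_nat i) \<le> ereal (of_int (total n * k + (k' + int (length xs))))"
    proof (cases "i \<le> length xs")
      case True
      have "a_invariant A i ?E \<le> ereal (of_int ?b)"
        unfolding a_invariant_def
      proof (rule Sup_least)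
        fix z assume "z \<in> {ereal (of_int \<mu>) | \<mu>. local_cohomology_nonzero A (irrelevant_ideal A) i ?E \<mu>}"
        then obtain \<mu> where \<mu>: "z = ereal (of_int \<mu>)" "local_cohomology_nonzero A (irrelevant_ideal A) i ?E \<mu>"
          by blast
        show "z \<le> ereal (of_int ?b)"
          unfolding \<mu>(1) ereal_less_eq of_int_le_iff using bound[OF \<mu>(2)] by (rule conjunct2)
      qed
      then have "a_invariant A i ?E + ereal (of_nat i) \<le> ereal (of_int ?b) + ereal (of_nat i)"
        by (rule add_right_mono)
      also have "\<dots> \<le> ereal (of_int (total n * k + (k' + int (length xs))))" using True by simp
      finally show ?thesis .
    next
      case False
      then have "\<not> local_cohomology_nonzero A (irrelevant_ideal A) i ?E \<mu>" for \<mu> using bound by blast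
      \<comment> \<open>An empty supremum in \<open>ereal\<close> is its least element, and adding
        the finite \<open>i\<close> does not change it.\<close>
      then have "a_invariant A i ?E = - \<infinity>" unfolding a_invariant_def by (simp add: bot_ereal_def)
      then show ?thesis by simp
    qed
  qed
  then show ?thesis by blast
qed

end

section \<open>Products of powers of ideals\<close>

context graded_ring
begin

lemma power_product_cong:
  assumes "\<And>j. j \<in> {1..t} \<Longrightarrow> ideal (I j) A" "\<And>j. j \<in> {1..t} \<Longrightarrow> n j = n' j"
  shows "power_product A t I n = power_product A t I n'"
proof -
  interpret S: comm_monoid "ideals_set A" by (rule ideals_set_is_comm_monoid)
  have c: "I j \<in> carrier (ideals_set A)" if "j \<in> {1..t}" for j using assms(1)[OF that] by (simp add: ideals_set_def)
  show ?thesis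
    unfolding power_product_def
    by (rule S.finprod_cong') (use assms(2) c in \<open>auto intro: S.nat_pow_closed\<close>)
qed

lemma power_product_zero: "power_product A t I (\<lambda>_. 0) = carrier A"
proof -
  interpret S: comm_monoid "ideals_set A" by (rule ideals_set_is_comm_monoid)
  have "power_product A t I (\<lambda>_. 0) = \<one>\<^bsub>ideals_set A\<^esub>" unfolding power_product_def by simp
  then show ?thesis by (simp add: ideals_set_def)
qed

lemma power_product_ideal:
  assumes "\<And>j. j \<in> {1..t} \<Longrightarrow> ideal (I j) A" shows "ideal (power_product A t I n) A"
proof -
  interpret S: comm_monoid "ideals_set A" by (rule ideals_set_is_comm_monoid)
  have c: "I j \<in> carrier (ideals_set A)" if "j \<in> {1..t}" for j using assms(1)[OF that] by (simp add: ideals_set_def)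
  have "power_product A t I n \<in> carrier (ideals_set A)"
    unfolding power_product_def by (rule S.finprod_closed) (use c in \<open>auto intro: S.nat_pow_closed\<close>)
  then show ?thesis by (simp add: ideals_set_def)
qed

lemma power_product_Suc:
  assumes I: "\<And>j. j \<in> {1..t} \<Longrightarrow> ideal (I j) A" and j: "j \<in> {1..t}"
  shows "power_product A t I (n(j := Suc (n j))) = I j \<cdot>\<^bsub>A\<^esub> power_product A t I n"
proof -
  let ?S = "ideals_set A"
  interpret S: comm_monoid ?S by (rule ideals_set_is_comm_monoid)
  have c: "I k \<in> carrier ?S" if "k \<in> {1..t}" for k using I[OF that] by (simp add: ideals_set_def)
  have pc: "I k [^]\<^bsub>?S\<^esub> m \<in> carrier ?S" if "k \<in> {1..t}" for k and m :: nat
    by (rule S.nat_pow_closed[OF c[OF that]])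
  let ?R = "{1..t} - {j}"
  have set: "{1..t} = insert j ?R" using j by blast
  have split: "power_product A t I m = I j [^]\<^bsub>?S\<^esub> m j \<otimes>\<^bsub>?S\<^esub> (\<Otimes>\<^bsub>?S\<^esub>k\<in>?R. I k [^]\<^bsub>?S\<^esub> m k)" for m
    unfolding power_product_def by (subst set, rule S.finprod_insert) (use pc j in auto)
  have rest: "(\<Otimes>\<^bsub>?S\<^esub>k\<in>?R. I k [^]\<^bsub>?S\<^esub> (n(j := Suc (n j))) k) = (\<Otimes>\<^bsub>?S\<^esub>k\<in>?R. I k [^]\<^bsub>?S\<^esub> n k)"
    by (rule S.finprod_cong') (use pc in auto)
  have restc: "(\<Otimes>\<^bsub>?S\<^esub>k\<in>?R. I k [^]\<^bsub>?S\<^esub> n k) \<in> carrier ?S"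
    by (rule S.finprod_closed) (use pc in auto)
  have "power_product A t I (n(j := Suc (n j))) = I j \<otimes>\<^bsub>?S\<^esub> power_product A t I n"
    unfolding split rest using c[OF j] pc[OF j] restc by (simp add: S.m_ac)
  then show ?thesis by (simp add: ideals_set_def)
qed

end

lemma (in module) module_span_submodule:
  assumes "S \<subseteq> carrier M" shows "submodule (module_span R M S) R M"
proof (rule submoduleI)
  have sub: "module_span R M S \<subseteq> L" if "submodule L R M" "S \<subseteq> L" for L
    unfolding module_span_def using that by blast
  show "module_span R M S \<subseteq> carrier M" by (rule sub[OF carrier_is_submodule assms])
  have mem: "x \<in> module_span R M S" if "\<And>L. submodule L R M \<Longrightarrow> S \<subseteq> L \<Longrightarrow> x \<in> L" for x
    unfolding module_span_def using that by blast
  show "\<zero>\<^bsub>M\<^esub> \<in> module_span R M S"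
    by (rule mem) (rule additive_subgroup.zero_closed[OF additive_subgroupI[OF submodule.axioms(1)]])
  show "\<ominus>\<^bsub>M\<^esub> a \<in> module_span R M S" if "a \<in> module_span R M S" for a
    by (rule mem) (use sub that submoduleE(3) in blast)
  show "a \<oplus>\<^bsub>M\<^esub> b \<in> module_span R M S" if "a \<in> module_span R M S" "b \<in> module_span R M S" for a b
    by (rule mem) (use sub that submoduleE(5) in blast)
  show "a \<odot>\<^bsub>M\<^esub> x \<in> module_span R M S" if "a \<in> carrier R" "x \<in> module_span R M S" for a x
    by (rule mem) (use sub that submoduleE(4) in blast)
qed

theorem corollary5p3p4:
  fixes A :: "'a graded_ring"
    and M :: "('a, 'm) graded_module"
    and I :: "nat \<Rightarrow> 'a set"
    and t :: nat
  assumes "noetherian_ring A"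
    and "standard_graded A"
    and "artinian_ring (degree_zero_ring A)"
    and "local_ring (degree_zero_ring A)"
    and "t \<ge> 1"
    and "\<And>j. j \<in> {1..t} \<Longrightarrow> homogeneous_ideal A (I j)"
    and "graded_module A M"
    and "nat_graded M"
    and "fin_gen_module A M"
  shows "\<exists>k k' :: int. \<forall>n :: nat \<Rightarrow> nat.
    regularity A (ideal_times_module A (power_product A t I n) M)
      \<le> ereal (of_int ((\<Sum>j=1..t. int (n j)) * k + k'))"
proof -
  interpret graded_module A M by (rule assms(7))
  obtain X1 where X1: "X1 \<subseteq> degree_part A 1" "finite X1" "generate_ring A (degree_part A 0 \<union> X1) = carrier A"
    using assms(2) unfolding standard_graded_def by blast
  obtain xs where xs: "set xs = X1" using finite_list[OF X1(2)] by blast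
  obtain Ms where Ms: "Ms \<subseteq> carrier M" "finite Ms" "module_span A M Ms = carrier M"
    using assms(9) unfolding fin_gen_module_def by blast
  have I: "ideal (I j) A" if "j \<in> {1..t}" for j
    using assms(6)[OF that] unfolding homogeneous_ideal_def by blast
  \<comment> \<open>The finite generating set is taken inside a homogeneous one, so that each
    generator has a degree and its shift is a homogeneous operator.\<close>
  have "\<forall>j\<in>{1..t}. \<exists>F. finite F \<and> F \<subseteq> (\<Union>n. degree_part A n) \<and> I j = Idl\<^bsub>A\<^esub> F"
  proof
    fix j assume "j \<in> {1..t}"
    then obtain S where S: "S \<subseteq> (\<Union>n. degree_part A n)" "I j = Idl\<^bsub>A\<^esub> S"
      using assms(6) unfolding homogeneous_ideal_def by blast
    have "S \<subseteq> carrier A" using S(1) degree_part_carrier by blast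
    then obtain F where "F \<subseteq> S" "finite F" "Idl\<^bsub>A\<^esub> F = Idl\<^bsub>A\<^esub> S" using finite_ideal_generators[OF assms(1)] by blast
    then show "\<exists>F. finite F \<and> F \<subseteq> (\<Union>n. degree_part A n) \<and> I j = Idl\<^bsub>A\<^esub> F" using S by blast
  qed
  from bchoice[OF this] obtain F where F: "\<And>j. j \<in> {1..t} \<Longrightarrow> finite (F j)"
    "\<And>j. j \<in> {1..t} \<Longrightarrow> F j \<subseteq> (\<Union>n. degree_part A n)" "\<And>j. j \<in> {1..t} \<Longrightarrow> I j = Idl\<^bsub>A\<^esub> (F j)" by blast
  have Fc: "F j \<subseteq> carrier A" if "j \<in> {1..t}" for j using F(2)[OF that] degree_part_carrier by blast
  define fs where "fs = Sigma {1..t} F"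
  \<comment> \<open>A nonzero homogeneous generator has exactly one degree, whereas zero has every
    degree; hence the choice.\<close>
  define \<delta> where "\<delta> jf = (SOME m. snd jf \<in> degree_part A m)" for jf :: "nat \<times> 'a"
  define G where "G n = {a \<odot>\<^bsub>M\<^esub> x | a x. a \<in> power_product A t I n \<and> x \<in> carrier M}" for n
  define N where "N n = module_span A M (G n)" for n
  have J: "ideal (power_product A t I n) A" for n by (rule power_product_ideal) (rule I)
  have prod_Suc: "power_product A t I (n(j := Suc (n j))) = I j \<cdot>\<^bsub>A\<^esub> power_product A t I n" if "j \<in> {1..t}" for j n
    by (rule power_product_Suc) (use I that in blast)+
  have Gc: "G n \<subseteq> carrier M" for n unfolding G_def using ideal.Icarr[OF J] by blast
  have Nsub: "submodule (N n) A M" for n unfolding N_def by (rule module_span_submodule[OF Gc])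
  have GN: "a \<odot>\<^bsub>M\<^esub> x \<in> N n" if "a \<in> power_product A t I n" "x \<in> carrier M" for a x n
    unfolding N_def module_span_def using that unfolding G_def by blast
  have Nmin: "N n \<subseteq> U" if "submodule U A M" "\<And>a x. a \<in> power_product A t I n \<Longrightarrow> x \<in> carrier M \<Longrightarrow> a \<odot>\<^bsub>M\<^esub> x \<in> U" for n U
  proof -
    have "G n \<subseteq> U" unfolding G_def using that(2) by blast
    then show ?thesis unfolding N_def module_span_def using that(1) by blast
  qed
  have rees: "rees_module A M xs Ms {1..t} fs \<delta> N"
  proof (intro rees_module.intro rees_module_axioms.intro assms(1,7) Ms Nsub)
    show "set xs \<subseteq> degree_part A 1" "generate_ring A (degree_part A 0 \<union> set xs) = carrier A"
      unfolding xs by (rule X1)+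
    show "finite {1..t}" by simp
    show "finite fs" unfolding fs_def using F(1) by blast
    show "N (\<lambda>_. 0) = carrier M"
    proof
      show "N (\<lambda>_. 0) \<subseteq> carrier M" using submoduleE(1)[OF Nsub] .
      have "\<one>\<^bsub>A\<^esub> \<odot>\<^bsub>M\<^esub> x \<in> N (\<lambda>_. 0)" if "x \<in> carrier M" for x
        by (rule GN[OF _ that]) (simp add: power_product_zero)
      then show "carrier M \<subseteq> N (\<lambda>_. 0)" by auto
    qed
  next
    fix j f assume "(j, f) \<in> fs"
    then have jf: "j \<in> {1..t}" "f \<in> F j" unfolding fs_def by blast+
    show "j \<in> {1..t}" by (rule jf(1))
    have "\<exists>m. snd (j, f) \<in> degree_part A m" using F(2)[OF jf(1)] jf(2) by auto
    from someI_ex[OF this] show "f \<in> degree_part A (\<delta> (j, f))" unfolding \<delta>_def by simp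
    have fc: "f \<in> carrier A" using Fc jf by blast
    fix n y assume y: "y \<in> N n"
    \<comment> \<open>\<open>N n\<close> is a span, so it is enough that the \<open>y\<close>
      satisfying the claim form a submodule that contains the products \<open>a x\<close>.\<close>
    let ?U = "{y \<in> carrier M. f \<odot>\<^bsub>M\<^esub> y \<in> N (n(j := Suc (n j)))}"
    note E = submoduleE[OF Nsub[of "n(j := Suc (n j))"]]
    have "N n \<subseteq> ?U"
    proof (rule Nmin)
      show "submodule ?U A M"
      proof (rule submoduleI)
        show "\<zero>\<^bsub>M\<^esub> \<in> ?U"
          using additive_subgroup.zero_closed[OF additive_subgroupI[OF submodule.axioms(1)[OF Nsub]]] fc by simp
      next
        fix a y assume a: "a \<in> carrier A" and y: "y \<in> ?U"
        have "f \<odot>\<^bsub>M\<^esub> (a \<odot>\<^bsub>M\<^esub> y) = a \<odot>\<^bsub>M\<^esub> (f \<odot>\<^bsub>M\<^esub> y)"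
          using a fc y m_comm[OF a fc] by (simp add: smult_assoc1[symmetric])
        then show "a \<odot>\<^bsub>M\<^esub> y \<in> ?U" using E(4)[OF a] a y by simp
      qed (use E(3,5) fc in \<open>auto simp: smult_r_distr smult_r_minus\<close>)
    next
      fix a x assume a: "a \<in> power_product A t I n" and x: "x \<in> carrier M"
      have ac: "a \<in> carrier A" using ideal.Icarr[OF J a] .
      have "f \<in> I j" using F(3)[OF jf(1)] genideal_self[OF Fc[OF jf(1)]] jf(2) by blast
      then have "f \<otimes>\<^bsub>A\<^esub> a \<in> power_product A t I (n(j := Suc (n j)))"
        unfolding prod_Suc[OF jf(1)] using a by (rule ideal_prod.prod)
      from GN[OF this x] show "a \<odot>\<^bsub>M\<^esub> x \<in> ?U" using ac fc x by (simp add: smult_assoc1)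
    qed
    then show "f \<odot>\<^bsub>M\<^esub> y \<in> N (n(j := Suc (n j)))" using y by blast
  next
    fix n j U assume j: "j \<in> {1..t}" and U: "submodule U A M"
      and gen: "\<And>f y. (j, f) \<in> fs \<Longrightarrow> y \<in> N n \<Longrightarrow> f \<odot>\<^bsub>M\<^esub> y \<in> U"
    note E = submoduleE[OF U]
    \<comment> \<open>The scalars that carry \<open>N n\<close> into \<open>U\<close> form an ideal;
      it contains the generators of \<open>I j\<close>, hence \<open>I j\<close> itself.\<close>
    let ?L = "{r \<in> carrier A. \<forall>y\<in>N n. r \<odot>\<^bsub>M\<^esub> y \<in> U}"
    have Nc: "y \<in> carrier M" if "y \<in> N n" for y using submoduleE(1)[OF Nsub] that by blast
    have "ideal ?L A"
    proof (rule idealI2)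
      show "additive_subgroup ?L A"
        by (rule abelian_group.additive_subgroupI2[OF ring.axioms(1)[OF ring_axioms]])
          (use E(3,5) Nc additive_subgroup.zero_closed[OF additive_subgroupI[OF submodule.axioms(1)[OF U]]]
            in \<open>auto simp: smult_l_distr smult_l_minus\<close>)
      fix r b assume "r \<in> ?L" "b \<in> carrier A"
      then show "b \<otimes>\<^bsub>A\<^esub> r \<in> ?L" using E(4) Nc by (simp add: smult_assoc1)
    qed
    moreover have "F j \<subseteq> ?L" using gen Fc[OF j] j unfolding fs_def by blast
    ultimately have IL: "I j \<subseteq> ?L" unfolding F(3)[OF j] by (rule genideal_minimal)
    show "N (n(j := Suc (n j))) \<subseteq> U"
    proof (rule Nmin[OF U])
      fix a x assume "a \<in> power_product A t I (n(j := Suc (n j)))" and x: "x \<in> carrier M"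
      then have "a \<in> I j \<cdot>\<^bsub>A\<^esub> power_product A t I n" unfolding prod_Suc[OF j] by blast
      then have "a \<in> carrier A \<and> a \<odot>\<^bsub>M\<^esub> x \<in> U"
      proof induction
        case (prod r b)
        then have r: "r \<in> ?L" "b \<in> carrier A" using IL ideal.Icarr[OF J] by blast+
        have "r \<odot>\<^bsub>M\<^esub> (b \<odot>\<^bsub>M\<^esub> x) \<in> U" using r(1) GN[OF prod(2) x] by blast
        then show ?case using r x by (simp add: smult_assoc1)
      next
        case (sum s1 s2)
        then show ?case using E(5) x by (simp add: smult_l_distr)
      qed
      then show "a \<odot>\<^bsub>M\<^esub> x \<in> U" by blast
    qed
  qed
  then interpret rees: rees_module A M xs Ms "{1..t}" fs \<delta> N .
  obtain k k' where kk: "\<And>n. rees.supported n \<Longrightarrow>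
      regularity A (graded_submodule M (N n)) \<le> ereal (of_int (rees.total n * k + k'))"
    using rees.regularity_bound by blast
  have "regularity A (ideal_times_module A (power_product A t I n) M)
      \<le> ereal (of_int ((\<Sum>j=1..t. int (n j)) * k + k'))" for n
  proof -
    \<comment> \<open>\<open>n\<close> is an arbitrary function on the naturals; truncating it
      outside \<open>{1..t}\<close> makes it \<open>supported\<close> and changes neither the
      product of powers nor the sum.\<close>
    let ?n = "\<lambda>j. if j \<in> {1..t} then n j else 0"
    have "power_product A t I n = power_product A t I ?n"
      by (rule power_product_cong[where I = I, OF I]) simp_all
    then have "ideal_times_module A (power_product A t I n) M = graded_submodule M (N ?n)"
      unfolding ideal_times_module_def N_def G_def by simp
    moreover have "rees.supported ?n" unfolding rees.supported_def by simp
    moreover have "rees.total ?n = (\<Sum>j=1..t. int (n j))" unfolding rees.total_def by (rule sum.cong) auto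
    ultimately show ?thesis using kk[of ?n] by simp
  qed
  then show ?thesis by blast
qed

end
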